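(* There exist a countably connected domain $D \subset \hat{\mathbb{C}}$ and an exhaustion $\Phi=(D_j)$ of $D$ such that the associated sequence $(f_j)$ of normalized conformal maps $f_j : D_j \to \tilde D_j$ onto circle domains converges locally uniformly in $D$ to a conformal map $f_\Phi : D \to f_\Phi(D)$, and $f_\Phi(D)$ is not a circle domain.
   Context: $\hat{\mathbb{C}}$ is the Riemann sphere; a domain is a connected open set. For a domain $G\subset\hat{\mathbb{C}}$, $\mathcal{C}(G)$ denotes the set of connected components of $\hat{\mathbb{C}}\setminus G$; $G$ is countably connected if $\mathcal{C}(G)$ is (at most) countable. A circle domain is a domain $G$ such that every element of $\mathcal{C}(G)$ is a closed disk or a point. An exhaustion of a domain $D\subset\hat{\mathbb{C}}$ is a sequence $\Phi=(D_j)_{j\ge 1}$ of domains $D_j\subset D$, each bounded by finitely many disjoint Jordan curves in $D$, with $D_j\subset D_{j+1}$ for all $j$ and $D=\bigcup_j D_j$. Fix distinct points $a_0,a_1,a_2\in D_1$. By Koebe's theorem, for each $j$ there is a unique conformal map $f_j:D_j\to\tilde D_j$ onto a circle domain $\tilde D_j\subset\hat{\mathbb{C}}$ with $f_j(a_k)=a_k$ for $k=0,1,2$. The sequence $(f_j)$ always has subsequences converging locally uniformly in $D$ to conformal maps; if the whole sequence converges, its limit is denoted $f_\Phi$. *)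

theory Defs
  imports "HOL-Analysis.Analysis"
begin

section \<open>The Riemann sphere\<close>

datatype riemann_sphere = Fin complex | Infty

text \<open>Inverse stereographic projection onto the unit sphere of \<open>\<complex> \<times> \<real>\<close>; the chordal
  metric is the Euclidean metric pulled back along it. The sphere has diameter 2.\<close>

fun stereo :: "riemann_sphere \<Rightarrow> complex \<times> real" where
  "stereo (Fin z) = (complex_of_real (2 / (1 + (norm z)\<^sup>2)) * z, ((norm z)\<^sup>2 - 1) / ((norm z)\<^sup>2 + 1))"
| "stereo Infty = (0, 1)"

lemma stereo_snd_ne_1: "((norm (z::complex))\<^sup>2 - 1) / ((norm z)\<^sup>2 + 1) \<noteq> 1"
proof -
  have "(norm z)\<^sup>2 + 1 > 0" by (simp add: add_nonneg_pos)
  then show ?thesis by (simp add: divide_simps)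
qed

lemma inj_stereo: "inj stereo"
proof (rule injI)
  fix p q assume eq: "stereo p = stereo q"
  have key: "z = w" if "stereo (Fin z) = stereo (Fin w)" for z w
  proof -
    define r s where "r = (norm z)\<^sup>2" and "s = (norm w)\<^sup>2"
    have nonneg: "r \<ge> 0" "s \<ge> 0" by (simp_all add: r_def s_def)
    have fst_eq: "complex_of_real (2 / (1 + r)) * z = complex_of_real (2 / (1 + s)) * w"
      and snd_eq: "(r - 1) / (r + 1) = (s - 1) / (s + 1)"
      using that unfolding r_def s_def by (simp_all only: stereo.simps prod.inject)
    have "(r - 1) * (s + 1) = (s - 1) * (r + 1)"
      using snd_eq nonneg by (simp add: frac_eq_eq)
    then have "r = s" by (simp add: algebra_simps)
    moreover have "complex_of_real (2 / (1 + s)) \<noteq> 0"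
      using nonneg by (simp only: of_real_eq_0_iff) simp
    ultimately show ?thesis using fst_eq by (metis mult_left_cancel)
  qed
  show "p = q"
  proof (cases p)
    case p: (Fin z)
    show ?thesis
    proof (cases q)
      case (Fin w)
      then show ?thesis using key eq p by blast
    next
      case Infty
      then show ?thesis using eq p stereo_snd_ne_1[of z] by (metis stereo.simps prod.inject)
    qed
  next
    case p: Infty
    show ?thesis
    proof (cases q)
      case (Fin w)
      then show ?thesis using eq p stereo_snd_ne_1[of w] by (metis stereo.simps prod.inject)
    qed (simp only: p)
  qed
qed

lemma range_stereo: "range stereo = sphere 0 1"
proof (intro equalityI subsetI)
  fix x assume "x \<in> range stereo"
  then obtain p where p: "x = stereo p" by blast
  show "x \<in> sphere 0 1"
  proof (cases p)
    case (Fin z)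
    define r where "r = (norm z)\<^sup>2"
    have r: "r \<ge> 0" unfolding r_def by simp
    have "(norm x)\<^sup>2 = (2 / (1 + r))\<^sup>2 * r + ((r - 1) / (r + 1))\<^sup>2"
      unfolding p Fin r_def
      by (simp only: stereo.simps norm_prod_def fst_conv snd_conv norm_mult norm_of_real
          real_norm_def power_mult_distrib power2_abs real_sqrt_pow2 add_nonneg_nonneg
          zero_le_power2 mult_nonneg_nonneg)
    also have "\<dots> = (4 * r + (r - 1)\<^sup>2) / (r + 1)\<^sup>2"
      by (simp add: power_divide add_divide_distrib add.commute)
    also have "4 * r + (r - 1)\<^sup>2 = (r + 1)\<^sup>2"
      by (simp add: power2_eq_square algebra_simps)
    also have "(r + 1)\<^sup>2 / (r + 1)\<^sup>2 = 1"
      using r by simp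
    finally have "norm x = 1" using norm_ge_zero[of x] by (simp add: power2_eq_1_iff)
    then show ?thesis by simp
  qed (simp add: p norm_Pair)
next
  fix x :: "complex \<times> real" assume "x \<in> sphere 0 1"
  obtain w t where x: "x = (w, t)" by (cases x)
  have "sqrt ((norm w)\<^sup>2 + t\<^sup>2) = 1"
    using \<open>x \<in> sphere 0 1\<close> by (simp add: x norm_Pair)
  then have n: "(norm w)\<^sup>2 = 1 - t\<^sup>2" by simp
  show "x \<in> range stereo"
  proof (cases "t = 1")
    case True
    then have "x = stereo Infty" using n by (simp add: x)
    then show ?thesis by blast
  next
    case False
    define z where "z = w / complex_of_real (1 - t)"
    have "(norm z)\<^sup>2 = (1 - t\<^sup>2) / (1 - t)\<^sup>2"
      unfolding z_def norm_divide norm_of_real power_divide n by simp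
    also have "\<dots> = (1 + t) / (1 - t)"
      using False by (simp add: divide_simps power2_eq_square) (simp add: algebra_simps)
    finally have z2: "(norm z)\<^sup>2 = (1 + t) / (1 - t)" .
    have a: "2 / (1 + (norm z)\<^sup>2) = 1 - t"
      unfolding z2 using False by (simp add: divide_simps)
    have b: "((norm z)\<^sup>2 - 1) / ((norm z)\<^sup>2 + 1) = t"
      unfolding z2 using False by (simp add: divide_simps)
    have "x = stereo (Fin z)"
      unfolding stereo.simps a b x using False by (simp add: z_def)
    then show ?thesis by blast
  qed
qed

instantiation riemann_sphere :: metric_space
begin

definition dist_riemann_sphere :: "riemann_sphere \<Rightarrow> riemann_sphere \<Rightarrow> real" where
  "dist_riemann_sphere p q = dist (stereo p) (stereo q)"

definition uniformity_riemann_sphere :: "(riemann_sphere \<times> riemann_sphere) filter" where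
  "uniformity_riemann_sphere = (INF e\<in>{0<..}. principal {(p, q). dist p q < e})"

definition open_riemann_sphere :: "riemann_sphere set \<Rightarrow> bool" where
  "open_riemann_sphere U \<longleftrightarrow> (\<forall>p\<in>U. \<forall>\<^sub>F (p', q) in uniformity. p' = p \<longrightarrow> q \<in> U)"

instance
proof
  fix p q r :: riemann_sphere
  show "dist p q = 0 \<longleftrightarrow> p = q"
    using inj_stereo by (auto simp: dist_riemann_sphere_def inj_eq)
  show "dist p q \<le> dist p r + dist q r"
    unfolding dist_riemann_sphere_def by (rule dist_triangle2)
qed (simp_all only: uniformity_riemann_sphere_def open_riemann_sphere_def)

end

section \<open>Holomorphic and conformal maps\<close>

fun sphere_inversion :: "riemann_sphere \<Rightarrow> riemann_sphere" where
  "sphere_inversion (Fin z) = (if z = 0 then Infty else Fin (1 / z))"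
| "sphere_inversion Infty = Fin 0"

text \<open>The value at \<open>Infty\<close> is a dummy.\<close>

fun fin_part :: "riemann_sphere \<Rightarrow> complex" where
  "fin_part (Fin z) = z"
| "fin_part Infty = 0"

text \<open>Holomorphy with respect to the atlas with the two charts \<open>z\<close> and \<open>1 / z\<close>: \<open>\<alpha>\<close>
  selects the chart in the source and \<open>\<beta>\<close> the one in the target. Intended for open \<open>U\<close>.\<close>

definition sphere_holomorphic_on :: "(riemann_sphere \<Rightarrow> riemann_sphere) \<Rightarrow> riemann_sphere set \<Rightarrow> bool" where
  "sphere_holomorphic_on f U \<longleftrightarrow> continuous_on U f \<and>
     (\<forall>\<alpha>\<in>{id, sphere_inversion}. \<forall>\<beta>\<in>{id, sphere_inversion}.
        (\<lambda>z. fin_part (\<beta> (f (\<alpha> (Fin z)))))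
          holomorphic_on {z. \<alpha> (Fin z) \<in> U \<and> \<beta> (f (\<alpha> (Fin z))) \<noteq> Infty})"

definition conformal_on :: "(riemann_sphere \<Rightarrow> riemann_sphere) \<Rightarrow> riemann_sphere set \<Rightarrow> bool" where
  "conformal_on f U \<longleftrightarrow> sphere_holomorphic_on f U \<and> inj_on f U"

section \<open>Circle domains and exhaustions\<close>

definition sphere_domain :: "riemann_sphere set \<Rightarrow> bool" where
  "sphere_domain G \<longleftrightarrow> open G \<and> connected G \<and> G \<noteq> {}"

definition countably_connected :: "riemann_sphere set \<Rightarrow> bool" where
  "countably_connected G \<longleftrightarrow> countable (components (- G))"

text \<open>The closed disks of the sphere, i.e. the sets bounded by a circle or a line together with
  \<open>Infty\<close>, are the proper nondegenerate spherical caps, which are the closed chordal balls of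
  radius strictly between 0 and the diameter 2.\<close>

definition closed_disk :: "riemann_sphere set \<Rightarrow> bool" where
  "closed_disk S \<longleftrightarrow> (\<exists>p r. 0 < r \<and> r < 2 \<and> S = cball p r)"

definition circle_domain :: "riemann_sphere set \<Rightarrow> bool" where
  "circle_domain G \<longleftrightarrow> sphere_domain G \<and>
     (\<forall>C\<in>components (- G). closed_disk C \<or> (\<exists>p. C = {p}))"

definition jordan_curve :: "riemann_sphere set \<Rightarrow> bool" where
  "jordan_curve J \<longleftrightarrow> (\<exists>\<gamma>. simple_path \<gamma> \<and> pathfinish \<gamma> = pathstart \<gamma> \<and> J = path_image \<gamma>)"

text \<open>Exhaustions are indexed from 0: \<open>\<Phi> 0\<close> is the first domain of the sequence.\<close>

definition exhaustion :: "riemann_sphere set \<Rightarrow> (nat \<Rightarrow> riemann_sphere set) \<Rightarrow> bool" where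
  "exhaustion D \<Phi> \<longleftrightarrow>
     (\<forall>j. sphere_domain (\<Phi> j) \<and> \<Phi> j \<subseteq> D \<and>
        (\<exists>\<J>. finite \<J> \<and> pairwise disjnt \<J> \<and> (\<forall>J\<in>\<J>. jordan_curve J \<and> J \<subseteq> D) \<and>
             frontier (\<Phi> j) = \<Union>\<J>)) \<and>
     (\<forall>j. \<Phi> j \<subseteq> \<Phi> (Suc j)) \<and>
     D = (\<Union>j. \<Phi> j)"

text \<open>Koebe's theorem provides such a map for a finitely connected domain \<open>G\<close>, and its values
  on \<open>G\<close> are determined uniquely; the values outside \<open>G\<close> are irrelevant.\<close>

definition normalized_koebe_map ::
  "riemann_sphere \<Rightarrow> riemann_sphere \<Rightarrow> riemann_sphere \<Rightarrow> riemann_sphere set \<Rightarrow>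
     (riemann_sphere \<Rightarrow> riemann_sphere) \<Rightarrow> bool" where
  "normalized_koebe_map a0 a1 a2 G f \<longleftrightarrow>
     conformal_on f G \<and> circle_domain (f ` G) \<and> f a0 = a0 \<and> f a1 = a1 \<and> f a2 = a2"

text \<open>For an exhaustion \<open>\<Phi>\<close> of \<open>D\<close> and maps \<open>f j\<close> that are only meaningful on \<open>\<Phi> j\<close>,
  this is independent of the values of \<open>f j\<close> off \<open>\<Phi> j\<close>: every point of \<open>D\<close> has a neighbourhood
  contained in all but finitely many \<open>\<Phi> j\<close>, to which \<open>U\<close> may be shrunk.\<close>

definition locally_uniform_limit ::
  "riemann_sphere set \<Rightarrow> (nat \<Rightarrow> riemann_sphere \<Rightarrow> riemann_sphere) \<Rightarrow>
     (riemann_sphere \<Rightarrow> riemann_sphere) \<Rightarrow> bool" where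
  "locally_uniform_limit D f g \<longleftrightarrow>
     (\<forall>p\<in>D. \<exists>U. open U \<and> p \<in> U \<and> U \<subseteq> D \<and> uniform_limit U f g sequentially)"

end

theory Submission
  imports Defs "HOL-Complex_Analysis.Complex_Analysis" "HOL-Real_Asymp.Real_Asymp"
begin

text \<open>
  The domain is the slit plane \<open>D = \<complex> - (-\<infinity>, 0]\<close>, and it is exhausted by ring domains. Such a ring
  domain is a large Jordan domain of \<open>D\<close> from which a thin closed neighbourhood of a long arc, hugging
  the lower side of the slit, has been removed. As the arc is pushed into the slit, the ring
  domains fill \<open>D\<close>, but the arc never becomes negligible: seen from the point 1, it carries about
  half of the harmonic measure. Koebe's map sends a ring domain to a ring bounded by two circles.
  In the limit one circle represents the upper side of the slit and the other one the lower side,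
  so both circles must touch, and the limit map sends \<open>D\<close> onto the complement of two tangent disks.
  After a Moebius transformation the tangent point is \<open>\<infinity>\<close>, the image is the strip \<open>|Im z| < \<pi>\<close>,
  and the limit map is the principal logarithm. The complement of the strip in the sphere is
  connected and neither a disk nor a point.

  To have Koebe's maps explicitly, the construction starts from their inverses. For every period
  \<open>P\<close> there is a \<open>P\<close>-periodic map \<open>strip_map\<close> from the strip \<open>|Im s| < \<pi>\<close> into the slit plane that is
  injective modulo the period, and \<open>strip_map\<close> tends to \<open>exp\<close> as \<open>P\<close> tends to \<open>\<infinity>\<close>
  (\<open>strip_map_inj\<close>, \<open>strip_map_avoids_nonpos_Reals\<close>, \<open>strip_map_tendsto_exp\<close>). The strip modulo its
  period is a round annulus, via \<open>wrap s = P / (2 \<pi> \<i>) (exp (2 \<pi> \<i> s / P) - 1)\<close>, which tends to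
  the identity. Hence the image of a slightly narrower strip under \<open>strip_map\<close> is a ring domain
  bounded by two Jordan curves, \<open>annulus_map = wrap \<circ> strip_map\<^sup>-\<^sup>1\<close> maps it onto a round annulus, and
  \<open>annulus_map\<close> tends to the logarithm locally uniformly (\<open>annulus_map_tendsto_Ln\<close>).

  The periodic map comes from the sum of \<open>coth ((s + k P) / 2)\<close> over all integers \<open>k\<close>. It gains the
  constant 2 when \<open>s\<close> moves by \<open>P\<close>, so subtracting \<open>2 s / P\<close> makes it periodic. On the two lines
  \<open>Im s = \<plusminus>\<pi>\<close> the sum is real, hence the corrected function \<open>slit_map\<close> has constant imaginary part
  there: it maps the strip modulo its period onto the complement of two parallel horizontal
  slits. Injectivity is the classical count by the argument principle
  (\<open>zero_of_slit_num_unique\<close>). As \<open>P\<close> grows, the two slits approach \<open>[-1, 1]\<close> from both sides, and a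
  Moebius transformation that sends two points near the ends of the first slit to \<open>0\<close> and \<open>\<infinity>\<close>
  turns \<open>slit_map\<close> into \<open>strip_map\<close>.

  Normalizing at three prescribed points means composing with Moebius transformations whose
  coefficients converge. They act on the sphere as uniformly Lipschitz maps and preserve closed
  disks (\<open>moebius_lipschitz\<close>, \<open>closed_disk_moebius\<close>), so neither the convergence nor the shape of the
  limit domain is affected.
\<close>

section \<open>Homogeneous coordinates and Moebius transformations\<close>

text \<open>The point with homogeneous coordinates \<open>[u : v]\<close>. Moebius transformations become
  matrices and the chordal metric becomes a determinant, without case distinctions for
  \<open>Infty\<close>.\<close>

definition proj :: "complex \<Rightarrow> complex \<Rightarrow> riemann_sphere" where
  "proj u v = (if v = 0 then Infty else Fin (u / v))"

definition norm_sq :: "complex \<Rightarrow> complex \<Rightarrow> real" where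
  "norm_sq u v = (norm u)\<^sup>2 + (norm v)\<^sup>2"

lemma norm_sq_pos: "u \<noteq> 0 \<or> v \<noteq> 0 \<Longrightarrow> 0 < norm_sq u v"
  by (auto simp: norm_sq_def add_pos_nonneg add_nonneg_pos)

lemma proj_scale: "k \<noteq> 0 \<Longrightarrow> proj (k * u) (k * v) = proj u v"
  by (simp add: proj_def)

lemma proj_exhaust:
  obtains u v where "p = proj u v" "u \<noteq> 0 \<or> v \<noteq> 0"
proof (cases p)
  case (Fin z)
  then have "p = proj z 1" by (simp add: proj_def)
  then show ?thesis using that by fastforce
next
  case Infty
  then have "p = proj 1 0" by (simp add: proj_def)
  then show ?thesis using that by fastforce
qed

lemma Fin_eq_proj: "Fin z = proj z 1" and Infty_eq_proj: "Infty = proj 1 0"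
  by (simp_all add: proj_def)

lemma stereo_proj:
  assumes "u \<noteq> 0 \<or> v \<noteq> 0"
  shows "stereo (proj u v) = ((2 / norm_sq u v) *\<^sub>R (u * cnj v), ((norm u)\<^sup>2 - (norm v)\<^sup>2) / norm_sq u v)"
proof (cases "v = 0")
  case True
  then show ?thesis using assms by (simp add: proj_def norm_sq_def)
next
  case False
  define r where "r = (norm v)\<^sup>2"
  have r: "r > 0" using False by (simp add: r_def)
  have n: "(norm (u / v))\<^sup>2 = (norm u)\<^sup>2 / r" by (simp add: norm_divide power_divide r_def)
  have N: "norm_sq u v > 0" using assms by (rule norm_sq_pos)
  have uv: "u / v = (1 / r) *\<^sub>R (u * cnj v)"
    unfolding complex_div_cnj[of u v] r_def by (simp add: scaleR_conv_of_real)
  have "2 / (1 + (norm u)\<^sup>2 / r) * (1 / r) = 2 / norm_sq u v"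
    using r N by (simp add: norm_sq_def r_def[symmetric] field_simps)
  moreover have "((norm u)\<^sup>2 / r - 1) / ((norm u)\<^sup>2 / r + 1) = ((norm u)\<^sup>2 - r) / norm_sq u v"
    using r N by (simp add: norm_sq_def r_def[symmetric] divide_simps)
  moreover have "stereo (proj u v) = (of_real (2 / (1 + (norm u)\<^sup>2 / r)) * (u / v),
      ((norm u)\<^sup>2 / r - 1) / ((norm u)\<^sup>2 / r + 1))"
    using False unfolding proj_def n[symmetric] by (simp only: stereo.simps if_False)
  moreover have "of_real x * (u / v) = (x * (1 / r)) *\<^sub>R (u * cnj v)" for x
    unfolding uv by (simp add: scaleR_conv_of_real)
  ultimately show ?thesis unfolding r_def[symmetric] by (simp only:)
qed

lemma norm_stereo: "norm (stereo p) = 1"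
  using range_stereo by (metis dist_0_norm mem_sphere rangeI)

lemma dist_sq_stereo: "(dist p q)\<^sup>2 = 2 - 2 * (stereo p \<bullet> stereo q)"
proof -
  have "(dist p q)\<^sup>2 = (stereo p - stereo q) \<bullet> (stereo p - stereo q)"
    by (simp add: dist_riemann_sphere_def dist_norm power2_norm_eq_inner)
  also have "\<dots> = (norm (stereo p))\<^sup>2 + (norm (stereo q))\<^sup>2 - 2 * (stereo p \<bullet> stereo q)"
    by (simp add: power2_norm_eq_inner inner_diff_left inner_diff_right inner_commute)
  finally show ?thesis by (simp add: norm_stereo)
qed

text \<open>Both sides are rational in the coordinates: the squared chordal distance is \<open>2 - 2
  cos\<close> of the angle between two unit vectors, and the difference is Lagrange's identity for
  the two coordinate vectors.\<close>

lemma dist_proj: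
  assumes "u \<noteq> 0 \<or> v \<noteq> 0" "a \<noteq> 0 \<or> b \<noteq> 0"
  shows "(dist (proj u v) (proj a b))\<^sup>2 = 4 * (norm (u * b - v * a))\<^sup>2 / (norm_sq u v * norm_sq a b)"
proof -
  have N: "norm_sq u v > 0" "norm_sq a b > 0" using assms by (auto intro: norm_sq_pos)
  have "stereo (proj u v) \<bullet> stereo (proj a b) =
     (4 * ((u * cnj v) \<bullet> (a * cnj b)) + ((norm u)\<^sup>2 - (norm v)\<^sup>2) * ((norm a)\<^sup>2 - (norm b)\<^sup>2)) / (norm_sq u v * norm_sq a b)"
    unfolding stereo_proj[OF assms(1)] stereo_proj[OF assms(2)] by (simp add: inner_prod_def add_divide_distrib)
  moreover have "norm_sq u v * norm_sq a b - (4 * ((u * cnj v) \<bullet> (a * cnj b)) + ((norm u)\<^sup>2 - (norm v)\<^sup>2) * ((norm a)\<^sup>2 - (norm b)\<^sup>2))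
     = 2 * (norm (u * b - v * a))\<^sup>2"
    unfolding norm_sq_def cmod_power2 by (simp add: inner_complex_def power2_eq_square algebra_simps)
  ultimately show ?thesis unfolding dist_sq_stereo using N by (simp add: field_simps)
qed

lemma dist_Fin_le: "dist (Fin z) (Fin w) \<le> 2 * norm (z - w)"
proof (rule power2_le_imp_le)
  have "1 \<le> norm_sq z 1 * norm_sq w 1" by (simp add: norm_sq_def mult_ge1_I)
  then show "(dist (Fin z) (Fin w))\<^sup>2 \<le> (2 * norm (z - w))\<^sup>2"
    unfolding Fin_eq_proj by (subst dist_proj) (auto simp: power_mult_distrib divide_le_eq mult_left_mono mult_le_cancel_left1)
qed simp

lemma continuous_on_Fin: "continuous_on A Fin"
  unfolding continuous_on_iff
proof (intro ballI allI impI)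
  fix x and \<epsilon> :: real assume "\<epsilon> > 0"
  moreover have "dist (Fin x') (Fin x) < \<epsilon>" if "dist x' x < \<epsilon> / 2" for x'
    using dist_Fin_le[of x' x] that by (simp add: dist_norm)
  ultimately show "\<exists>d>0. \<forall>x'\<in>A. dist x' x < d \<longrightarrow> dist (Fin x') (Fin x) < \<epsilon>"
    by (intro exI[of _ "\<epsilon> / 2"]) simp
qed

lemma continuous_on_stereo: "continuous_on A stereo"
  unfolding continuous_on_iff by (auto simp: dist_riemann_sphere_def)

text \<open>Stereographic projection inverts \<open>stereo\<close>; this is what makes
  \<open>fin_part\<close> continuous.\<close>

lemma fin_part_stereo: "p \<noteq> Infty \<Longrightarrow> fin_part p = fst (stereo p) / of_real (1 - snd (stereo p))"
proof (cases p)
  case (Fin z)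
  define r where "r = (norm z)\<^sup>2"
  have r: "1 + r > 0" by (simp add: r_def add_pos_nonneg)
  have st: "stereo p = (of_real (2 / (1 + r)) * z, (r - 1) / (r + 1))"
    unfolding Fin r_def by (simp only: stereo.simps)
  have "1 - (r - 1) / (r + 1) = 2 / (1 + r)" using r by (simp add: field_simps)
  moreover have "complex_of_real (2 / (1 + r)) \<noteq> 0" using r by (simp only: of_real_eq_0_iff) simp
  moreover have "fin_part p = z" by (simp add: Fin)
  ultimately show ?thesis unfolding st fst_conv snd_conv by (simp del: of_real_divide)
qed auto

lemma snd_stereo_ne_1: "p \<noteq> Infty \<Longrightarrow> snd (stereo p) \<noteq> 1"
  by (cases p) (use stereo_snd_ne_1 in auto)

lemma continuous_on_fin_part: "continuous_on (- {Infty}) fin_part"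
proof (rule continuous_on_eq)
  show "continuous_on (- {Infty}) (\<lambda>p. fst (stereo p) / of_real (1 - snd (stereo p)))"
    using snd_stereo_ne_1 by (intro continuous_intros continuous_on_stereo) (auto simp: complex_eq_iff)
qed (use fin_part_stereo in auto)

lemma inj_Fin: "inj_on Fin A" by (auto intro: inj_onI)

lemma open_Fin_image:
  assumes "open A" shows "open (Fin ` A)"
proof -
  have "open (fin_part -` A \<inter> - {Infty})"
    by (rule continuous_on_open_vimage[THEN iffD1, rule_format, OF _ continuous_on_fin_part assms]) (simp add: open_Compl)
  moreover have "fin_part -` A \<inter> - {Infty} = Fin ` A"
  proof (intro equalityI subsetI)
    fix p assume "p \<in> fin_part -` A \<inter> - {Infty}" then show "p \<in> Fin ` A" by (cases p) auto
  qed auto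
  ultimately show ?thesis by simp
qed

text \<open>Stated with squared norms, as every estimate for matrices below compares squares.\<close>

lemma cauchy_schwarz2:
  fixes a b u v :: complex
  shows "(norm (a * u + b * v))\<^sup>2 \<le> norm_sq a b * norm_sq u v"
proof -
  have "norm (a * u + b * v) \<le> norm a * norm u + norm b * norm v"
    by (metis norm_mult norm_triangle_ineq)
  then have "(norm (a * u + b * v))\<^sup>2 \<le> (norm a * norm u + norm b * norm v)\<^sup>2"
    by (intro power_mono) auto
  also have "\<dots> \<le> norm_sq a b * norm_sq u v"
    using zero_le_power2[of "norm a * norm v - norm b * norm u"]
    by (simp add: norm_sq_def power2_eq_square algebra_simps)
  finally show ?thesis .
qed

fun moebius :: "complex \<Rightarrow> complex \<Rightarrow> complex \<Rightarrow> complex \<Rightarrow> riemann_sphere \<Rightarrow> riemann_sphere" where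
  "moebius a b c d (Fin z) = proj (a * z + b) (c * z + d)"
| "moebius a b c d Infty = proj a c"

lemma matrix_nonzero:
  fixes a b c d u v :: complex
  assumes "a * d - b * c \<noteq> 0" "u \<noteq> 0 \<or> v \<noteq> 0"
  shows "a * u + b * v \<noteq> 0 \<or> c * u + d * v \<noteq> 0"
proof (rule ccontr)
  assume "\<not> ?thesis"
  then have *: "a * u + b * v = 0" "c * u + d * v = 0" by auto
  have "(a * d - b * c) * u = d * (a * u + b * v) - b * (c * u + d * v)"
       "(a * d - b * c) * v = a * (c * u + d * v) - c * (a * u + b * v)" by (simp_all add: algebra_simps)
  then show False using * assms by auto
qed

lemma moebius_proj:
  assumes "u \<noteq> 0 \<or> v \<noteq> 0"
  shows "moebius a b c d (proj u v) = proj (a * u + b * v) (c * u + d * v)"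
proof (cases "v = 0")
  case True
  then show ?thesis using assms proj_scale[of u a c] by (simp add: proj_def[of u 0] mult.commute)
next
  case False
  have "a * u + b * v = v * (a * (u / v) + b)" "c * u + d * v = v * (c * (u / v) + d)"
    using False by (simp_all add: algebra_simps)
  then show ?thesis using False proj_scale[of v "a * (u / v) + b" "c * (u / v) + d"] by (simp add: proj_def[of u v])
qed

lemma moebius_inverse:
  assumes "a * d - b * c \<noteq> 0"
  shows "moebius d (- b) (- c) a (moebius a b c d p) = p"
proof -
  obtain u v where p: "p = proj u v" "u \<noteq> 0 \<or> v \<noteq> 0" by (rule proj_exhaust)
  have "moebius d (- b) (- c) a (moebius a b c d p) =
     proj (d * (a * u + b * v) + - b * (c * u + d * v)) (- c * (a * u + b * v) + a * (c * u + d * v))"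
    unfolding p(1) moebius_proj[OF p(2)] by (rule moebius_proj[OF matrix_nonzero[OF assms p(2)]])
  also have "\<dots> = proj ((a * d - b * c) * u) ((a * d - b * c) * v)" by (simp add: algebra_simps)
  finally show ?thesis using proj_scale[OF assms] p by simp
qed

lemma inj_moebius: "a * d - b * c \<noteq> 0 \<Longrightarrow> inj (moebius a b c d)"
  by (rule inj_on_inverseI[where g = "moebius d (- b) (- c) a"]) (rule moebius_inverse)

lemma moebius_inverse':
  assumes "a * d - b * c \<noteq> 0"
  shows "moebius a b c d (moebius d (- b) (- c) a p) = p"
  using moebius_inverse[of d a "- b" "- c" p] assms by (simp add: mult.commute)

lemma moebius_image_eq:
  assumes "a * d - b * c \<noteq> 0"
  shows "moebius a b c d ` S = {p. moebius d (- b) (- c) a p \<in> S}"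
proof (intro equalityI subsetI)
  fix p assume "p \<in> moebius a b c d ` S"
  then show "p \<in> {p. moebius d (- b) (- c) a p \<in> S}" using moebius_inverse[OF assms] by auto
next
  fix p assume "p \<in> {p. moebius d (- b) (- c) a p \<in> S}"
  then show "p \<in> moebius a b c d ` S" using moebius_inverse'[OF assms, of p]
    by (intro image_eqI[of _ _ "moebius d (- b) (- c) a p"]) auto
qed

definition frob_sq :: "complex \<Rightarrow> complex \<Rightarrow> complex \<Rightarrow> complex \<Rightarrow> real" where
  "frob_sq a b c d = norm_sq a b + norm_sq c d"

lemma norm_sq_matrix_le: "norm_sq (a * u + b * v) (c * u + d * v) \<le> frob_sq a b c d * norm_sq u v"
  using cauchy_schwarz2[of a u b v] cauchy_schwarz2[of c u d v]
  by (simp add: norm_sq_def[of "a * u + b * v"] frob_sq_def distrib_right)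

text \<open>The adjugate matrix has the same Frobenius norm and inverts the matrix up to the determinant, so
  the upper bound for it is a lower bound for the matrix itself.\<close>

lemma norm_sq_matrix_ge: "(norm (a * d - b * c))\<^sup>2 * norm_sq u v \<le> frob_sq a b c d * norm_sq (a * u + b * v) (c * u + d * v)"
proof -
  have "(norm (a * d - b * c))\<^sup>2 * norm_sq u v = norm_sq ((a * d - b * c) * u) ((a * d - b * c) * v)"
    unfolding norm_sq_def norm_mult power_mult_distrib by (simp only: distrib_left)
  also have "(a * d - b * c) * u = d * (a * u + b * v) + - b * (c * u + d * v)" by (simp add: algebra_simps)
  also have "(a * d - b * c) * v = - c * (a * u + b * v) + a * (c * u + d * v)" by (simp add: algebra_simps)
  also have "norm_sq (d * (a * u + b * v) + - b * (c * u + d * v)) (- c * (a * u + b * v) + a * (c * u + d * v))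
     \<le> frob_sq d (- b) (- c) a * norm_sq (a * u + b * v) (c * u + d * v)" by (rule norm_sq_matrix_le)
  also have "frob_sq d (- b) (- c) a = frob_sq a b c d" by (simp add: frob_sq_def norm_sq_def)
  finally show ?thesis .
qed

text \<open>In homogeneous coordinates the determinant of two vectors is multiplied by \<open>a d - b
  c\<close>, while their norms shrink at most by the factor of \<open>norm_sq_matrix_ge\<close>.\<close>

lemma moebius_lipschitz:
  assumes D: "a * d - b * c \<noteq> 0"
  shows "dist (moebius a b c d p) (moebius a b c d q) \<le> frob_sq a b c d / norm (a * d - b * c) * dist p q"
proof (rule power2_le_imp_le)
  define \<Delta> where "\<Delta> = (norm (a * d - b * c))\<^sup>2"
  define m where "m = frob_sq a b c d"
  have \<Delta>: "\<Delta> > 0" using D by (simp add: \<Delta>_def)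
  have m: "m \<ge> 0" by (simp add: m_def frob_sq_def norm_sq_def)
  obtain u v where p: "p = proj u v" "u \<noteq> 0 \<or> v \<noteq> 0" by (rule proj_exhaust)
  obtain x y where q: "q = proj x y" "x \<noteq> 0 \<or> y \<noteq> 0" by (rule proj_exhaust)
  define N where "N = norm_sq (a * u + b * v) (c * u + d * v)"
  define M where "M = norm_sq (a * x + b * y) (c * x + d * y)"
  have pos: "N > 0" "M > 0" "norm_sq u v > 0" "norm_sq x y > 0"
    unfolding N_def M_def using matrix_nonzero[OF D] p q by (auto intro!: norm_sq_pos)
  define t where "t = (norm (u * y - v * x))\<^sup>2"
  have t: "t \<ge> 0" by (simp add: t_def)
  have "(dist (moebius a b c d p) (moebius a b c d q))\<^sup>2 =
     4 * (norm ((a * u + b * v) * (c * x + d * y) - (c * u + d * v) * (a * x + b * y)))\<^sup>2 / (N * M)"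
    unfolding p(1) q(1) moebius_proj[OF p(2)] moebius_proj[OF q(2)] N_def M_def
    by (intro dist_proj matrix_nonzero D p q)
  also have "(a * u + b * v) * (c * x + d * y) - (c * u + d * v) * (a * x + b * y) = (a * d - b * c) * (u * y - v * x)"
    by (simp add: algebra_simps)
  also have "(norm ((a * d - b * c) * (u * y - v * x)))\<^sup>2 = \<Delta> * t"
    by (simp add: norm_mult power_mult_distrib \<Delta>_def t_def)
  also have "4 * (\<Delta> * t) / (N * M) \<le> m\<^sup>2 / \<Delta> * (4 * t / (norm_sq u v * norm_sq x y))"
  proof -
    have "(\<Delta> * norm_sq u v) * (\<Delta> * norm_sq x y) \<le> (m * N) * (m * M)"
      unfolding \<Delta>_def m_def N_def M_def using pos D m
      by (intro mult_mono norm_sq_matrix_ge) (auto simp: m_def norm_sq_def)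
    then have *: "\<Delta> * \<Delta> * (norm_sq u v * norm_sq x y) \<le> m\<^sup>2 * (N * M)" by (simp add: power2_eq_square algebra_simps)
    have "\<Delta> / (N * M) \<le> m\<^sup>2 / \<Delta> * (1 / (norm_sq u v * norm_sq x y))"
      using * \<Delta> pos by (simp add: divide_simps mult_ac)
    from mult_left_mono[OF this, of "4 * t"] show ?thesis using t by (simp add: mult_ac)
  qed
  also have "4 * t / (norm_sq u v * norm_sq x y) = (dist p q)\<^sup>2"
    unfolding p(1) q(1) t_def by (rule dist_proj[OF p(2) q(2), symmetric])
  also have "m\<^sup>2 / \<Delta> * (dist p q)\<^sup>2 = (frob_sq a b c d / norm (a * d - b * c) * dist p q)\<^sup>2"
    by (simp add: power_mult_distrib power_divide m_def \<Delta>_def)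
  finally show "(dist (moebius a b c d p) (moebius a b c d q))\<^sup>2 \<le> (frob_sq a b c d / norm (a * d - b * c) * dist p q)\<^sup>2" .
qed (simp add: frob_sq_def norm_sq_def)

lemma continuous_on_moebius:
  assumes "a * d - b * c \<noteq> 0" shows "continuous_on A (moebius a b c d)"
proof -
  define L where "L = frob_sq a b c d / norm (a * d - b * c) + 1"
  have L: "L > 0" by (simp add: L_def frob_sq_def norm_sq_def add_nonneg_pos)
  have l: "dist (moebius a b c d p) (moebius a b c d q) \<le> L * dist p q" for p q
    using moebius_lipschitz[OF assms, of p q] zero_le_dist[of p q] unfolding L_def distrib_right by linarith
  show ?thesis unfolding continuous_on_iff
  proof (intro ballI allI impI)
    fix x and \<epsilon> :: real assume "\<epsilon> > 0"
    then show "\<exists>\<delta>>0. \<forall>x'\<in>A. dist x' x < \<delta> \<longrightarrow> dist (moebius a b c d x') (moebius a b c d x) < \<epsilon>"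
      using L l[of _ x] by (intro exI[of _ "\<epsilon> / L"]) (auto simp: pos_less_divide_eq mult.commute intro: le_less_trans)
  qed
qed

text \<open>The bound does not depend on \<open>p\<close>: this is uniform convergence on the whole sphere
  when the coefficients converge. The determinant of the two image vectors only sees the
  difference of the matrices, since a vector has determinant 0 with itself.\<close>

lemma dist_moebius_moebius_le:
  assumes D: "a * d - b * c \<noteq> 0" and D': "a' * d' - b' * c' \<noteq> 0"
  shows "(dist (moebius a' b' c' d' p) (moebius a b c d p))\<^sup>2 \<le>
     4 * frob_sq (a' - a) (b' - b) (c' - c) (d' - d) * frob_sq a' b' c' d' / (norm (a' * d' - b' * c'))\<^sup>2"
proof -
  obtain u v where p: "p = proj u v" "u \<noteq> 0 \<or> v \<noteq> 0" by (rule proj_exhaust)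
  define N where "N = norm_sq (a * u + b * v) (c * u + d * v)"
  define N' where "N' = norm_sq (a' * u + b' * v) (c' * u + d' * v)"
  define e f where "e = (a' - a) * u + (b' - b) * v" and "f = (c' - c) * u + (d' - d) * v"
  define \<Delta> where "\<Delta> = (norm (a' * d' - b' * c'))\<^sup>2"
  have pos: "N > 0" "N' > 0" "norm_sq u v > 0" "\<Delta> > 0"
    unfolding N_def N'_def \<Delta>_def using matrix_nonzero[OF D] matrix_nonzero[OF D'] p D' by (auto intro!: norm_sq_pos)
  have "(dist (moebius a' b' c' d' p) (moebius a b c d p))\<^sup>2 =
     4 * (norm ((a' * u + b' * v) * (c * u + d * v) - (c' * u + d' * v) * (a * u + b * v)))\<^sup>2 / (N' * N)"
    unfolding p(1) moebius_proj[OF p(2)] N_def N'_def by (intro dist_proj matrix_nonzero D D' p)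
  also have "(a' * u + b' * v) * (c * u + d * v) - (c' * u + d' * v) * (a * u + b * v)
     = (c * u + d * v) * e + - (a * u + b * v) * f" by (simp add: e_def f_def algebra_simps)
  also have "4 * (norm ((c * u + d * v) * e + - (a * u + b * v) * f))\<^sup>2 / (N' * N)
      \<le> 4 * (N * norm_sq e f) / (N' * N)"
  proof -
    have "norm_sq (c * u + d * v) (- (a * u + b * v)) = N" unfolding N_def norm_sq_def norm_minus_cancel by simp
    then show ?thesis using cauchy_schwarz2[of "c * u + d * v" e "- (a * u + b * v)" f] pos
      by (intro divide_right_mono mult_left_mono) simp_all
  qed
  also have "\<dots> = 4 * norm_sq e f / N'" using pos by simp
  also have "\<dots> \<le> 4 * (frob_sq (a' - a) (b' - b) (c' - c) (d' - d) * norm_sq u v) / (\<Delta> * norm_sq u v / frob_sq a' b' c' d')"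
  proof (rule frac_le)
    show "4 * norm_sq e f \<le> 4 * (frob_sq (a' - a) (b' - b) (c' - c) (d' - d) * norm_sq u v)"
      unfolding e_def f_def using norm_sq_matrix_le by simp
    have m: "frob_sq a' b' c' d' > 0"
    proof -
      have "\<Delta> * norm_sq u v \<le> frob_sq a' b' c' d' * N'" unfolding \<Delta>_def N'_def by (rule norm_sq_matrix_ge)
      then show ?thesis using pos mult_pos_pos[OF pos(4,3)] by (metis less_le_trans zero_less_mult_pos2)
    qed
    show "\<Delta> * norm_sq u v / frob_sq a' b' c' d' \<le> N'"
      using norm_sq_matrix_ge[of a' d' b' c' u v] m unfolding \<Delta>_def N'_def by (simp add: divide_le_eq mult.commute)
    show "0 < \<Delta> * norm_sq u v / frob_sq a' b' c' d'" using m pos by simp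
  qed (simp add: frob_sq_def norm_sq_def)
  also have "\<dots> = 4 * frob_sq (a' - a) (b' - b) (c' - c) (d' - d) * frob_sq a' b' c' d' / \<Delta>"
    using pos by (simp add: field_simps)
  finally show ?thesis unfolding \<Delta>_def .
qed

section \<open>Closed disks and circle domains\<close>

text \<open>A Hermitian form on \<open>\<complex>\<^sup>2\<close> with diagonal \<open>\<alpha>\<close>,
  \<open>\<delta>\<close>; its sign at a nonzero vector depends only on the point of the sphere.\<close>

definition herm_form :: "real \<Rightarrow> complex \<Rightarrow> real \<Rightarrow> complex \<Rightarrow> complex \<Rightarrow> real" where
  "herm_form \<alpha> \<beta> \<delta> u v = \<alpha> * (norm u)\<^sup>2 + 2 * (\<beta> \<bullet> (u * cnj v)) + \<delta> * (norm v)\<^sup>2"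

definition herm_disk :: "real \<Rightarrow> complex \<Rightarrow> real \<Rightarrow> riemann_sphere set" where
  "herm_disk \<alpha> \<beta> \<delta> = {p. \<forall>u v. (u \<noteq> 0 \<or> v \<noteq> 0) \<and> p = proj u v \<longrightarrow> 0 \<le> herm_form \<alpha> \<beta> \<delta> u v}"

text \<open>On the sphere in \<open>\<complex> \<times> \<real>\<close> a Hermitian form is an affine
  function. Thus the inequality cuts out a spherical cap.\<close>

lemma herm_form_stereo:
  assumes "u \<noteq> 0 \<or> v \<noteq> 0"
  shows "herm_form (\<tau> - c) \<beta> (- \<tau> - c) u v = norm_sq u v * ((\<beta>, \<tau>) \<bullet> stereo (proj u v) - c)"
proof -
  have N: "norm_sq u v > 0" by (rule norm_sq_pos[OF assms])
  have "norm_sq u v * ((\<beta>, \<tau>) \<bullet> stereo (proj u v)) = 2 * (\<beta> \<bullet> (u * cnj v)) + \<tau> * ((norm u)\<^sup>2 - (norm v)\<^sup>2)"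
    unfolding stereo_proj[OF assms] using N by (simp add: inner_prod_def distrib_left)
  then have "norm_sq u v * ((\<beta>, \<tau>) \<bullet> stereo (proj u v) - c) =
      2 * (\<beta> \<bullet> (u * cnj v)) + \<tau> * ((norm u)\<^sup>2 - (norm v)\<^sup>2) - norm_sq u v * c" by (simp add: right_diff_distrib)
  then show ?thesis by (simp add: herm_form_def norm_sq_def algebra_simps)
qed

lemma herm_disk_stereo: "herm_disk (\<tau> - c) \<beta> (- \<tau> - c) = {p. c \<le> (\<beta>, \<tau>) \<bullet> stereo p}"
proof -
  have key: "0 \<le> herm_form (\<tau> - c) \<beta> (- \<tau> - c) u v \<longleftrightarrow> c \<le> (\<beta>, \<tau>) \<bullet> stereo (proj u v)" if "u \<noteq> 0 \<or> v \<noteq> 0" for u v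
    unfolding herm_form_stereo[OF that] using norm_sq_pos[OF that] by (simp add: zero_le_mult_iff)
  show ?thesis
  proof (intro equalityI subsetI)
    fix p assume p: "p \<in> herm_disk (\<tau> - c) \<beta> (- \<tau> - c)"
    obtain u v where uv: "p = proj u v" "u \<noteq> 0 \<or> v \<noteq> 0" by (rule proj_exhaust)
    then have "0 \<le> herm_form (\<tau> - c) \<beta> (- \<tau> - c) u v" using p unfolding herm_disk_def by blast
    then show "p \<in> {p. c \<le> (\<beta>, \<tau>) \<bullet> stereo p}" using key[OF uv(2)] uv(1) by simp
  next
    fix p assume p: "p \<in> {p. c \<le> (\<beta>, \<tau>) \<bullet> stereo p}"
    show "p \<in> herm_disk (\<tau> - c) \<beta> (- \<tau> - c)" unfolding herm_disk_def using key p by auto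
  qed
qed

lemma proj_in_herm_disk:
  assumes "u \<noteq> 0 \<or> v \<noteq> 0"
  shows "proj u v \<in> herm_disk \<alpha> \<beta> \<delta> \<longleftrightarrow> 0 \<le> herm_form \<alpha> \<beta> \<delta> u v"
proof -
  define \<tau> where "\<tau> = (\<alpha> - \<delta>) / 2"
  define c where "c = - (\<alpha> + \<delta>) / 2"
  have ab: "\<alpha> = \<tau> - c" "\<delta> = - \<tau> - c" by (simp_all add: \<tau>_def c_def field_simps)
  show ?thesis unfolding ab herm_disk_stereo mem_Collect_eq herm_form_stereo[OF assms]
    using norm_sq_pos[OF assms] by (simp add: zero_le_mult_iff)
qed

lemma Fin_in_herm_disk: "Fin z \<in> herm_disk \<alpha> \<beta> \<delta> \<longleftrightarrow> 0 \<le> \<alpha> * (norm z)\<^sup>2 + 2 * (\<beta> \<bullet> z) + \<delta>"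
  unfolding Fin_eq_proj by (subst proj_in_herm_disk) (auto simp: herm_form_def)

lemma Infty_in_herm_disk: "Infty \<in> herm_disk \<alpha> \<beta> \<delta> \<longleftrightarrow> 0 \<le> \<alpha>"
  unfolding Infty_eq_proj by (subst proj_in_herm_disk) (auto simp: herm_form_def)

lemma norm_pair_sq: "(norm (\<beta>::complex, \<tau>::real))\<^sup>2 = (norm \<beta>)\<^sup>2 + \<tau>\<^sup>2"
  by (simp add: norm_Pair)

text \<open>Caps are the intersections of the sphere with half-spaces \<open>c \<le> b \<bullet> x\<close>
  where \<open>|c| < norm b\<close>. The latter condition says that the Hermitian form is
  indefinite, and the cap is the ball around \<open>b / norm b\<close>.\<close>

lemma closed_disk_iff_herm_disk:
  "closed_disk S \<longleftrightarrow> (\<exists>\<alpha> \<beta> \<delta>. \<alpha> * \<delta> < (norm \<beta>)\<^sup>2 \<and> S = herm_disk \<alpha> \<beta> \<delta>)"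
proof
  assume "closed_disk S"
  then obtain p r where r: "0 < r" "r < 2" and S: "S = cball p r" by (auto simp: closed_disk_def)
  obtain \<beta> \<tau> where n: "stereo p = (\<beta>, \<tau>)" by (cases "stereo p")
  have n1: "(norm \<beta>)\<^sup>2 + \<tau>\<^sup>2 = 1" using norm_stereo[of p] norm_pair_sq[of \<beta> \<tau>] unfolding n by simp
  define c where "c = 1 - r\<^sup>2 / 2"
  have "r\<^sup>2 < 2\<^sup>2" using r by (intro power_strict_mono) auto
  moreover have "0 < r\<^sup>2" using r by simp
  ultimately have "\<bar>c\<bar> < 1" unfolding c_def by (simp add: abs_less_iff)
  then have "c\<^sup>2 < 1" by (simp add: abs_square_less_1)
  then have 1: "(\<tau> - c) * (- \<tau> - c) < (norm \<beta>)\<^sup>2" using n1 by (simp add: power2_eq_square algebra_simps)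
  have "q \<in> S \<longleftrightarrow> c \<le> (\<beta>, \<tau>) \<bullet> stereo q" for q
  proof -
    have "q \<in> S \<longleftrightarrow> (dist p q)\<^sup>2 \<le> r\<^sup>2" unfolding S using r by (simp add: power2_le_iff_abs_le)
    also have "\<dots> \<longleftrightarrow> c \<le> (\<beta>, \<tau>) \<bullet> stereo q" unfolding dist_sq_stereo n c_def by (auto simp: field_simps)
    finally show ?thesis .
  qed
  then have "S = herm_disk (\<tau> - c) \<beta> (- \<tau> - c)" unfolding herm_disk_stereo by blast
  then show "\<exists>\<alpha> \<beta> \<delta>. \<alpha> * \<delta> < (norm \<beta>)\<^sup>2 \<and> S = herm_disk \<alpha> \<beta> \<delta>" using 1 by blast
next
  assume "\<exists>\<alpha> \<beta> \<delta>. \<alpha> * \<delta> < (norm \<beta>)\<^sup>2 \<and> S = herm_disk \<alpha> \<beta> \<delta>"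
  then obtain \<alpha> \<beta> \<delta> where H: "\<alpha> * \<delta> < (norm \<beta>)\<^sup>2" "S = herm_disk \<alpha> \<beta> \<delta>" by blast
  \<comment> \<open>The center is \<open>(\<beta>, \<tau>) / L\<close>; the squared distance of a unit vector from it is \<open>2 - 2 cos\<close>.\<close>
  define \<tau> where "\<tau> = (\<alpha> - \<delta>) / 2"
  define c where "c = - (\<alpha> + \<delta>) / 2"
  have ab: "\<alpha> = \<tau> - c" "\<delta> = - \<tau> - c" by (simp_all add: \<tau>_def c_def field_simps)
  define L where "L = norm (\<beta>, \<tau>)"
  have "c\<^sup>2 < L\<^sup>2" using H(1) unfolding ab L_def norm_pair_sq by (simp add: power2_eq_square algebra_simps)
  then have cL: "\<bar>c\<bar> < L" by (simp add: L_def abs_le_square_iff[symmetric] not_le[symmetric])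
  then have L: "L > 0" by linarith
  have "norm ((1 / L) *\<^sub>R (\<beta>, \<tau>)) = 1" using L unfolding norm_scaleR L_def by simp
  then have "(1 / L) *\<^sub>R (\<beta>, \<tau>) \<in> range stereo" unfolding range_stereo by simp
  then obtain p where p: "stereo p = (1 / L) *\<^sub>R (\<beta>, \<tau>)" by (metis rangeE)
  define t where "t = c / L"
  define r where "r = sqrt (2 - 2 * t)"
  have t: "- 1 < t" "t < 1" using cL L by (simp_all add: t_def field_simps abs_less_iff)
  have r2: "r\<^sup>2 = 2 - 2 * t" unfolding r_def using t by (intro real_sqrt_pow2) linarith
  have r: "0 < r" unfolding r_def using t by simp
  have "r\<^sup>2 < 2\<^sup>2" unfolding r2 using t by simp
  then have r': "r < 2" by (rule power2_less_imp_less) simp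
  have "q \<in> cball p r \<longleftrightarrow> c \<le> (\<beta>, \<tau>) \<bullet> stereo q" for q
  proof -
    have "q \<in> cball p r \<longleftrightarrow> (dist p q)\<^sup>2 \<le> r\<^sup>2" using r by (simp add: power2_le_iff_abs_le)
    also have "\<dots> \<longleftrightarrow> c / L \<le> (1 / L) * ((\<beta>, \<tau>) \<bullet> stereo q)"
      unfolding dist_sq_stereo p r2 inner_scaleR_left t_def by linarith
    also have "\<dots> \<longleftrightarrow> c \<le> (\<beta>, \<tau>) \<bullet> stereo q" using L by (simp add: divide_le_cancel)
    finally show ?thesis .
  qed
  then have "S = cball p r" unfolding H(2) ab herm_disk_stereo by blast
  then show "closed_disk S" unfolding closed_disk_def using r r' by blast
qed

lemma inner_cnj: "2 * complex_of_real (x \<bullet> y) = x * cnj y + cnj x * y"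
  by (simp add: complex_eq_iff inner_complex_def)

text \<open>Substituting the inverse matrix into an indefinite Hermitian form gives an indefinite Hermitian
  form, because its determinant is multiplied by \<open>|a d - b c|\<^sup>2\<close>. The primed
  coefficients are those of the transformed form.\<close>

lemma closed_disk_moebius:
  assumes S: "closed_disk S" and D: "a * d - b * c \<noteq> 0"
  shows "closed_disk (moebius a b c d ` S)"
proof -
  obtain \<alpha> \<beta> \<delta> where H: "\<alpha> * \<delta> < (norm \<beta>)\<^sup>2" "S = herm_disk \<alpha> \<beta> \<delta>" using S closed_disk_iff_herm_disk by blast
  define \<alpha>' where "\<alpha>' = \<alpha> * (norm d)\<^sup>2 - 2 * (\<beta> \<bullet> (d * cnj c)) + \<delta> * (norm c)\<^sup>2"
  define \<delta>' where "\<delta>' = \<alpha> * (norm b)\<^sup>2 - 2 * (\<beta> \<bullet> (b * cnj a)) + \<delta> * (norm a)\<^sup>2"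
  define \<beta>' where "\<beta>' = - \<alpha> * cnj d * b + \<beta> * cnj d * a + cnj \<beta> * b * cnj c - \<delta> * cnj c * a"
  have ca: "complex_of_real \<alpha>' = \<alpha> * (d * cnj d) - (\<beta> * cnj d * c + cnj \<beta> * d * cnj c) + \<delta> * (c * cnj c)"
    unfolding \<alpha>'_def by (simp add: inner_cnj complex_norm_square[symmetric] algebra_simps)
  have cd: "complex_of_real \<delta>' = \<alpha> * (b * cnj b) - (\<beta> * cnj b * a + cnj \<beta> * b * cnj a) + \<delta> * (a * cnj a)"
    unfolding \<delta>'_def by (simp add: inner_cnj complex_norm_square[symmetric] algebra_simps)
  have form: "herm_form \<alpha> \<beta> \<delta> (d * u + - b * v) (- c * u + a * v) = herm_form \<alpha>' \<beta>' \<delta>' u v" for u v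
  proof -
    have "complex_of_real (herm_form \<alpha> \<beta> \<delta> (d * u + - b * v) (- c * u + a * v)) = complex_of_real (herm_form \<alpha>' \<beta>' \<delta>' u v)"
      unfolding herm_form_def of_real_add of_real_mult of_real_numeral inner_cnj complex_norm_square ca cd \<beta>'_def
      by (simp add: algebra_simps)
    then show ?thesis by (simp only: of_real_eq_iff)
  qed
  have "complex_of_real (\<alpha>' * \<delta>' - (norm \<beta>')\<^sup>2) = complex_of_real ((norm (a * d - b * c))\<^sup>2 * (\<alpha> * \<delta> - (norm \<beta>)\<^sup>2))"
    unfolding of_real_diff of_real_mult complex_norm_square ca cd \<beta>'_def
    by (simp add: algebra_simps)
  then have "\<alpha>' * \<delta>' - (norm \<beta>')\<^sup>2 = (norm (a * d - b * c))\<^sup>2 * (\<alpha> * \<delta> - (norm \<beta>)\<^sup>2)"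
    by (simp only: of_real_eq_iff)
  moreover have "(norm (a * d - b * c))\<^sup>2 * (\<alpha> * \<delta> - (norm \<beta>)\<^sup>2) < 0" using H(1) D by (simp add: mult_less_0_iff)
  ultimately have "\<alpha>' * \<delta>' < (norm \<beta>')\<^sup>2" by linarith
  moreover have "moebius a b c d ` S = herm_disk \<alpha>' \<beta>' \<delta>'"
  proof -
    have D': "d * a - - b * - c \<noteq> 0" using D by (simp add: mult.commute)
    have "p \<in> moebius a b c d ` S \<longleftrightarrow> p \<in> herm_disk \<alpha>' \<beta>' \<delta>'" for p
    proof -
      obtain u v where p: "p = proj u v" "u \<noteq> 0 \<or> v \<noteq> 0" by (rule proj_exhaust)
      show ?thesis unfolding moebius_image_eq[OF D] mem_Collect_eq p(1) moebius_proj[OF p(2)] H(2)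
          proj_in_herm_disk[OF matrix_nonzero[OF D' p(2)]] proj_in_herm_disk[OF p(2)] form ..
    qed
    then show ?thesis by blast
  qed
  ultimately show ?thesis unfolding closed_disk_iff_herm_disk by blast
qed

lemma closed_disk_imp_closed: "closed_disk S \<Longrightarrow> closed S"
  by (auto simp: closed_disk_def)

text \<open>Two disjoint closed connected sets separate their union, so a component lies in one of them.\<close>

lemma components_of_two_closed:
  assumes A: "closed A" "connected A" and B: "closed B" "connected B"
    and disj: "A \<inter> B = {}" and C: "C \<in> components (A \<union> B)"
  shows "C = A \<or> C = B"
proof -
  note C' = in_components_connected[OF C] in_components_subset[OF C] in_components_nonempty[OF C]
  have "A \<inter> C = {} \<or> B \<inter> C = {}"
    using connected_closedD[OF C'(1) _ C'(2) A(1) B(1)] disj by blast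
  then show ?thesis
  proof
    assume "A \<inter> C = {}"
    then have "C \<subseteq> B" using C' by blast
    then have "B \<subseteq> C" using components_maximal[OF C B(2)] C' by blast
    then show ?thesis using \<open>C \<subseteq> B\<close> by blast
  next
    assume "B \<inter> C = {}"
    then have "C \<subseteq> A" using C' by blast
    then have "A \<subseteq> C" using components_maximal[OF C A(2)] C' by blast
    then show ?thesis using \<open>C \<subseteq> A\<close> by blast
  qed
qed

text \<open>The chordal distance of \<open>Fin z\<close> from \<open>Infty\<close> is at most \<open>2 /
  |z|\<close>.\<close>

lemma Infty_in_closure_Fin:
  assumes "\<not> bounded A" shows "Infty \<in> closure (Fin ` A)"
  unfolding closure_approachable
proof (intro allI impI)
  fix \<epsilon> :: real assume "\<epsilon> > 0"
  have "\<exists>z\<in>A. \<not> norm z \<le> 2 / \<epsilon>" using assms unfolding bounded_iff by blast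
  then obtain z where z: "z \<in> A" "2 / \<epsilon> < norm z" by auto
  have "0 < 2 / \<epsilon>" using \<open>\<epsilon> > 0\<close> by simp
  then have nz: "norm z > 0" using z(2) by linarith
  have "(dist (Fin z) Infty)\<^sup>2 = 4 / norm_sq z 1"
    unfolding Fin_eq_proj Infty_eq_proj by (subst dist_proj) (auto simp: norm_sq_def)
  also have "\<dots> \<le> 4 / (norm z)\<^sup>2"
  proof (rule divide_left_mono)
    show "(norm z)\<^sup>2 \<le> norm_sq z 1" by (simp add: norm_sq_def)
    show "0 < norm_sq z 1 * (norm z)\<^sup>2" using nz norm_sq_pos[of z 1] by simp
  qed simp
  also have "\<dots> < \<epsilon>\<^sup>2"
  proof -
    have "2 / norm z < \<epsilon>" using z(2) \<open>\<epsilon> > 0\<close> nz by (simp add: field_simps)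
    then have "(2 / norm z)\<^sup>2 < \<epsilon>\<^sup>2" using nz by (intro power_strict_mono) auto
    then show ?thesis by (simp add: power_divide)
  qed
  finally have "dist (Fin z) Infty < \<epsilon>" using \<open>\<epsilon> > 0\<close> by (intro power2_less_imp_less[of _ \<epsilon>]) auto
  then show "\<exists>y\<in>Fin ` A. dist y Infty < \<epsilon>" using z(1) by blast
qed

lemma connected_insert_Infty:
  assumes "connected A" "\<not> bounded A" shows "connected (insert Infty (Fin ` A))"
proof (rule connected_intermediate_closure)
  show "connected (Fin ` A)" by (intro connected_continuous_image continuous_on_Fin assms)
  show "insert Infty (Fin ` A) \<subseteq> closure (Fin ` A)"
    using Infty_in_closure_Fin[OF assms(2)] closure_subset[of "Fin ` A"] by simp
  show "Fin ` A \<subseteq> insert Infty (Fin ` A)" by (rule subset_insertI)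
qed

lemma Compl_Fin_image: "- (Fin ` A) = insert Infty (Fin ` (- A))"
proof (intro equalityI subsetI)
  fix p assume "p \<in> - (Fin ` A)" then show "p \<in> insert Infty (Fin ` (- A))" by (cases p) auto
qed auto

text \<open>The complement of a round annulus consists of a disk and the exterior of a larger disk, both of
  which are closed disks of the sphere.\<close>

lemma circle_domain_moebius_annulus:
  assumes D: "a * d - b * c \<noteq> 0" and r: "0 < r1" "r1 < r2"
    and X: "connected X" "X \<noteq> {}" "X = {z. r1 < norm (z - q) \<and> norm (z - q) < r2}"
  shows "circle_domain (moebius a b c d ` Fin ` X)"
proof -
  define A where "A = Fin ` cball q r1"
  define B where "B = insert Infty (Fin ` (- ball q r2))"
  have sq: "(norm (z - q))\<^sup>2 = (norm z)\<^sup>2 - 2 * (q \<bullet> z) + (norm q)\<^sup>2" for z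
    unfolding power2_norm_eq_inner by (simp add: inner_diff_left inner_diff_right inner_commute)
  have A: "A = herm_disk (-1) q (r1\<^sup>2 - (norm q)\<^sup>2)"
  proof (intro set_eqI)
    fix p show "p \<in> A \<longleftrightarrow> p \<in> herm_disk (-1) q (r1\<^sup>2 - (norm q)\<^sup>2)"
    proof (cases p)
      case (Fin z)
      have "p \<in> A \<longleftrightarrow> (norm (z - q))\<^sup>2 \<le> r1\<^sup>2"
        using r by (auto simp: A_def Fin dist_norm norm_minus_commute power2_le_iff_abs_le)
      then show ?thesis unfolding Fin Fin_in_herm_disk sq by auto
    qed (auto simp: A_def Infty_in_herm_disk)
  qed
  have B: "B = herm_disk 1 (- q) ((norm q)\<^sup>2 - r2\<^sup>2)"
  proof (intro set_eqI)
    fix p show "p \<in> B \<longleftrightarrow> p \<in> herm_disk 1 (- q) ((norm q)\<^sup>2 - r2\<^sup>2)"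
    proof (cases p)
      case (Fin z)
      have "p \<in> B \<longleftrightarrow> r2 \<le> norm (z - q)" by (auto simp: B_def Fin dist_norm norm_minus_commute)
      also have "\<dots> \<longleftrightarrow> r2\<^sup>2 \<le> (norm (z - q))\<^sup>2" using r by (simp add: power_mono_iff)
      finally show ?thesis unfolding Fin Fin_in_herm_disk sq by auto
    qed (auto simp: B_def Infty_in_herm_disk)
  qed
  have cd: "closed_disk A" "closed_disk B"
    unfolding closed_disk_iff_herm_disk using A B r by (force intro!: exI)+
  have conA: "connected A" unfolding A_def by (intro connected_continuous_image continuous_on_Fin) (auto intro: convex_connected)
  have conB: "connected B" unfolding B_def
  proof (rule connected_insert_Infty)
    show "connected (- ball q r2)" by (rule connected_complement_bounded_convex) auto
    show "\<not> bounded (- ball q r2)" by (metis bounded_ball bounded_Un Compl_partition not_bounded_UNIV)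
  qed
  have AB: "- (Fin ` X) = A \<union> B" "A \<inter> B = {}"
    unfolding Compl_Fin_image X(3) A_def B_def using r by (auto simp: dist_norm norm_minus_commute)
  let ?M = "moebius a b c d"
  have bij: "bij ?M" using inj_moebius[OF D] moebius_inverse'[OF D] by (metis bij_def surjI)
  have cM: "- (?M ` Fin ` X) = ?M ` A \<union> ?M ` B"
    using AB(1) bij by (metis bij_image_Compl_eq image_Un)
  have dj: "?M ` A \<inter> ?M ` B = {}" using AB(2) inj_moebius[OF D] by (metis image_Int image_empty)
  have cds: "closed_disk (?M ` A)" "closed_disk (?M ` B)" using cd closed_disk_moebius[OF _ D] by auto
  have con: "connected (?M ` A)" "connected (?M ` B)"
    using conA conB continuous_on_moebius[OF D] by (auto intro: connected_continuous_image)
  have "closed (- (?M ` Fin ` X))" unfolding cM using cds by (intro closed_Un closed_disk_imp_closed)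
  then have "open (?M ` Fin ` X)" by (simp add: open_closed)
  moreover have "connected (?M ` Fin ` X)"
    by (intro connected_continuous_image continuous_on_moebius D continuous_on_Fin X)
  ultimately have "sphere_domain (?M ` Fin ` X)" using X(2) by (simp add: sphere_domain_def)
  moreover have "closed_disk C" if "C \<in> components (- (?M ` Fin ` X))" for C
    using components_of_two_closed[OF _ con(1) _ con(2) dj, of C] that cds closed_disk_imp_closed unfolding cM by auto
  ultimately show ?thesis unfolding circle_domain_def by blast
qed

text \<open>The complement of the strip is connected, two half-planes joined at \<open>Infty\<close>. If it
  were a disk, a quadratic function \<open>\<alpha> |z|\<^sup>2 + 2 \<beta> \<bullet> z +
  \<delta>\<close> would be negative exactly on the strip. Symmetry in
  \<open>\<plusminus>4\<i>\<close> forces \<open>\<alpha> > 0\<close>, and then the function is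
  positive far out on the real axis, inside the strip.\<close>

lemma moebius_strip_not_circle_domain:
  assumes D: "a * d - b * c \<noteq> 0"
  shows "\<not> circle_domain (moebius a b c d ` Fin ` {z. \<bar>Im z\<bar> < pi})"
proof
  let ?M = "moebius a b c d" and ?X = "Fin ` {z. \<bar>Im z\<bar> < pi}"
  assume cd: "circle_domain (?M ` ?X)"
  define E where "E = - ?X"
  have unb: "\<not> bounded {z. pi \<le> Im z}" "\<not> bounded {z. Im z \<le> - pi}"
  proof -
    have n: "norm (Complex 0 t) = \<bar>t\<bar>" for t by (simp add: cmod_def)
    have "\<exists>z. pi \<le> Im z \<and> \<not> norm z \<le> B" for B
      by (rule exI[of _ "Complex 0 (\<bar>B\<bar> + 4)"]) (unfold n complex.sel, use pi_less_4 in linarith)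
    moreover have "\<exists>z. Im z \<le> - pi \<and> \<not> norm z \<le> B" for B
      by (rule exI[of _ "Complex 0 (- \<bar>B\<bar> - 4)"]) (unfold n complex.sel, use pi_less_4 in linarith)
    ultimately show "\<not> bounded {z. pi \<le> Im z}" "\<not> bounded {z. Im z \<le> - pi}"
      unfolding bounded_iff mem_Collect_eq by blast+
  qed
  have E: "E = insert Infty (Fin ` {z. pi \<le> Im z}) \<union> insert Infty (Fin ` {z. Im z \<le> - pi})"
    unfolding E_def Compl_Fin_image by (auto simp: abs_less_iff not_less)
  have conE: "connected E" unfolding E
    using unb by (intro connected_Un connected_insert_Infty convex_connected convex_halfspace_Im_ge convex_halfspace_Im_le) auto
  have bij: "bij ?M" using inj_moebius[OF D] moebius_inverse'[OF D] by (metis bij_def surjI)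
  have "- (?M ` ?X) = ?M ` E" unfolding E_def using bij by (metis bij_image_Compl_eq)
  moreover have "connected (?M ` E)"
    by (intro connected_continuous_image continuous_on_moebius D conE)
  moreover have "?M ` E \<noteq> {}" using E by blast
  ultimately have "?M ` E \<in> components (- (?M ` ?X))" by (simp add: in_components_self)
  then have "closed_disk (?M ` E) \<or> (\<exists>p. ?M ` E = {p})" using cd by (auto simp: circle_domain_def)
  then show False
  proof
    assume "\<exists>p. ?M ` E = {p}"
    moreover have "Infty \<in> E" "Fin (4 * \<i>) \<in> E" unfolding E using pi_less_4 by auto
    ultimately show False using inj_moebius[OF D] by (metis image_eqI inj_eq riemann_sphere.distinct(1) singletonD)
  next
    assume "closed_disk (?M ` E)"
    then have "closed_disk (moebius d (- b) (- c) a ` ?M ` E)"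
      by (rule closed_disk_moebius) (use D in \<open>simp add: mult.commute\<close>)
    also have "moebius d (- b) (- c) a ` ?M ` E = E" using moebius_inverse[OF D] by (force simp: image_image)
    finally obtain \<alpha> \<beta> \<delta> where H: "\<alpha> * \<delta> < (norm \<beta>)\<^sup>2" "E = herm_disk \<alpha> \<beta> \<delta>" using closed_disk_iff_herm_disk by blast
    have mem: "\<bar>Im z\<bar> < pi \<longleftrightarrow> \<alpha> * (norm z)\<^sup>2 + 2 * (\<beta> \<bullet> z) + \<delta> < 0" for z
    proof -
      have "Fin z \<in> E \<longleftrightarrow> \<not> \<bar>Im z\<bar> < pi" unfolding E_def by auto
      then show ?thesis unfolding H(2) Fin_in_herm_disk by linarith
    qed
    have "0 \<le> \<alpha>" using H(2) Infty_in_herm_disk[of \<alpha> \<beta> \<delta>] unfolding E by auto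
    have "\<delta> < 0" using mem[of 0] by simp
    have p: "\<alpha> * 16 + 2 * (4 * Im \<beta>) + \<delta> \<ge> 0" "\<alpha> * 16 - 2 * (4 * Im \<beta>) + \<delta> \<ge> 0"
      using mem[of "4 * \<i>"] mem[of "- 4 * \<i>"] pi_less_4 by (auto simp: inner_complex_def norm_mult power_mult_distrib)
    then have "\<alpha> * 16 + \<delta> \<ge> 0" by linarith
    then have "\<alpha> > 0" using \<open>\<delta> < 0\<close> by (smt (verit) mult_nonneg_nonpos)
    \<comment> \<open>Large enough for the quadratic term to dominate.\<close>
    define x where "x = (2 * \<bar>Re \<beta>\<bar> + \<bar>\<delta>\<bar> + 1) / \<alpha> + 1"
    have x: "\<alpha> * x = 2 * \<bar>Re \<beta>\<bar> + \<bar>\<delta>\<bar> + 1 + \<alpha>" "x \<ge> 1"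
      using \<open>\<alpha> > 0\<close> by (auto simp: x_def field_simps)
    have "\<alpha> * x\<^sup>2 + 2 * (Re \<beta> * x) + \<delta> < 0"
      using mem[of "of_real x"] by (simp add: inner_complex_def)
    moreover have "\<alpha> * x\<^sup>2 = 2 * (\<bar>Re \<beta>\<bar> * x) + \<bar>\<delta>\<bar> * x + x + \<alpha> * x"
    proof -
      have "\<alpha> * x\<^sup>2 = (2 * \<bar>Re \<beta>\<bar> + \<bar>\<delta>\<bar> + 1 + \<alpha>) * x"
        using x(1) by (simp only: power2_eq_square mult.assoc[symmetric])
      then show ?thesis by (simp only: distrib_right mult.assoc mult_1_left)
    qed
    moreover have "\<bar>\<delta>\<bar> * 1 \<le> \<bar>\<delta>\<bar> * x" using x(2) by (intro mult_left_mono) auto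
    moreover have "- (\<bar>Re \<beta>\<bar> * x) \<le> Re \<beta> * x" using x(2) by (metis abs_ge_minus_self minus_le_iff mult_minus_left mult_right_mono order_trans zero_le_one)
    moreover have "0 \<le> \<bar>Re \<beta>\<bar> * x" "0 < \<alpha> * x" using x(2) \<open>\<alpha> > 0\<close> by auto
    ultimately show False using x(2) abs_ge_minus_self[of \<delta>] by linarith
  qed
qed

section \<open>Conformal maps into the sphere and interpolation at three points\<close>

lemma sphere_inversion_proj:
  "u \<noteq> 0 \<or> v \<noteq> 0 \<Longrightarrow> sphere_inversion (proj u v) = proj v u"
  by (auto simp: proj_def)

text \<open>In the chart at \<open>Infty\<close> the quotient is inverted, which swaps numerator and
  denominator.\<close>

lemma holomorphic_chart_of_moebius:
  assumes D: "a * d - b * c \<noteq> 0" and g: "g holomorphic_on A" and \<beta>: "\<beta> \<in> {id, sphere_inversion}"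
  shows "(\<lambda>z. fin_part (\<beta> (moebius a b c d (Fin (g z))))) holomorphic_on
           {z \<in> A. \<beta> (moebius a b c d (Fin (g z))) \<noteq> Infty}"
proof -
  have nz: "a * g z + b \<noteq> 0 \<or> c * g z + d \<noteq> 0" for z
    using matrix_nonzero[OF D, of "g z" 1] by simp
  from \<beta> consider "\<beta> = id" | "\<beta> = sphere_inversion" by blast
  then show ?thesis
  proof cases
    case 1
    have "(\<lambda>z. (a * g z + b) / (c * g z + d)) holomorphic_on {z \<in> A. \<beta> (moebius a b c d (Fin (g z))) \<noteq> Infty}"
      by (intro holomorphic_intros holomorphic_on_subset[OF g]) (auto simp: 1 proj_def)
    then show ?thesis
      by (rule holomorphic_transform) (auto simp: 1 proj_def split: if_splits)
  next
    case 2
    have "(\<lambda>z. (c * g z + d) / (a * g z + b)) holomorphic_on {z \<in> A. \<beta> (moebius a b c d (Fin (g z))) \<noteq> Infty}"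
      by (intro holomorphic_intros holomorphic_on_subset[OF g])
        (auto simp: 2 sphere_inversion_proj[OF nz], auto simp: proj_def)
    then show ?thesis
      by (rule holomorphic_transform) (auto simp: 2 sphere_inversion_proj[OF nz], auto simp: proj_def split: if_splits)
  qed
qed

lemma conformal_on_moebius_Fin:
  assumes D: "a * d - b * c \<noteq> 0" and A: "open A" and g: "g holomorphic_on A" "inj_on g A"
  shows "conformal_on (\<lambda>p. moebius a b c d (Fin (g (fin_part p)))) (Fin ` A)"
  unfolding conformal_on_def
proof
  let ?F = "\<lambda>p. moebius a b c d (Fin (g (fin_part p)))"
  show "inj_on ?F (Fin ` A)"
  proof (rule inj_onI)
    fix p q assume pq: "p \<in> Fin ` A" "q \<in> Fin ` A" "?F p = ?F q"
    then have "g (fin_part p) = g (fin_part q)" using injD[OF inj_moebius[OF D]] by blast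
    then show "p = q" using pq(1,2) g(2) by (auto dest: inj_onD)
  qed
  show "sphere_holomorphic_on ?F (Fin ` A)"
    unfolding sphere_holomorphic_on_def
  proof (intro conjI ballI)
    have "continuous_on (Fin ` A) (\<lambda>p. g (fin_part p))"
      by (rule continuous_on_compose2[OF holomorphic_on_imp_continuous_on[OF g(1)]
            continuous_on_subset[OF continuous_on_fin_part]]) auto
    then show "continuous_on (Fin ` A) ?F"
      by (intro continuous_on_compose2[OF continuous_on_moebius[OF D, of UNIV]] continuous_on_compose2[OF continuous_on_Fin[of UNIV]]) auto
    fix \<alpha> \<beta> assume \<alpha>: "\<alpha> \<in> {id, sphere_inversion}" and \<beta>: "\<beta> \<in> {id, sphere_inversion}"
    from \<alpha> consider "\<alpha> = id" | "\<alpha> = sphere_inversion" by blast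
    then show "(\<lambda>z. fin_part (\<beta> (?F (\<alpha> (Fin z))))) holomorphic_on {z. \<alpha> (Fin z) \<in> Fin ` A \<and> \<beta> (?F (\<alpha> (Fin z))) \<noteq> Infty}"
    proof cases
      case 1
      have "{z. \<alpha> (Fin z) \<in> Fin ` A \<and> \<beta> (?F (\<alpha> (Fin z))) \<noteq> Infty} = {z \<in> A. \<beta> (moebius a b c d (Fin (g z))) \<noteq> Infty}"
        by (auto simp: 1)
      then show ?thesis using holomorphic_chart_of_moebius[OF D g(1) \<beta>] by (simp add: 1)
    next
      case 2
      define A' where "A' = {z. z \<noteq> 0 \<and> 1 / z \<in> A}"
      have "(\<lambda>z. g (1 / z)) holomorphic_on A'"
        by (rule holomorphic_on_compose_gen[OF _ g(1), unfolded o_def]) (auto simp: A'_def intro!: holomorphic_intros)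
      from holomorphic_chart_of_moebius[OF D this \<beta>]
      have *: "(\<lambda>z. fin_part (\<beta> (moebius a b c d (Fin (g (1 / z)))))) holomorphic_on
           {z \<in> A'. \<beta> (moebius a b c d (Fin (g (1 / z)))) \<noteq> Infty}" .
      have "{z. \<alpha> (Fin z) \<in> Fin ` A \<and> \<beta> (?F (\<alpha> (Fin z))) \<noteq> Infty} = {z \<in> A'. \<beta> (moebius a b c d (Fin (g (1 / z)))) \<noteq> Infty}"
        by (auto simp: 2 A'_def split: if_splits)
      moreover have "(\<lambda>z. fin_part (\<beta> (?F (\<alpha> (Fin z))))) holomorphic_on {z \<in> A'. \<beta> (moebius a b c d (Fin (g (1 / z)))) \<noteq> Infty}"
        by (rule holomorphic_transform[OF *]) (auto simp: 2 A'_def)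
      ultimately show ?thesis by simp
    qed
  qed
qed

definition interp_a :: "complex \<Rightarrow> complex \<Rightarrow> complex \<Rightarrow> complex \<Rightarrow> complex \<Rightarrow> complex \<Rightarrow> complex" where
  "interp_a z0 z1 z2 w0 w1 w2 = w0 * (w2 - w1) * (z2 - z0) - w1 * (w2 - w0) * (z2 - z1)"
definition interp_b :: "complex \<Rightarrow> complex \<Rightarrow> complex \<Rightarrow> complex \<Rightarrow> complex \<Rightarrow> complex \<Rightarrow> complex" where
  "interp_b z0 z1 z2 w0 w1 w2 = w1 * (w2 - w0) * z0 * (z2 - z1) - w0 * (w2 - w1) * z1 * (z2 - z0)"
definition interp_c :: "complex \<Rightarrow> complex \<Rightarrow> complex \<Rightarrow> complex \<Rightarrow> complex \<Rightarrow> complex \<Rightarrow> complex" where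
  "interp_c z0 z1 z2 w0 w1 w2 = (w2 - w1) * (z2 - z0) - (w2 - w0) * (z2 - z1)"
definition interp_d :: "complex \<Rightarrow> complex \<Rightarrow> complex \<Rightarrow> complex \<Rightarrow> complex \<Rightarrow> complex \<Rightarrow> complex" where
  "interp_d z0 z1 z2 w0 w1 w2 = (w2 - w0) * z0 * (z2 - z1) - (w2 - w1) * z1 * (z2 - z0)"

lemmas interp_defs = interp_a_def interp_b_def interp_c_def interp_d_def

abbreviation "interp z0 z1 z2 w0 w1 w2 \<equiv>
  moebius (interp_a z0 z1 z2 w0 w1 w2) (interp_b z0 z1 z2 w0 w1 w2) (interp_c z0 z1 z2 w0 w1 w2) (interp_d z0 z1 z2 w0 w1 w2)"

lemma interp_det:
  "interp_a z0 z1 z2 w0 w1 w2 * interp_d z0 z1 z2 w0 w1 w2 - interp_b z0 z1 z2 w0 w1 w2 * interp_c z0 z1 z2 w0 w1 w2 =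
    (w2 - w1) * (w2 - w0) * (w0 - w1) * ((z2 - z1) * (z2 - z0) * (z0 - z1))"
  unfolding interp_defs by (simp add: algebra_simps)

text \<open>The matrix is the product of the adjugate of the one that sends \<open>w0, w1, w2\<close> to
  \<open>0, \<infinity>, 1\<close> with the one that sends \<open>z0, z1, z2\<close> there. Its
  entries are polynomials in the six points, hence depend continuously on them.\<close>

lemma moebius_interp:
  assumes "z0 \<noteq> z1" "z0 \<noteq> z2" "z1 \<noteq> z2" "w0 \<noteq> w1" "w0 \<noteq> w2" "w1 \<noteq> w2"
  shows "interp z0 z1 z2 w0 w1 w2 (Fin z0) = Fin w0"
    "interp z0 z1 z2 w0 w1 w2 (Fin z1) = Fin w1"
    "interp z0 z1 z2 w0 w1 w2 (Fin z2) = Fin w2"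
proof -
  have p: "proj x y = Fin w" if "x = w * k" "y = k" "k \<noteq> 0" for x y w k
    using that by (simp add: proj_def)
  show "interp z0 z1 z2 w0 w1 w2 (Fin z0) = Fin w0"
    unfolding moebius.simps
  proof (rule p)
    show "(w2 - w1) * (z2 - z0) * (z0 - z1) \<noteq> 0" using assms by simp
  qed (simp_all add: interp_defs algebra_simps)
  show "interp z0 z1 z2 w0 w1 w2 (Fin z1) = Fin w1"
    unfolding moebius.simps
  proof (rule p)
    show "(w2 - w0) * (z2 - z1) * (z0 - z1) \<noteq> 0" using assms by simp
  qed (simp_all add: interp_defs algebra_simps)
  show "interp z0 z1 z2 w0 w1 w2 (Fin z2) = Fin w2"
    unfolding moebius.simps
  proof (rule p)
    show "(z2 - z1) * (z2 - z0) * (w0 - w1) \<noteq> 0" using assms by simp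
  qed (simp_all add: interp_defs algebra_simps)
qed

section \<open>A periodic parallel slit map\<close>

lemma exp_eq_1_box: "\<bar>Im s\<bar> < 2 * pi \<Longrightarrow> exp s = 1 \<longleftrightarrow> s = 0"
proof
  assume i: "\<bar>Im s\<bar> < 2 * pi" and "exp s = 1"
  then obtain n where n: "Re s = 0" "Im s = of_int (2 * n) * pi" by (auto simp: exp_eq_1)
  then have "\<bar>of_int n\<bar> < (1::real)" using i by (simp add: abs_mult)
  then have "n = 0" by linarith
  then show "s = 0" using n by (simp add: complex_eq_iff)
qed auto

lemma exp_ne_1: "Re s \<noteq> 0 \<Longrightarrow> exp s \<noteq> 1"
  by (metis norm_exp_eq_Re exp_eq_one_iff norm_one)

lemma exp_edge:
  assumes "\<bar>Im s\<bar> = pi" shows "exp s = - of_real (exp (Re s))"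
proof -
  have "Im s = pi \<or> Im s = - pi" using assms by linarith
  then have "cis (Im s) = - 1" by (auto simp: complex_eq_iff)
  then show ?thesis by (subst exp_eq_polar) simp
qed

lemma exp_edge_ne_1: "Im b = pi \<Longrightarrow> exp b \<noteq> 1"
  using exp_eq_1_box[of b] by fastforce

lemma exp_notin_nonpos_Reals:
  assumes "- pi < Im s" "Im s < pi" shows "exp s \<notin> \<real>\<^sub>\<le>\<^sub>0"
proof
  assume "exp s \<in> \<real>\<^sub>\<le>\<^sub>0"
  then obtain r where r: "exp s = of_real r" "r \<le> 0" by (auto elim: nonpos_Reals_cases)
  then have "r < 0" by (metis exp_not_eq_zero of_real_0 order_le_less)
  then have "Im (Ln (exp s)) = pi" unfolding r(1) by (subst Im_Ln_eq_pi) auto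
  then show False using assms by simp
qed

lemma abs_Im_Ln_less: "w \<notin> \<real>\<^sub>\<le>\<^sub>0 \<Longrightarrow> \<bar>Im (Ln w)\<bar> < pi"
  using Im_Ln_less_pi[of w] mpi_less_Im_Ln[of w] by (cases "w = 0") auto

lemma Ln_image_slit_plane: "Ln ` (- \<real>\<^sub>\<le>\<^sub>0) = {z. \<bar>Im z\<bar> < pi}"
proof (intro equalityI subsetI)
  fix z assume "z \<in> Ln ` (- \<real>\<^sub>\<le>\<^sub>0)"
  then show "z \<in> {z. \<bar>Im z\<bar> < pi}" using abs_Im_Ln_less by auto
next
  fix z assume z: "z \<in> {z. \<bar>Im z\<bar> < pi}"
  then have I: "- pi < Im z" "Im z < pi" by auto
  then have L: "Ln (exp z) = z" by simp
  have "exp z \<notin> \<real>\<^sub>\<le>\<^sub>0" by (rule exp_notin_nonpos_Reals[OF I])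
  then show "z \<in> Ln ` (- \<real>\<^sub>\<le>\<^sub>0)" using L by (metis ComplI image_eqI)
qed

locale periodic_slit_map =
  fixes P :: real
  assumes P_gt_1: "1 < P"
begin

definition Q :: real where "Q = exp P"

abbreviation cQ :: complex where "cQ \<equiv> complex_of_real Q"

text \<open>With \<open>y = exp s\<close> and \<open>T u = (u + 1) / (u - 1)\<close>, so that \<open>coth (s
  / 2) = T y\<close>, this is \<open>T (Q\<^sup>k\<^sup>+\<^sup>1 y) + T
  (Q\<^sup>-\<^sup>k\<^sup>-\<^sup>1 y)\<close>: the terms of index \<open>\<plusminus>(k +
  1)\<close> of the sum of \<open>coth ((s + k P) / 2)\<close>. Only the symmetric pairs are
  summable.\<close>

definition pair_term :: "nat \<Rightarrow> complex \<Rightarrow> complex" where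
  "pair_term k y = 2 / (cQ ^ Suc k * y - 1) - 2 * y / (cQ ^ Suc k - y)"

definition \<rho> :: "complex \<Rightarrow> complex" where
  "\<rho> y = (\<Sum>k. pair_term k y)"

text \<open>The values of \<open>exp\<close> on \<open>|Re s| < P\<close>, where \<open>T y\<close> is the
  only term with a pole.\<close>

definition annulus :: "complex set" where
  "annulus = {y. 1 / Q < norm y \<and> norm y < Q}"

text \<open>The numerator of \<open>slit_map\<close> over the common denominator \<open>exp s - 1\<close>;
  it is holomorphic across the pole 0 of \<open>slit_map\<close> and takes the value 2 there.\<close>

definition slit_num :: "complex \<Rightarrow> complex" where
  "slit_num s = (exp s + 1) + (exp s - 1) * (\<rho> (exp s) - 2 * s / P)"

text \<open>The sum of \<open>coth ((s + k P) / 2)\<close> over all integers \<open>k\<close>, minus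
  \<open>2 s / P\<close>.\<close>

definition slit_map :: "complex \<Rightarrow> complex" where
  "slit_map s = slit_num s / (exp s - 1)"

lemma Q_gt_1: "1 < Q" and Q_pos: "0 < Q"
  using P_gt_1 by (auto simp: Q_def)

text \<open>Geometric decay, uniform for \<open>m \<le> |y| \<le> M\<close>. It yields convergence,
  holomorphy and the limit \<open>P \<longrightarrow> \<infinity>\<close> at once.\<close>

lemma norm_pair_term_le:
  assumes m: "1 / Q < m" "m \<le> norm y" and M: "norm y \<le> M" "M < Q"
  shows "norm (pair_term k y) \<le> 2 * (1 / (Q * m - 1) + M / (Q - M)) * (1 / Q) ^ k"
proof -
  have Qm: "Q * m - 1 > 0" using m Q_gt_1 by (simp add: field_simps)
  have Qk: "1 \<le> Q ^ k" using Q_gt_1 by simp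
  have M0: "0 \<le> M" using M(1) norm_ge_zero[of y] by linarith
  have a: "Q ^ k * (Q * m - 1) \<le> norm (cQ ^ Suc k * y - 1)"
  proof -
    have "Q ^ k * (Q * m - 1) = Q ^ Suc k * m - Q ^ k" by (simp add: algebra_simps)
    also have "\<dots> \<le> Q ^ Suc k * norm y - 1"
      using m Qk Q_pos by (intro diff_mono mult_left_mono) auto
    also have "\<dots> = norm (cQ ^ Suc k * y) - norm (1::complex)"
      using Q_pos by (simp add: norm_mult norm_power)
    also have "\<dots> \<le> norm (cQ ^ Suc k * y - 1)" by (rule norm_triangle_ineq2)
    finally show ?thesis .
  qed
  have b: "Q ^ k * (Q - M) \<le> norm (cQ ^ Suc k - y)"
  proof -
    have "Q ^ k * (Q - M) = Q ^ Suc k - Q ^ k * M" by (simp add: algebra_simps)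
    also have "\<dots> \<le> Q ^ Suc k - 1 * M" using Qk M0 by (intro diff_left_mono mult_right_mono) auto
    also have "\<dots> \<le> norm (cQ ^ Suc k) - norm y" using M(1) Q_pos
      by (simp add: norm_mult norm_power)
    also have "\<dots> \<le> norm (cQ ^ Suc k - y)" by (rule norm_triangle_ineq2)
    finally show ?thesis .
  qed
  have a': "norm (2 / (cQ ^ Suc k * y - 1)) \<le> 2 / (Q ^ k * (Q * m - 1))"
    unfolding norm_divide using a Qk Qm by (simp add: frac_le)
  have b': "norm (2 * y / (cQ ^ Suc k - y)) \<le> 2 * M / (Q ^ k * (Q - M))"
    unfolding norm_divide norm_mult using b Qk M M0 by (intro frac_le mult_mono mult_pos_pos) auto
  have "norm (pair_term k y) \<le> 2 / (Q ^ k * (Q * m - 1)) + 2 * M / (Q ^ k * (Q - M))"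
    unfolding pair_term_def by (rule order_trans[OF norm_triangle_ineq4 add_mono[OF a' b']])
  also have "\<dots> = 2 * (1 / (Q * m - 1) + M / (Q - M)) * (1 / Q) ^ k"
    by (simp add: power_one_over divide_inverse inverse_mult_distrib distrib_left distrib_right power_inverse ac_simps)
  finally show ?thesis .
qed

lemma summable_geo: "summable (\<lambda>k. C * (1 / Q) ^ k)" and suminf_geo: "(\<Sum>k. C * (1 / Q) ^ k) = C * (Q / (Q - 1))"
proof -
  have l: "norm (1 / Q) < 1" using Q_gt_1 by simp
  show "summable (\<lambda>k. C * (1 / Q) ^ k)" by (intro summable_mult summable_geometric l)
  show "(\<Sum>k. C * (1 / Q) ^ k) = C * (Q / (Q - 1))"
    using suminf_mult[OF summable_geometric[OF l], of C] suminf_geometric[OF l] Q_gt_1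
    by (simp add: field_simps)
qed

lemma summable_pair_term:
  assumes "y \<in> annulus" shows "summable (\<lambda>k. pair_term k y)"
proof (rule summable_comparison_test'[OF summable_geo, of 0])
  show "norm (pair_term k y) \<le> 2 * (1 / (Q * norm y - 1) + norm y / (Q - norm y)) * (1 / Q) ^ k" for k
    using assms by (intro norm_pair_term_le) (auto simp: annulus_def)
qed

lemma norm_\<rho>_le:
  assumes m: "1 / Q < m" "m \<le> norm y" and M: "norm y \<le> M" "M < Q"
  shows "norm (\<rho> y) \<le> 2 * (1 / (Q * m - 1) + M / (Q - M)) * (Q / (Q - 1))"
  unfolding \<rho>_def suminf_geo[symmetric]
  by (rule norm_suminf_le[OF norm_pair_term_le[OF assms] summable_geo])

lemma pair_term_nz:
  assumes "y \<in> annulus" shows "cQ ^ Suc k * y - 1 \<noteq> 0" "cQ ^ Suc k - y \<noteq> 0"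
proof -
  have k: "1 \<le> Q ^ k" using Q_gt_1 by simp
  have "1 < Q * norm y" using assms Q_pos by (simp add: annulus_def field_simps)
  also have "\<dots> \<le> Q ^ k * (Q * norm y)" using k Q_pos mult_right_mono[OF k, of "Q * norm y"] by simp
  finally have "norm (cQ ^ Suc k * y) \<noteq> norm (1::complex)" using Q_pos
    by (simp add: norm_mult norm_power algebra_simps)
  then show "cQ ^ Suc k * y - 1 \<noteq> 0" by auto
  have "norm y < Q" using assms by (simp add: annulus_def)
  also have "\<dots> \<le> Q ^ k * Q" using k Q_pos by simp
  finally have "norm (cQ ^ Suc k) \<noteq> norm y" using Q_pos
    by (simp add: norm_mult norm_power algebra_simps)
  then show "cQ ^ Suc k - y \<noteq> 0" by auto
qed

lemma open_annulus: "open annulus"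
  unfolding annulus_def by (intro open_Collect_conj open_Collect_less continuous_intros)

lemma holomorphic_\<rho>: "\<rho> holomorphic_on annulus"
proof (rule holomorphic_uniform_sequence[OF open_annulus, of "\<lambda>n y. \<Sum>k<n. pair_term k y"])
  show "(\<lambda>y. \<Sum>k<n. pair_term k y) holomorphic_on annulus" for n
    unfolding pair_term_def using pair_term_nz by (intro holomorphic_intros) auto
  fix y assume y: "y \<in> annulus"
  then obtain d where d: "d > 0" "cball y d \<subseteq> annulus"
    using open_annulus open_contains_cball by blast
  have "compact (norm ` cball y d)" "norm ` cball y d \<noteq> {}"
    using d by (auto intro!: compact_continuous_image continuous_intros)
  then obtain m M where m: "m \<in> norm ` cball y d" "\<And>t. t \<in> norm ` cball y d \<Longrightarrow> m \<le> t"
     and M: "M \<in> norm ` cball y d" "\<And>t. t \<in> norm ` cball y d \<Longrightarrow> t \<le> M"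
    by (metis compact_attains_inf compact_attains_sup)
  have mM: "m \<le> norm z" "norm z \<le> M" if "z \<in> cball y d" for z
    using m(2) M(2) that by blast+
  have "1 / Q < m" "M < Q" using m(1) M(1) d(2) unfolding annulus_def by blast+
  then have "uniform_limit (cball y d) (\<lambda>n y. \<Sum>k<n. pair_term k y) (\<lambda>y. \<Sum>k. pair_term k y) sequentially"
    by (intro Weierstrass_m_test[OF _ summable_geo[of "2 * (1 / (Q * m - 1) + M / (Q - M))"]]
        norm_pair_term_le mM)
  then show "\<exists>d>0. cball y d \<subseteq> annulus \<and>
     uniform_limit (cball y d) (\<lambda>n y. \<Sum>k<n. pair_term k y) \<rho> sequentially"
    using d unfolding \<rho>_def by blast
qed

text \<open>Multiplying \<open>y\<close> by \<open>Q\<close> shifts the index of the symmetric partial sums,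
  so they telescope: a term tending to \<open>T \<infinity> = 1\<close> enters and one tending to
  \<open>T 0 = -1\<close> leaves.\<close>

lemma \<rho>_shift:
  assumes y: "1 / Q < norm y" "norm y < 1"
  shows "(cQ * y + 1) / (cQ * y - 1) + \<rho> (cQ * y) = (y + 1) / (y - 1) + \<rho> y + 2"
proof -
  have Qy: "norm (cQ * y) = Q * norm y" using Q_pos by (simp add: norm_mult)
  have "1 < Q * norm y" "1 / Q < 1" using y(1) Q_gt_1 by (auto simp: field_simps)
  moreover have "Q * norm y < Q" using y(2) Q_pos by simp
  ultimately have ya: "y \<in> annulus" "cQ * y \<in> annulus"
    using y Q_gt_1 unfolding annulus_def mem_Collect_eq Qy by linarith+
  have y0: "y \<noteq> 0" using y Q_pos by auto
  have pos: "cQ ^ n * y \<noteq> 1" for n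
  proof (cases n)
    case 0 then show ?thesis using y by auto
  next
    case (Suc k) then show ?thesis using pair_term_nz(1)[OF ya(1), of k] by auto
  qed
  have neg: "cQ ^ n - y \<noteq> 0" for n
  proof (cases n)
    case 0 then show ?thesis using y by auto
  next
    case (Suc k) then show ?thesis using pair_term_nz(2)[OF ya(1), of k] by auto
  qed
  have Qnz: "cQ \<noteq> 0" using Q_pos by simp
  have part: "(cQ * y + 1) / (cQ * y - 1) + (\<Sum>k<n. pair_term k (cQ * y)) =
      (y + 1) / (y - 1) + (\<Sum>k<n. pair_term k y) +
      ((cQ ^ Suc n * y + 1) / (cQ ^ Suc n * y - 1) - (y + cQ ^ n) / (y - cQ ^ n))" for n
  proof (induction n)
    case 0
    then show ?case by simp
  next
    case (Suc n)
    define A where "A = cQ ^ Suc n * y"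
    define B where "B = cQ ^ n"
    define q where "q = complex_of_real Q"
    have nz: "A - 1 \<noteq> 0" "q * A - 1 \<noteq> 0" "y - B \<noteq> 0" "y - q * B \<noteq> 0" "q \<noteq> 0" "B - y \<noteq> 0" "q * B - y \<noteq> 0"
      using pos[of "Suc n"] pos[of "Suc (Suc n)"] neg[of n] neg[of "Suc n"] Qnz
      unfolding A_def B_def q_def by (auto simp: algebra_simps)
    have t1: "pair_term n (cQ * y) = 2 / (q * A - 1) - 2 * y / (B - y)"
    proof -
      have "pair_term n (cQ * y) = 2 / (q * A - 1) - 2 * (q * y) / (q * B - q * y)"
        unfolding pair_term_def A_def B_def q_def by (simp add: algebra_simps)
      also have "2 * (q * y) / (q * B - q * y) = 2 * y / (B - y)"
      proof -
        have "2 * (q * y) / (q * B - q * y) = (q * (2 * y)) / (q * (B - y))" by (simp add: algebra_simps)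
        also have "\<dots> = 2 * y / (B - y)" using nz(5) by (rule mult_divide_mult_cancel_left)
        finally show ?thesis .
      qed
      finally show ?thesis .
    qed
    have t2: "pair_term n y = 2 / (A - 1) - 2 * y / (q * B - y)"
      unfolding pair_term_def A_def B_def q_def by (simp add: algebra_simps)
    have T: "(u + 1) / (u - 1) = 1 + 2 / (u - 1)" if "u - 1 \<noteq> 0" for u :: complex
      using that by (simp add: field_simps)
    have U: "(y + c) / (y - c) = - 1 - 2 * y / (c - y)" if "c - y \<noteq> 0" for c
    proof -
      have "y - c \<noteq> 0" using that by auto
      then show ?thesis using that by (simp add: divide_simps) (simp add: algebra_simps)
    qed
    have key: "pair_term n (cQ * y) + ((A + 1) / (A - 1) - (y + B) / (y - B)) =
       pair_term n y + ((q * A + 1) / (q * A - 1) - (y + q * B) / (y - q * B))"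
      unfolding t1 t2 T[OF nz(1)] T[OF nz(2)] U[OF nz(6)] U[OF nz(7)] by simp
    have "(cQ * y + 1) / (cQ * y - 1) + (\<Sum>k<Suc n. pair_term k (cQ * y)) =
       (y + 1) / (y - 1) + (\<Sum>k<n. pair_term k y) + (pair_term n (cQ * y) + ((A + 1) / (A - 1) - (y + B) / (y - B)))"
      using Suc.IH unfolding A_def B_def by simp
    also have "\<dots> = (y + 1) / (y - 1) + (\<Sum>k<n. pair_term k y) +
       (pair_term n y + ((q * A + 1) / (q * A - 1) - (y + q * B) / (y - q * B)))"
      by (simp only: key)
    also have "\<dots> = (y + 1) / (y - 1) + (\<Sum>k<Suc n. pair_term k y) +
      ((cQ ^ Suc (Suc n) * y + 1) / (cQ ^ Suc (Suc n) * y - 1) - (y + cQ ^ Suc n) / (y - cQ ^ Suc n))"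
      unfolding A_def B_def q_def by (simp add: algebra_simps)
    finally show ?case .
  qed
  have inv: "(\<lambda>n. inverse (cQ ^ n)) \<longlonglongrightarrow> 0"
    using tendsto_of_real[OF LIMSEQ_inverse_realpow_zero[OF Q_gt_1], where 'a = complex] by simp
  have Qn: "cQ ^ n \<noteq> 0" for n using Qnz by simp
  have scale: "(y + inverse r) / (y - inverse r) = (r * y + 1) / (r * y - 1)" if "r \<noteq> 0" for r :: complex
    using mult_divide_mult_cancel_left[OF that, of "y + inverse r" "y - inverse r"] that
    by (simp add: distrib_left right_diff_distrib)
  have l1: "(\<lambda>n. (cQ ^ Suc n * y + 1) / (cQ ^ Suc n * y - 1)) \<longlonglongrightarrow> (1::complex)"
  proof -
    have "(\<lambda>n. (y + inverse (cQ ^ Suc n)) / (y - inverse (cQ ^ Suc n))) \<longlonglongrightarrow> (y + 0) / (y - 0)"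
      using y0 by (intro tendsto_intros LIMSEQ_Suc[OF inv]) auto
    moreover have "(y + inverse (cQ ^ Suc n)) / (y - inverse (cQ ^ Suc n))
       = (cQ ^ Suc n * y + 1) / (cQ ^ Suc n * y - 1)" for n
      by (rule scale[OF Qn])
    ultimately show ?thesis unfolding add_0_right diff_zero divide_self[OF y0] by (simp only:)
  qed
  have l2: "(\<lambda>n. (y + cQ ^ n) / (y - cQ ^ n)) \<longlonglongrightarrow> (-1::complex)"
  proof -
    have "(\<lambda>n. (inverse (cQ ^ n) * y + 1) / (inverse (cQ ^ n) * y - 1)) \<longlonglongrightarrow> (0 * y + 1) / (0 * y - 1)"
      by (intro tendsto_intros inv) auto
    moreover have "(inverse (cQ ^ n) * y + 1) / (inverse (cQ ^ n) * y - 1)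
       = (y + cQ ^ n) / (y - cQ ^ n)" for n
      using Qn[of "n"] mult_divide_mult_cancel_left[OF Qn[of n], of "inverse (cQ ^ n) * y + 1"
        "inverse (cQ ^ n) * y - 1"] by (simp add: distrib_left right_diff_distrib mult.assoc[symmetric])
    ultimately show ?thesis by simp
  qed
  have "(\<lambda>n. (cQ * y + 1) / (cQ * y - 1) + (\<Sum>k<n. pair_term k (cQ * y))) \<longlonglongrightarrow> (cQ * y + 1) / (cQ * y - 1) + \<rho> (cQ * y)"
    unfolding \<rho>_def by (intro tendsto_intros summable_LIMSEQ summable_pair_term ya)
  moreover have "(\<lambda>n. (y + 1) / (y - 1) + (\<Sum>k<n. pair_term k y) +
      ((cQ ^ Suc n * y + 1) / (cQ ^ Suc n * y - 1) - (y + cQ ^ n) / (y - cQ ^ n))) \<longlonglongrightarrow> (y + 1) / (y - 1) + \<rho> y + (1 - (-1))"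
    unfolding \<rho>_def by (intro tendsto_add tendsto_diff tendsto_const summable_LIMSEQ summable_pair_term ya l1 l2)
  ultimately show ?thesis unfolding part using LIMSEQ_unique by fastforce
qed

end

section \<open>Counting zeros in a period\<close>

context periodic_slit_map
begin

definition band :: "complex set" where
  "band = {s. \<bar>Re s\<bar> < P}"

lemma open_band: "open band" and convex_band: "convex band"
proof -
  have b: "band = {s. - P < Re s} \<inter> {s. Re s < P}" by (auto simp: band_def)
  show "open band" unfolding b by (intro open_Int open_halfspace_Re_gt open_halfspace_Re_lt)
  show "convex band" unfolding b by (intro convex_Int convex_halfspace_Re_gt convex_halfspace_Re_lt)
qed

lemma inverse_Q: "1 / Q = exp (- P)"
  by (simp add: Q_def exp_minus inverse_eq_divide)

lemma exp_in_annulus: "s \<in> band \<Longrightarrow> exp s \<in> annulus"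
  unfolding annulus_def inverse_Q by (auto simp: band_def Q_def)

lemma holomorphic_slit_num: "slit_num holomorphic_on band"
  unfolding slit_num_def using P_gt_1 exp_in_annulus
  by (intro holomorphic_intros holomorphic_on_compose_gen[OF _ holomorphic_\<rho>, unfolded o_def]) auto

lemma slit_num_0: "slit_num 0 = 2"
  by (simp add: slit_num_def)

lemma slit_map_eq: "exp s \<noteq> 1 \<Longrightarrow> slit_map s = (exp s + 1) / (exp s - 1) + \<rho> (exp s) - 2 * s / P"
  by (simp add: slit_map_def slit_num_def add_divide_distrib)

lemma slit_map_eq_iff: "exp s \<noteq> 1 \<Longrightarrow> slit_map s = w \<longleftrightarrow> slit_num s = w * (exp s - 1)"
  by (auto simp: slit_map_def field_simps)

lemma slit_map_periodic:
  assumes "- P < Re s" "Re s < 0" shows "slit_map (s + P) = slit_map s"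
proof -
  have y: "1 / Q < norm (exp s)" "norm (exp s) < 1"
    using assms unfolding inverse_Q by auto
  have Qy: "exp (s + P) = cQ * exp s" by (simp add: exp_add Q_def exp_of_real)
  have "exp (s + P) \<noteq> 1" "exp s \<noteq> 1"
    using assms by (auto intro!: exp_ne_1)
  then show ?thesis
    using \<rho>_shift[OF y] P_gt_1 by (simp add: slit_map_eq Qy add_divide_distrib distrib_left)
qed

lemma \<rho>_real: "t \<in> \<real> \<Longrightarrow> t \<in> annulus \<Longrightarrow> \<rho> t \<in> \<real>"
proof -
  assume t: "t \<in> \<real>" "t \<in> annulus"
  have r: "pair_term k t \<in> \<real>" for k
    unfolding pair_term_def using t by (intro Reals_diff Reals_divide Reals_mult Reals_power) auto
  show "\<rho> t \<in> \<real>" unfolding \<rho>_def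
  proof (rule closed_sequentially[OF closed_complex_Reals _ summable_LIMSEQ[OF summable_pair_term[OF t(2)]]])
    show "(\<Sum>k<n. pair_term k t) \<in> \<real>" for n using r by (auto intro: sum_in_Reals)
  qed
qed

text \<open>On \<open>Im s = \<plusminus>\<pi>\<close> the number \<open>exp s\<close> is real, and so is
  every term of the sum; only \<open>2 s / P\<close> contributes.\<close>

lemma Im_slit_map_edge:
  assumes "\<bar>Im s\<bar> = pi" "s \<in> band" shows "Im (slit_map s) = - 2 * Im s / P"
proof -
  have E: "exp s \<in> \<real>" unfolding exp_edge[OF assms(1)] by simp
  have n: "exp s \<noteq> 1"
  proof
    assume "exp s = 1"
    then have "Re (- complex_of_real (exp (Re s))) = Re 1" unfolding exp_edge[OF assms(1)] by simp
    then show False using exp_gt_zero[of "Re s"] by simp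
  qed
  have "(exp s + 1) / (exp s - 1) + \<rho> (exp s) \<in> \<real>"
    using E \<rho>_real[OF E exp_in_annulus[OF assms(2)]] by (intro Reals_add Reals_divide Reals_diff) auto
  then show ?thesis unfolding slit_map_eq[OF n] by (simp add: complex_is_Real_iff)
qed

end

context periodic_slit_map
begin

text \<open>The argument principle on a period rectangle of height \<open>2 \<pi>\<close>, applied to
  \<open>M = slit_num - w (exp - 1)\<close>. Off the pole, \<open>M / (exp - 1) = slit_map -
  w\<close>. The logarithmic derivative of this quotient has integral 0: the vertical sides cancel
  by periodicity, and on a horizontal side the quotient stays in a half-plane and returns to its
  initial value. So \<open>M\<close> has as many zeros in the rectangle as \<open>exp - 1\<close>,
  that is, one.\<close>

lemma zero_of_slit_num_unique:
  assumes w: "Im w \<noteq> 2 * pi / P" "Im w \<noteq> - 2 * pi / P"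
    and a: "\<bar>Re a\<bar> < P" "\<bar>Im a\<bar> < pi" "slit_num a = w * (exp a - 1)"
    and b: "\<bar>Re b\<bar> < P" "\<bar>Im b\<bar> < pi" "slit_num b = w * (exp b - 1)"
  shows "a - b \<in> {0, of_real P, - of_real P}"
proof -
  define Y where "Y = (\<lambda>s::complex. exp s - 1)"
  define M where "M = (\<lambda>s. slit_num s - w * Y s)"
  have holY: "Y holomorphic_on A" for A unfolding Y_def by (intro holomorphic_intros)
  have holM: "M holomorphic_on band" unfolding M_def using holY by (intro holomorphic_intros holomorphic_slit_num)
  have M0: "M 0 = 2" by (simp add: M_def Y_def slit_num_0)
  have dM: "(M has_field_derivative deriv M s) (at s)" if "s \<in> band" for s
    using holM open_band that holomorphic_derivI by blast
  have dY: "(Y has_field_derivative deriv Y s) (at s)" for s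
    using holY[of UNIV] holomorphic_derivI by blast
  have M_e: "M s = Y s * (slit_map s - w)" if "Y s \<noteq> 0" for s
    using that unfolding M_def Y_def slit_map_def by (simp add: field_simps)
  have Y0: "Y s = 0 \<longleftrightarrow> s = 0" if "\<bar>Im s\<bar> < 2 * pi" for s
    using exp_eq_1_box[OF that] by (simp add: Y_def)
  have pi2: "pi < 2 * pi" by simp
  \<comment> \<open>All relevant zeros have \<open>|Re| < R < P\<close>; as \<open>P / 2 < R\<close>, there is room for a period rectangle.\<close>
  define R where "R = (max (P / 2) (max \<bar>Re a\<bar> \<bar>Re b\<bar>) + P) / 2"
  have R: "P / 2 < R" "R < P" "\<bar>Re a\<bar> < R" "\<bar>Re b\<bar> < R" using a b P_gt_1 by (auto simp: R_def max_def)
  define S where "S = box (Complex (- R) (- 2 * pi)) (Complex R (2 * pi))"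
  define K where "K = cbox (Complex (- R) (- 2 * pi)) (Complex R (2 * pi))"
  have S: "s \<in> S \<longleftrightarrow> \<bar>Re s\<bar> < R \<and> \<bar>Im s\<bar> < 2 * pi" for s
    by (auto simp: S_def in_box_complex_iff)
  have "S \<subseteq> K" unfolding S_def K_def by (rule box_subset_cbox)
  have Kb: "K \<subseteq> band" using R by (auto simp: K_def in_cbox_complex_iff band_def)
  have Sb: "S \<subseteq> band" using Kb \<open>S \<subseteq> K\<close> by blast
  have "\<not> M constant_on band"
  proof
    assume "M constant_on band"
    moreover have "a \<in> band" "0 \<in> band" using a P_gt_1 by (auto simp: band_def)
    ultimately have "M a = M 0" unfolding constant_on_def by metis
    then show False using M0 a(3) by (simp add: M_def Y_def)
  qed
  then have "finite {s \<in> K. M s = 0}"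
    using holomorphic_compact_finite_zeros[OF holM open_band convex_connected[OF convex_band] _ Kb]
    by (simp add: K_def)
  define Z where "Z = {s \<in> S. M s = 0}"
  have finZ: "finite Z" unfolding Z_def
    using \<open>finite {s \<in> K. M s = 0}\<close> \<open>S \<subseteq> K\<close> by (rule_tac finite_subset) auto
  \<comment> \<open>Finitely many zeros leave room for vertical sides that avoid them.\<close>
  have "infinite ({- R<..<R - P} - (Re ` Z \<union> (\<lambda>z. Re z - P) ` Z))"
    using R finZ by (intro Diff_infinite_finite finite_UnI finite_imageI) auto
  then obtain x0 where "x0 \<in> {- R<..<R - P} - (Re ` Z \<union> (\<lambda>z. Re z - P) ` Z)"
    using infinite_imp_nonempty by blast
  then have x0: "- R < x0" "x0 < R - P" "x0 \<notin> Re ` Z" "x0 + P \<notin> Re ` Z"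
    by (auto simp: image_iff)
  define a1 a2 a3 a4 where "a1 = Complex x0 (- pi)" and "a2 = Complex (x0 + P) (- pi)"
     and "a3 = Complex (x0 + P) pi" and "a4 = Complex x0 pi"
  define g where "g = rectpath a1 a3"
  have cb: "cbox a1 a3 \<subseteq> S"
  proof
    fix s assume "s \<in> cbox a1 a3"
    then have "x0 \<le> Re s" "Re s \<le> x0 + P" "-pi \<le> Im s" "Im s \<le> pi" by (auto simp: in_cbox_complex_iff a1_def a3_def)
    then show "s \<in> S" unfolding S using x0 R pi2 pi_gt_zero by linarith
  qed
  have pimg: "path_image g = cbox a1 a3 - box a1 a3"
    unfolding g_def by (rule path_image_rectpath_cbox_minus_box) (use P_gt_1 in \<open>auto simp: a1_def a3_def\<close>)
  have onpath: "s \<in> path_image g \<longleftrightarrow> s \<in> cbox a1 a3 \<and> (Re s = x0 \<or> Re s = x0 + P \<or> \<bar>Im s\<bar> = pi)" for s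
    unfolding pimg using P_gt_1 by (auto simp: in_cbox_complex_iff in_box_complex_iff a1_def a3_def)
  have edge: "Y s \<noteq> 0 \<and> Im (slit_map s - w) \<noteq> 0" if "\<bar>Im s\<bar> = pi" "s \<in> band" for s
  proof
    show "Y s \<noteq> 0" using Y0[of s] that(1) by auto
    have "Im s = pi \<or> Im s = - pi" using that(1) by linarith
    then show "Im (slit_map s - w) \<noteq> 0" using Im_slit_map_edge[OF that] w by auto
  qed
  have nzp: "M s \<noteq> 0 \<and> Y s \<noteq> 0 \<and> s \<in> S" if "s \<in> path_image g" for s
  proof -
    have sS: "s \<in> S" using that onpath cb by blast
    show ?thesis
    proof (cases "\<bar>Im s\<bar> = pi")
      case True
      then have *: "Y s \<noteq> 0" "Im (slit_map s - w) \<noteq> 0" using edge sS Sb by auto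
      have "M s \<noteq> 0" unfolding M_e[OF *(1)] using * by auto
      then show ?thesis using * sS by simp
    next
      case False
      then have s: "Re s = x0 \<or> Re s = x0 + P" using that onpath by blast
      then have "M s \<noteq> 0" using sS x0(3,4) unfolding Z_def by force
      moreover have "s \<noteq> 0" using s x0 R by auto
      then have "Y s \<noteq> 0" using Y0[of s] sS S by auto
      ultimately show ?thesis using sS by simp
    qed
  qed
  have vg: "valid_path g" "pathfinish g = pathstart g" by (auto simp: g_def)
  have oS: "open S" "connected S" "convex S"
    unfolding S_def by (auto intro: convex_connected convex_box)
  have wind0: "\<forall>z. z \<notin> S \<longrightarrow> winding_number g z = 0"
    using cb P_gt_1 unfolding g_def
    by (intro allI impI winding_number_rectpath_outside) (auto simp: a1_def a3_def)
  have apM: "contour_integral g (\<lambda>x. deriv M x / M x) = 2 * pi * \<i> * (\<Sum>p\<in>Z. winding_number g p * zorder M p)"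
    using argument_principle[OF oS(1,2) _ _ vg _ wind0, of M "{}" "\<lambda>_. 1"] holM Sb nzp finZ
    by (auto simp: Z_def holomorphic_on_subset)
  have ZY: "{s \<in> S. Y s = 0} = {0}" using Y0 S R P_gt_1 by auto
  have apY: "contour_integral g (\<lambda>x. deriv Y x / Y x) = 2 * pi * \<i> * (winding_number g 0 * zorder Y 0)"
    using argument_principle[OF oS(1,2) _ _ vg _ wind0, of Y "{}" "\<lambda>_. 1"] holY[of S] nzp ZY
    by auto
  have w0: "winding_number g 0 = 1"
    unfolding g_def using x0 R by (intro winding_number_rectpath) (auto simp: in_box_complex_iff a1_def a3_def)
  have z0: "zorder Y 0 = 1"
  proof (rule zorder_zero_eqI[OF holY[of UNIV]])
    show "(deriv ^^ nat 1) Y 0 \<noteq> 0"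
    proof -
      have "(Y has_field_derivative 1) (at 0)" unfolding Y_def by (auto intro!: derivative_eq_intros)
      then show ?thesis by (simp add: DERIV_imp_deriv)
    qed
  qed (auto simp: Y_def)
  define E where "E = (\<lambda>s. M s / Y s)"
  define G where "G = (\<lambda>s. deriv M s / M s - deriv Y s / Y s)"
  have E_e: "E s = slit_map s - w" if "Y s \<noteq> 0" for s using M_e[OF that] that by (simp add: E_def)
  have dE: "(E has_field_derivative G s * E s) (at s)" if "s \<in> band" "Y s \<noteq> 0" "M s \<noteq> 0" for s
    unfolding E_def G_def using that
    by (auto intro!: derivative_eq_intros dM dY simp: field_simps)
  have horiz: "(G has_contour_integral 0) (linepath p q)"
    if pq: "closed_segment p q \<subseteq> {s \<in> S. \<bar>Im s\<bar> = pi}" "E p = E q" for p q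
  proof -
    have "(G has_contour_integral (Ln (E (pathfinish (linepath p q))) - Ln (E (pathstart (linepath p q))))) (linepath p q)"
    proof (rule contour_integral_primitive[where S = "closed_segment p q"])
      fix s assume "s \<in> closed_segment p q"
      then have s: "\<bar>Im s\<bar> = pi" "s \<in> band" using pq Sb by auto
      have Ys: "Y s \<noteq> 0" "Im (E s) \<noteq> 0" using edge[OF s] E_e by auto
      have "M s \<noteq> 0" using Ys by (auto simp: E_def)
      have "E s \<notin> \<real>\<^sub>\<le>\<^sub>0" using Ys(2) by (auto simp: complex_nonpos_Reals_iff)
      then have "((\<lambda>s. Ln (E s)) has_field_derivative inverse (E s) * (G s * E s)) (at s)"
        using DERIV_chain2[OF has_field_derivative_Ln dE[OF s(2) Ys(1) \<open>M s \<noteq> 0\<close>]] by simp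
      moreover have "E s \<noteq> 0" using Ys(2) by auto
      then have "inverse (E s) * (G s * E s) = G s" by simp
      ultimately show "((\<lambda>s. Ln (E s)) has_field_derivative G s) (at s within closed_segment p q)"
        by (simp add: has_field_derivative_at_within)
    qed auto
    then show ?thesis using pq(2) by simp
  qed
  have Eper: "E (s + P) = E s" if "- P < Re s" "Re s < 0" for s
  proof -
    have "Y s \<noteq> 0" "Y (s + P) \<noteq> 0" unfolding Y_def using that exp_ne_1[of s] exp_ne_1[of "s + P"] by auto
    then show ?thesis using slit_map_periodic[OF that] by (simp add: E_e)
  qed
  have Gper: "G (s + P) = G s" if s: "s \<in> path_image g" "Re s = x0" for s
  proof -
    have sP: "s + P \<in> path_image g" using s P_gt_1 unfolding onpath by (auto simp: in_cbox_complex_iff a1_def a3_def)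
    have rs: "- P < Re s" "Re s < 0" using s(2) x0 R by auto
    have "(E has_field_derivative G (s + P) * E (s + P)) (at (s + P))"
      using nzp[OF sP] Sb by (intro dE) auto
    then have "((\<lambda>t. E (t + P)) has_field_derivative G (s + P) * E (s + P)) (at s)"
      by (simp add: DERIV_shift)
    moreover have "((\<lambda>t. E (t + P)) has_field_derivative G s * E s) (at s)"
    proof (rule has_field_derivative_transform_within_open)
      show "(E has_field_derivative G s * E s) (at s)" using nzp[OF s(1)] Sb by (intro dE) auto
      show "open {t. - P < Re t \<and> Re t < 0}"
        by (intro open_Collect_conj open_Collect_less continuous_intros)
    qed (use rs Eper in auto)
    ultimately have "G (s + P) * E (s + P) = G s * E s" by (rule DERIV_unique)
    moreover have "E s \<noteq> 0" using nzp[OF s(1)] by (simp add: E_def)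
    ultimately show ?thesis using Eper[OF rs] by simp
  qed
  have "a2 = a1 + P" "a3 = a4 + P" by (auto simp: a1_def a2_def a3_def a4_def complex_eq_iff)
  have g_eq: "g = linepath a1 a2 +++ linepath a2 a3 +++ linepath a3 a4 +++ linepath a4 a1"
    unfolding g_def rectpath_def Let_def a1_def a2_def a3_def a4_def by simp
  have segs: "path_image g = closed_segment a1 a2 \<union> (closed_segment a2 a3 \<union> (closed_segment a3 a4 \<union> closed_segment a4 a1))"
    unfolding g_eq by (simp add: path_image_join)
  define T where "T = S - Z - {0}"
  have Tnz: "M s \<noteq> 0" "Y s \<noteq> 0" if "s \<in> T" for s using that Y0[of s] S by (auto simp: T_def Z_def)
  have Tb: "T \<subseteq> band" using Sb by (auto simp: T_def)
  have oT: "open T" unfolding T_def using oS finZ by (intro open_Diff finite_imp_closed) auto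
  have hMM: "(\<lambda>x. deriv M x / M x) holomorphic_on T"
    by (intro holomorphic_on_divide Tnz holomorphic_on_subset[OF holM Tb]
        holomorphic_on_subset[OF holomorphic_deriv[OF holM open_band] Tb])
  have hYY: "(\<lambda>x. deriv Y x / Y x) holomorphic_on T"
    by (intro holomorphic_on_divide Tnz holY holomorphic_deriv oT)
  have holG: "G holomorphic_on T"
    unfolding G_def by (intro holomorphic_on_diff hMM hYY)
  have pS: "path_image g \<subseteq> T"
  proof
    fix s assume "s \<in> path_image g"
    from nzp[OF this] show "s \<in> T" by (auto simp: T_def Z_def Y_def)
  qed
  have "closed_segment a2 a3 \<subseteq> T" using pS unfolding segs by blast
  then have "continuous_on (closed_segment a2 a3) G"
    using holomorphic_on_imp_continuous_on[OF holG] continuous_on_subset by blast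
  then obtain I where I: "(G has_contour_integral I) (linepath a2 a3)"
    using contour_integrable_continuous_linepath contour_integrable_on_def by blast
  have "(G has_contour_integral I) (linepath a1 a4)"
    unfolding has_contour_integral_linepath
  proof (rule has_integral_eq[OF _ I[unfolded has_contour_integral_linepath]])
    fix x :: real assume x: "x \<in> {0..1}"
    have l: "linepath a2 a3 x = linepath a1 a4 x + P"
      unfolding linepath_def \<open>a2 = a1 + P\<close> \<open>a3 = a4 + P\<close> by (simp add: algebra_simps scaleR_conv_of_real)
    have "linepath a1 a4 x \<in> closed_segment a4 a1" using x linepath_in_path[of x a1 a4] by (simp add: closed_segment_commute)
    then have "linepath a1 a4 x \<in> path_image g" unfolding segs by blast
    moreover have "Re (linepath a1 a4 x) = x0" by (simp add: linepath_def a1_def a4_def algebra_simps)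
    ultimately show "G (linepath a2 a3 x) * (a3 - a2) = G (linepath a1 a4 x) * (a4 - a1)"
      unfolding l using Gper by (simp add: \<open>a2 = a1 + P\<close> \<open>a3 = a4 + P\<close>)
  qed
  then have I': "(G has_contour_integral - I) (linepath a4 a1)"
    by (rule has_contour_integral_reverse_linepath)
  have rx: "- P < x0" "x0 < 0" using x0 R by auto
  have bot: "(G has_contour_integral 0) (linepath a1 a2)"
  proof (rule horiz)
    show "closed_segment a1 a2 \<subseteq> {s \<in> S. \<bar>Im s\<bar> = pi}"
    proof
      fix s assume s: "s \<in> closed_segment a1 a2"
      then obtain u where "s = (1 - u) *\<^sub>R a1 + u *\<^sub>R a2" by (auto simp: closed_segment_def)
      then have "Im s = (1 - u) * (- pi) + u * (- pi)" by (simp add: a1_def a2_def)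
      then have "Im s = - pi" by (simp add: algebra_simps)
      moreover have "s \<in> S" using s nzp segs by blast
      ultimately show "s \<in> {s \<in> S. \<bar>Im s\<bar> = pi}" by simp
    qed
    show "E a1 = E a2" unfolding \<open>a2 = a1 + P\<close> using rx by (intro Eper[symmetric]) (auto simp: a1_def)
  qed
  have top: "(G has_contour_integral 0) (linepath a3 a4)"
  proof (rule horiz)
    show "closed_segment a3 a4 \<subseteq> {s \<in> S. \<bar>Im s\<bar> = pi}"
    proof
      fix s assume s: "s \<in> closed_segment a3 a4"
      then obtain u where "s = (1 - u) *\<^sub>R a3 + u *\<^sub>R a4" by (auto simp: closed_segment_def)
      then have "Im s = (1 - u) * pi + u * pi" by (simp add: a3_def a4_def)
      then have "Im s = pi" by (simp add: algebra_simps)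
      moreover have "s \<in> S" using s nzp segs by blast
      ultimately show "s \<in> {s \<in> S. \<bar>Im s\<bar> = pi}" by simp
    qed
    show "E a3 = E a4" unfolding \<open>a3 = a4 + P\<close> using rx by (intro Eper) (auto simp: a4_def)
  qed
  have "(G has_contour_integral (0 + (I + (0 + - I)))) g"
    unfolding g_eq by (intro has_contour_integral_join bot I top I' valid_path_join) auto
  then have "contour_integral g G = 0" by (simp add: contour_integral_unique)
  moreover have "contour_integral g G = contour_integral g (\<lambda>x. deriv M x / M x) - contour_integral g (\<lambda>x. deriv Y x / Y x)"
    unfolding G_def
    by (intro contour_integral_diff contour_integrable_holomorphic_simple[OF hMM oT vg(1) pS]
      contour_integrable_holomorphic_simple[OF hYY oT vg(1) pS])
  ultimately have "contour_integral g (\<lambda>x. deriv M x / M x) = 2 * pi * \<i> * 1"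
    unfolding apY w0 z0 by simp
  then have sum1: "(\<Sum>p\<in>Z. winding_number g p * zorder M p) = 1" unfolding apM by simp
  have wp: "winding_number g p = (if p \<in> box a1 a3 then 1 else 0)" if "p \<in> Z" for p
  proof (cases "p \<in> box a1 a3")
    case True
    then show ?thesis unfolding g_def by (simp add: winding_number_rectpath)
  next
    case False
    have "p \<notin> path_image g" using nzp that by (auto simp: Z_def)
    then have "p \<notin> cbox a1 a3" using False pimg by auto
    then show ?thesis using False unfolding g_def using P_gt_1
      by (simp add: winding_number_rectpath_outside a1_def a3_def)
  qed
  have zM: "zorder M p \<ge> 1" if "p \<in> Z" for p
  proof -
    have pb: "p \<in> band" "M p = 0" using that Sb by (auto simp: Z_def)
    have "\<exists>z\<in>band. M z \<noteq> 0" using M0 P_gt_1 by (intro bexI[of _ 0]) (auto simp: band_def)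
    from zorder_exist_zero[OF holM open_band convex_connected[OF convex_band] pb(1) this]
    show ?thesis using pb(2) by (auto split: if_splits)
  qed
  define B where "B = Z \<inter> box a1 a3"
  have "(\<Sum>p\<in>Z. winding_number g p * zorder M p) = (\<Sum>p\<in>Z. if p \<in> box a1 a3 then of_int (zorder M p) else 0)"
    by (intro sum.cong refl) (simp add: wp)
  also have "\<dots> = of_int (\<Sum>p\<in>B. zorder M p)"
    unfolding B_def sum.inter_restrict[OF finZ] of_int_sum by (intro sum.cong refl) auto
  finally have sumB: "(\<Sum>p\<in>B. zorder M p) = 1" using sum1
    by (metis of_int_1 of_int_eq_iff)
  have "of_nat (card B) \<le> (\<Sum>p\<in>B. zorder M p)"
    using sum_mono[of B "\<lambda>_. 1" "zorder M"] zM by (simp add: B_def)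
  \<comment> \<open>Every zero contributes at least 1 to a sum that equals 1.\<close>
  then have cB: "card B \<le> 1" using sumB by simp
  have finB: "finite B" using finZ by (simp add: B_def)
  \<comment> \<open>Move a zero into the rectangle by a multiple of the period.\<close>
  have shift: "\<exists>c\<in>B. a - c \<in> {0, of_real P, - of_real P}" if a: "\<bar>Re a\<bar> < R" "\<bar>Im a\<bar> < pi" "M a = 0" for a
  proof -
    have Ia: "\<bar>Im a\<bar> < 2 * pi" using a(2) by simp
    have aZ: "a \<in> Z" using a Ia S unfolding Z_def by auto
    have "a \<noteq> 0" using M0 a(3) by auto
    then have Ya: "Y a \<noteq> 0" using Y0[OF Ia] by simp
    then have ea: "E a = 0" using a(3) by (simp add: E_def)
    have mem: "c \<in> B" if "Re c \<in> {x0<..<x0 + P}" "Im c = Im a" "E c = 0" "c \<noteq> 0" for c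
    proof -
      have cb': "c \<in> box a1 a3" using that a(2) by (auto simp: in_box_complex_iff a1_def a3_def)
      have "c \<in> S" using cb' cb box_subset_cbox by blast
      have "Y c \<noteq> 0" using Y0[of c] that Ia by simp
      then have "M c = 0" using that(3) by (simp add: E_def)
      then show ?thesis using cb' \<open>c \<in> S\<close> by (auto simp: B_def Z_def)
    qed
    have "Re a \<noteq> x0" "Re a \<noteq> x0 + P" using x0(3,4) aZ by force+
    then consider "Re a < x0" | "x0 < Re a" "Re a < x0 + P" | "x0 + P < Re a" by linarith
    then show ?thesis
    proof cases
      case 1
      have "a + P \<in> B"
      proof (rule mem)
        show "E (a + P) = 0" using Eper[of a] ea 1 x0 R a by auto
        have "Re (a + P) \<noteq> 0" using a R by auto
        then show "a + P \<noteq> 0" by (metis zero_complex.sel(1))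
      qed (use 1 x0 R a in auto)
      then show ?thesis by (intro bexI[of _ "a + P"]) auto
    next
      case 2
      then show ?thesis using mem[of a] ea \<open>a \<noteq> 0\<close> by (intro bexI[of _ a]) auto
    next
      case 3
      have "a - P \<in> B"
      proof (rule mem)
        show "E (a - P) = 0" using Eper[of "a - P"] ea 3 x0 R a by auto
        have "Re (a - P) \<noteq> 0" using a R by auto
        then show "a - P \<noteq> 0" by (metis zero_complex.sel(1))
      qed (use 3 x0 R a in auto)
      then show ?thesis by (intro bexI[of _ "a - P"]) auto
    qed
  qed
  have Mab: "M a = 0" "M b = 0" using a(3) b(3) by (simp_all add: M_def Y_def)
  obtain c where c: "c \<in> B" "a - c \<in> {0, of_real P, - of_real P}" using shift[OF R(3) a(2) Mab(1)] by blast
  obtain d where d: "d \<in> B" "b - d \<in> {0, of_real P, - of_real P}" using shift[OF R(4) b(2) Mab(2)] by blast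
  have "c = d" using cB finB c(1) d(1) card_le_Suc0_iff_eq[OF finB] by auto
  obtain u where u: "a - c = of_real u" "u \<in> {0, P, - P}" using c(2) by auto
  obtain v where v: "b - d = of_real v" "v \<in> {0, P, - P}" using d(2) by auto
  have ab: "a - b = of_real (u - v)" using u(1) v(1) \<open>c = d\<close> by (simp add: algebra_simps)
  have "\<bar>Re (a - b)\<bar> < 2 * P" using a(1) b(1) by auto
  then have "\<bar>u - v\<bar> < 2 * P" unfolding ab by simp
  then have "u - v \<in> {0, P, - P}" using u(2) v(2) P_gt_1 by auto
  then have "complex_of_real (u - v) \<in> of_real ` {0, P, - P}" by (rule imageI)
  then show ?thesis unfolding ab by simp
qed

end

section \<open>A periodic map into the slit plane\<close>

context periodic_slit_map
begin

definition strip :: "complex set" where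
  "strip = {s. \<bar>Re s\<bar> < P \<and> \<bar>Im s\<bar> < pi}"

lemma strip_box: "strip = box (Complex (- P) (- pi)) (Complex P pi)"
  by (auto simp: strip_def in_box_complex_iff)

lemma open_strip: "open strip" and connected_strip: "connected strip"
  unfolding strip_box by (auto intro: convex_connected convex_box)

lemma zero_in_strip: "0 \<in> strip"
  using P_gt_1 by (simp add: strip_def)

lemma strip_subset_band: "strip \<subseteq> band"
  by (auto simp: strip_def band_def)

lemma exp_eq_1_strip: "s \<in> strip \<Longrightarrow> exp s = 1 \<longleftrightarrow> s = 0"
proof -
  assume "s \<in> strip"
  then have "\<bar>Im s\<bar> < 2 * pi" using pi_gt_zero by (auto simp: strip_def)
  then show ?thesis by (rule exp_eq_1_box)
qed

lemma holomorphic_slit_map: "slit_map holomorphic_on {s \<in> band. exp s \<noteq> 1}"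
  unfolding slit_map_def by (intro holomorphic_intros holomorphic_on_subset[OF holomorphic_slit_num]) auto

text \<open>A constant value \<open>c\<close> would give \<open>slit_num = c (exp - 1)\<close> near 0, which
  contradicts \<open>slit_num 0 = 2\<close>.\<close>

lemma open_slit_map_image:
  assumes "open U" "U \<subseteq> strip - {0}" shows "open (slit_map ` U)"
proof (rule open_mapping_thm[of slit_map "strip - {0}"])
  show "slit_map holomorphic_on strip - {0}"
    by (rule holomorphic_on_subset[OF holomorphic_slit_map]) (use strip_subset_band exp_eq_1_strip in auto)
  show "open (strip - {0})" by (intro open_Diff open_strip) auto
  show "connected (strip - {0})" by (intro connected_open_delete open_strip connected_strip) auto
  show "\<not> slit_map constant_on strip - {0}"
  proof
    assume "slit_map constant_on strip - {0}"
    then obtain c where c: "\<And>s. s \<in> strip - {0} \<Longrightarrow> slit_map s = c" unfolding constant_on_def by blast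
    have n: "slit_num s - c * (exp s - 1) = 0" if "s \<in> strip - {0}" for s
      using c[OF that] slit_map_eq_iff[of s c] exp_eq_1_strip[of s] that by auto
    have "isCont slit_num 0"
      using holomorphic_slit_num open_band zero_in_strip strip_subset_band holomorphic_on_imp_continuous_on continuous_on_eq_continuous_at by blast
    then have "isCont (\<lambda>s. slit_num s - c * (exp s - 1)) 0"
      by (intro continuous_intros)
    then have "((\<lambda>s. slit_num s - c * (exp s - 1)) \<longlongrightarrow> 2) (at 0)"
      using slit_num_0 unfolding isCont_def by simp
    moreover have "eventually (\<lambda>s. s \<in> strip - {0}) (at 0)"
      using open_strip zero_in_strip by (auto simp: eventually_at_topological)
    then have "eventually (\<lambda>s. slit_num s - c * (exp s - 1) = 0) (at 0)"
      by (rule eventually_mono) (rule n)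
    then have "((\<lambda>s. slit_num s - c * (exp s - 1)) \<longlongrightarrow> 0) (at 0)"
      by (rule tendsto_eventually)
    ultimately show False using tendsto_unique[OF at_neq_bot] by fastforce
  qed
qed (use assms in auto)

text \<open>Two preimages of a value on one of the two slit lines would, by the open mapping theorem, yield
  two preimages of nearby values off these lines, where \<open>zero_of_slit_num_unique\<close>
  applies.\<close>

lemma slit_map_inj:
  assumes a: "a \<in> strip - {0}" and b: "b \<in> strip - {0}" and eq: "slit_map a = slit_map b"
  shows "a - b \<in> {0, of_real P, - of_real P}"
proof (rule ccontr)
  assume "a - b \<notin> {0, of_real P, - of_real P}"
  moreover have "open (- {0, of_real P, - complex_of_real P})" by (intro open_Compl finite_imp_closed) auto
  ultimately obtain d where d: "d > 0" "ball (a - b) d \<subseteq> - {0, of_real P, - of_real P}"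
    using open_contains_ball by blast
  have "open (strip - {0})" by (intro open_Diff open_strip) auto
  then have nb: "\<exists>r>0. ball x r \<subseteq> strip - {0}" if "x \<in> strip - {0}" for x
    using that open_contains_ball by blast
  obtain ra where ra: "ra > 0" "ball a ra \<subseteq> strip - {0}" using nb[OF a] by blast
  obtain rb where rb: "rb > 0" "ball b rb \<subseteq> strip - {0}" using nb[OF b] by blast
  define r where "r = min (d / 2) (min ra rb)"
  have r0: "r > 0" using ra rb d by (simp add: r_def)
  have "ball a r \<subseteq> ball a ra" "ball b r \<subseteq> ball b rb" by (auto simp: r_def)
  then have sub: "ball a r \<subseteq> strip - {0}" "ball b r \<subseteq> strip - {0}"
    using ra(2) rb(2) by blast+
  have "open (slit_map ` ball a r \<inter> slit_map ` ball b r)" using sub by (intro open_Int open_slit_map_image) auto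
  moreover have "slit_map a \<in> slit_map ` ball a r" "slit_map b \<in> slit_map ` ball b r" using r0 by (meson centre_in_ball imageI)+
  then have "slit_map a \<in> slit_map ` ball a r \<inter> slit_map ` ball b r" using eq by simp
  ultimately obtain \<delta> where \<delta>: "\<delta> > 0" "ball (slit_map a) \<delta> \<subseteq> slit_map ` ball a r \<inter> slit_map ` ball b r"
    using open_contains_ball by blast
  \<comment> \<open>Move \<open>w\<close> vertically, off the two exceptional lines.\<close>
  have "infinite ({0<..<\<delta>} - {2 * pi / P - Im (slit_map a), - 2 * pi / P - Im (slit_map a)})"
    using \<delta> by (intro Diff_infinite_finite) auto
  then obtain t where t: "t \<in> {0<..<\<delta>} - {2 * pi / P - Im (slit_map a), - 2 * pi / P - Im (slit_map a)}"
    using infinite_imp_nonempty by blast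
  define w where "w = slit_map a + t * \<i>"
  have "norm (complex_of_real t * \<i>) < \<delta>" using t by (simp add: norm_mult)
  then have "w \<in> ball (slit_map a) \<delta>" unfolding w_def by (simp add: dist_norm)
  then have "w \<in> slit_map ` ball a r" "w \<in> slit_map ` ball b r" using \<delta>(2) by blast+
  then obtain a' b' where ab: "a' \<in> ball a r" "b' \<in> ball b r" "slit_map a' = w" "slit_map b' = w"
    by (elim imageE) metis
  have w: "Im w \<noteq> 2 * pi / P" "Im w \<noteq> - 2 * pi / P" using t by (auto simp: w_def)
  have st: "a' \<in> strip - {0}" "b' \<in> strip - {0}" using ab(1,2) sub by blast+
  then have "exp a' \<noteq> 1" "exp b' \<noteq> 1" using exp_eq_1_strip by auto
  then have nn: "slit_num a' = w * (exp a' - 1)" "slit_num b' = w * (exp b' - 1)"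
    using ab(3,4) slit_map_eq_iff by blast+
  have rs: "\<bar>Re a'\<bar> < P" "\<bar>Im a'\<bar> < pi" "\<bar>Re b'\<bar> < P" "\<bar>Im b'\<bar> < pi"
    using st by (auto simp: strip_def)
  have "a' - b' \<in> {0, of_real P, - of_real P}"
    by (rule zero_of_slit_num_unique[OF w rs(1,2) nn(1) rs(3,4) nn(2)])
  moreover have "a' - b' \<in> ball (a - b) d"
  proof -
    have "dist (a - b) (a' - b') = norm ((a - a') - (b - b'))" by (simp add: dist_norm algebra_simps)
    also have "\<dots> \<le> norm (a - a') + norm (b - b')" by (rule norm_triangle_ineq4)
    also have "\<dots> < d / 2 + d / 2" using ab(1,2) unfolding r_def by (intro add_strict_mono) (simp_all add: dist_norm)
    finally show ?thesis by simp
  qed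
  ultimately show False using d by blast
qed

text \<open>An interior preimage of a boundary value would be shared with interior points close to the
  boundary, contrary to injectivity.\<close>

lemma slit_map_avoids_edge:
  assumes s: "s \<in> strip - {0}" and b: "b \<in> band" "Im b = pi"
  shows "slit_map s \<noteq> slit_map b"
proof
  assume eq: "slit_map s = slit_map b"
  have "open (strip - {0})" by (intro open_Diff open_strip) auto
  then obtain r1 where r1: "r1 > 0" "ball s r1 \<subseteq> strip - {0}" using s open_contains_ball by metis
  define r where "r = min r1 ((pi - Im s) / 2)"
  have Is: "\<bar>Im s\<bar> < pi" using s by (auto simp: strip_def)
  have r0: "r > 0" using r1 Is by (simp add: r_def abs_less_iff)
  have "ball s r \<subseteq> ball s r1" by (auto simp: r_def)
  with r1 r0 have r: "r > 0" "ball s r \<subseteq> strip - {0}" by auto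
  have "r \<le> (pi - Im s) / 2" unfolding r_def by (rule min.cobounded2)
  then have "2 * r \<le> pi - Im s" by simp
  moreover have "- pi < Im s" using Is by linarith
  ultimately have rI: "Im s + r \<le> pi - r" "r < pi" by simp_all
  have op: "open (slit_map ` ball s r)" using r by (intro open_slit_map_image) auto
  have "open {s \<in> band. exp s \<noteq> 1}"
    using open_Int[OF open_band open_Collect_neq[of "\<lambda>s::complex. exp s" "\<lambda>_. 1"]]
    by (auto simp: Int_def continuous_intros)
  then have "isCont slit_map b"
    using holomorphic_slit_map b exp_edge_ne_1 holomorphic_on_imp_continuous_on continuous_on_eq_continuous_at by blast
  moreover have "slit_map b \<in> slit_map ` ball s r" using r(1) eq by (metis centre_in_ball imageI)
  ultimately obtain \<delta> where \<delta>: "\<delta> > 0" "\<And>x. dist x b < \<delta> \<Longrightarrow> slit_map x \<in> slit_map ` ball s r"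
    using op unfolding continuous_at_eps_delta by (metis open_dist)
  define t where "t = min \<delta> r / 2"
  have t: "0 < t" "t < \<delta>" "t < r" using \<delta> r by (auto simp: t_def min_def)
  define b' where "b' = b - t * \<i>"
  have "dist b' b < \<delta>" using t by (simp add: b'_def dist_norm norm_mult)
  then obtain s' where s': "s' \<in> ball s r" "slit_map b' = slit_map s'" using \<delta>(2) by blast
  have b's: "b' \<in> strip - {0}" using b t rI
    by (auto simp: b'_def strip_def band_def complex_eq_iff)
  have "s' \<in> strip - {0}" using s' r by blast
  from slit_map_inj[OF b's this s'(2)] have "Im b' = Im s'" by (auto simp: algebra_simps complex_eq_iff)
  moreover have "Im s' < Im s + r" using s'(1) abs_Im_le_cmod[of "s' - s"] by (auto simp: dist_norm norm_minus_commute)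
  ultimately show False using rI t b(2) by (simp add: b'_def)
qed

definition edge_val :: "real \<Rightarrow> complex" where
  "edge_val x = slit_map (Complex x pi)"

text \<open>The two points near the ends of the slit. Any choice of \<open>x = x(P)\<close> with \<open>x
  \<longrightarrow> \<infinity>\<close> and \<open>x / P \<longrightarrow> 0\<close> would do as
  well as \<open>sqrt P\<close>: then \<open>tanh (x / 2) - 2 x / P\<close> tends to 1.\<close>

definition \<beta>1 :: complex where "\<beta>1 = edge_val (- sqrt P)"
definition \<beta>2 :: complex where "\<beta>2 = edge_val (sqrt P)"

text \<open>Equal to \<open>(slit_map s - \<beta>1) / (slit_map s - \<beta>2)\<close> off the pole, and
  equal to 1 at 0. The Moebius transformation sends the segment between \<open>\<beta>1\<close>
  and \<open>\<beta>2\<close> to \<open>[-\<infinity>, 0]\<close>.\<close>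

definition strip_map :: "complex \<Rightarrow> complex" where
  "strip_map s = (slit_num s - \<beta>1 * (exp s - 1)) / (slit_num s - \<beta>2 * (exp s - 1))"

lemma sqrt_P_less: "sqrt P < P"
  using P_gt_1 by (intro real_less_lsqrt) (auto simp: power2_eq_square)

lemma edge_in_band: "\<bar>x\<bar> \<le> sqrt P \<Longrightarrow> Complex x pi \<in> band"
  using sqrt_P_less by (auto simp: band_def)

text \<open>The intermediate value theorem along the upper edge, where the imaginary part is constant: the
  segment from \<open>\<beta>1\<close> to \<open>\<beta>2\<close> consists of boundary values.\<close>

lemma edge_segment:
  fixes t :: real
  assumes "0 \<le> t"
  shows "\<exists>x. \<bar>x\<bar> \<le> sqrt P \<and> (\<beta>1 + t * \<beta>2) = (1 + t) * edge_val x"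
proof -
  define X where "X = {- sqrt P .. sqrt P}"
  have "continuous_on X (\<lambda>x. slit_map (Complex x pi))"
  proof (rule continuous_on_compose2[OF holomorphic_on_imp_continuous_on[OF holomorphic_slit_map]])
    show "continuous_on X (\<lambda>x. Complex x pi)" unfolding Complex_eq by (intro continuous_intros)
    show "(\<lambda>x. Complex x pi) ` X \<subseteq> {s \<in> band. exp s \<noteq> 1}"
      using edge_in_band exp_edge_ne_1 by (auto simp: X_def)
  qed
  then have "continuous_on X (\<lambda>x. Re (edge_val x))" unfolding edge_val_def by (intro continuous_intros)
  then have "connected ((\<lambda>x. Re (edge_val x)) ` X)"
    by (rule connected_continuous_image) (simp add: X_def)
  then have cx: "convex ((\<lambda>x. Re (edge_val x)) ` X)" using connected_convex_1 by blast
  have "1 / (1 + t) + t / (1 + t) = 1" using assms by (simp add: add_divide_distrib[symmetric])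
  moreover have "Re \<beta>1 \<in> (\<lambda>x. Re (edge_val x)) ` X" "Re \<beta>2 \<in> (\<lambda>x. Re (edge_val x)) ` X"
    unfolding \<beta>1_def \<beta>2_def using P_gt_1 by (rule_tac imageI; simp add: X_def)+
  ultimately have "(1 / (1 + t)) *\<^sub>R Re \<beta>1 + (t / (1 + t)) *\<^sub>R Re \<beta>2 \<in> (\<lambda>x. Re (edge_val x)) ` X"
    using assms by (intro convexD[OF cx]) simp_all
  then obtain x where x: "x \<in> X" "Re (edge_val x) = (1 / (1 + t)) * Re \<beta>1 + (t / (1 + t)) * Re \<beta>2"
    by auto
  have xr: "(1 + t) * Re (edge_val x) = Re \<beta>1 + t * Re \<beta>2"
    unfolding x(2) using assms by (simp add: distrib_left)
  have im: "Im (edge_val x) = - 2 * pi / P" if "x \<in> X" for x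
    unfolding edge_val_def using that edge_in_band[of x] by (subst Im_slit_map_edge) (auto simp: X_def)
  have "Im \<beta>1 = - 2 * pi / P" "Im \<beta>2 = - 2 * pi / P"
    unfolding \<beta>1_def \<beta>2_def using P_gt_1 by (rule_tac im; simp add: X_def)+
  then have "\<beta>1 + t * \<beta>2 = (1 + t) * edge_val x"
    using xr im[OF x(1)] by (simp add: complex_eq_iff algebra_simps)
  then show ?thesis using x(1) by (intro exI[of _ x]) (auto simp: X_def)
qed

lemma strip_map_denom_nonzero:
  assumes "s \<in> strip" shows "slit_num s - \<beta>2 * (exp s - 1) \<noteq> 0"
proof (cases "s = 0")
  case False
  then have "exp s \<noteq> 1" using exp_eq_1_strip assms by blast
  moreover have "slit_map s \<noteq> \<beta>2" unfolding \<beta>2_def edge_val_def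
    using assms False P_gt_1 by (intro slit_map_avoids_edge edge_in_band) auto
  ultimately show ?thesis using slit_map_eq_iff[of s \<beta>2] by simp
qed (simp add: slit_num_0)

text \<open>A value in \<open>(-\<infinity>, 0]\<close> would mean that \<open>slit_map s\<close> lies on
  the segment from \<open>\<beta>1\<close> to \<open>\<beta>2\<close>, which belongs to the
  boundary values.\<close>

lemma strip_map_avoids_nonpos_Reals:
  assumes "s \<in> strip" shows "strip_map s \<notin> \<real>\<^sub>\<le>\<^sub>0"
proof
  assume "strip_map s \<in> \<real>\<^sub>\<le>\<^sub>0"
  then obtain r where r: "strip_map s = of_real r" "r \<le> 0" by (auto elim: nonpos_Reals_cases)
  define t where "t = - r"
  have t: "t \<ge> 0" "strip_map s = - of_real t" using r by (simp_all add: t_def)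
  then have "slit_num s - \<beta>1 * (exp s - 1) = - t * (slit_num s - \<beta>2 * (exp s - 1))"
    using strip_map_denom_nonzero[OF assms] unfolding strip_map_def by (simp add: field_simps)
  then have eq: "(1 + t) * slit_num s = (\<beta>1 + t * \<beta>2) * (exp s - 1)" by (simp add: algebra_simps)
  obtain x where x: "\<bar>x\<bar> \<le> sqrt P" "\<beta>1 + t * \<beta>2 = (1 + t) * edge_val x" using edge_segment[OF t(1)] by blast
  have "1 + complex_of_real t \<noteq> 0" using t(1) by (auto simp: complex_eq_iff)
  then have eq: "slit_num s = edge_val x * (exp s - 1)" using eq unfolding x(2) by simp
  show False
  proof (cases "s = 0")
    case True
    then show ?thesis using eq by (simp add: slit_num_0)
  next
    case False
    then have "exp s \<noteq> 1" using exp_eq_1_strip assms by blast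
    then have "slit_map s = edge_val x" using eq slit_map_eq_iff by blast
    then show ?thesis using slit_map_avoids_edge[OF _ edge_in_band[OF x(1)]] assms False
      unfolding edge_val_def by auto
  qed
qed

lemma holomorphic_strip_map: "strip_map holomorphic_on strip"
  unfolding strip_map_def using strip_map_denom_nonzero
  by (intro holomorphic_intros holomorphic_on_subset[OF holomorphic_slit_num strip_subset_band]) auto

lemma strip_map_periodic:
  assumes "s \<in> strip" "Re s < 0" shows "strip_map (s + P) = strip_map s"
proof -
  have strip_map: "strip_map s = (slit_map s - \<beta>1) / (slit_map s - \<beta>2)" if "exp s \<noteq> 1" for s
  proof -
    have "slit_num s - \<beta> * (exp s - 1) = (exp s - 1) * (slit_map s - \<beta>)" for \<beta>
      using that by (simp add: slit_map_def field_simps)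
    then show ?thesis unfolding strip_map_def using that by simp
  qed
  have "Re s > - P" using assms by (auto simp: strip_def)
  then show ?thesis using assms(2) slit_map_periodic[of s] by (simp add: strip_map exp_ne_1)
qed

lemma strip_map_inj:
  assumes "\<beta>1 \<noteq> \<beta>2" and a: "a \<in> strip" and b: "b \<in> strip" and eq: "strip_map a = strip_map b"
  shows "a - b \<in> {0, of_real P, - of_real P}"
proof -
  have "(slit_num a - \<beta>1 * (exp a - 1)) * (slit_num b - \<beta>2 * (exp b - 1)) =
        (slit_num b - \<beta>1 * (exp b - 1)) * (slit_num a - \<beta>2 * (exp a - 1))"
    using eq strip_map_denom_nonzero[OF a] strip_map_denom_nonzero[OF b] unfolding strip_map_def by (simp add: frac_eq_eq)
  then have "(\<beta>1 - \<beta>2) * (slit_num a * (exp b - 1)) = (\<beta>1 - \<beta>2) * (slit_num b * (exp a - 1))"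
    by (simp add: algebra_simps)
  then have eq: "slit_num a * (exp b - 1) = slit_num b * (exp a - 1)" using assms(1) by simp
  show ?thesis
  proof (cases "a = 0 \<or> b = 0")
    case True
    then show ?thesis using eq exp_eq_1_strip a b by (auto simp: slit_num_0)
  next
    case False
    then have "exp a \<noteq> 1" "exp b \<noteq> 1" using exp_eq_1_strip a b by auto
    then have "slit_map a = slit_map b" using eq unfolding slit_map_def by (simp add: frac_eq_eq)
    then show ?thesis using slit_map_inj a b False by auto
  qed
qed

lemma norm_\<rho>_exp_le:
  assumes "\<bar>Re s\<bar> \<le> R" "R < P"
  shows "norm (\<rho> (exp s)) \<le> 4 / (exp (P - R) - 1) * (exp P / (exp P - 1))"
proof -
  have "norm (\<rho> (exp s)) \<le> 2 * (1 / (Q * exp (- R) - 1) + exp R / (Q - exp R)) * (Q / (Q - 1))"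
    using assms by (intro norm_\<rho>_le) (auto simp: inverse_Q, auto simp: Q_def)
  also have "exp R / (Q - exp R) = 1 / (exp (P - R) - 1)"
  proof -
    have "Q - exp R = exp R * (exp (P - R) - 1)" by (simp add: Q_def right_diff_distrib exp_add[symmetric])
    then show ?thesis by simp
  qed
  also have "Q * exp (- R) = exp (P - R)" by (simp add: Q_def exp_add[symmetric])
  also have "2 * (1 / (exp (P - R) - 1) + 1 / (exp (P - R) - 1)) = 4 / (exp (P - R) - 1)" by simp
  finally show ?thesis by (simp only: Q_def)
qed

end

section \<open>Convergence to the exponential function\<close>

definition \<rho>_bound :: "real \<Rightarrow> real \<Rightarrow> real" where
  "\<rho>_bound P R = 4 / (exp (P - R) - 1) * (exp P / (exp P - 1))"

context periodic_slit_map
begin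

lemma edge_val_eq:
  assumes "\<bar>x\<bar> \<le> sqrt P"
  shows "norm (edge_val x - of_real ((exp x - 1) / (exp x + 1))) \<le> \<rho>_bound P (sqrt P) + 2 * (sqrt P + pi) / P"
proof -
  define s where "s = Complex x pi"
  have E: "exp s = - of_real (exp x)" using exp_edge[of s] by (simp add: s_def)
  have "edge_val x = (exp s + 1) / (exp s - 1) + \<rho> (exp s) - 2 * s / P"
    unfolding edge_val_def s_def[symmetric] by (rule slit_map_eq, rule exp_edge_ne_1) (simp add: s_def)
  moreover have "(exp s + 1) / (exp s - 1) = of_real ((exp x - 1) / (exp x + 1))"
  proof -
    have "(exp s + 1) / (exp s - 1) = of_real ((1 - exp x) / (- exp x - 1))" unfolding E by simp
    also have "(1 - exp x) / (- exp x - 1) = (exp x - 1) / (exp x + 1)"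
      using minus_divide_divide[of "exp x - 1" "exp x + 1"] by simp
    finally show ?thesis .
  qed
  ultimately have "edge_val x - of_real ((exp x - 1) / (exp x + 1)) = \<rho> (exp s) - 2 * s / P" by simp
  also have "norm \<dots> \<le> norm (\<rho> (exp s)) + norm (2 * s / P)" by (rule norm_triangle_ineq4)
  also have "norm (\<rho> (exp s)) \<le> \<rho>_bound P (sqrt P)"
    unfolding \<rho>_bound_def using assms sqrt_P_less by (intro norm_\<rho>_exp_le) (auto simp: s_def)
  also have "norm (2 * s / P) \<le> 2 * (sqrt P + pi) / P"
  proof -
    have "norm s \<le> \<bar>Re s\<bar> + \<bar>Im s\<bar>" by (rule cmod_le)
    also have "\<dots> \<le> sqrt P + pi" using assms by (simp add: s_def)
    finally show ?thesis using P_gt_1 by (simp add: norm_divide norm_mult divide_right_mono)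
  qed
  finally show ?thesis by simp
qed

text \<open>Numerator and denominator of \<open>strip_map\<close> are \<open>2 exp s\<close> and
  \<open>2\<close> up to multiples of \<open>\<kappa> - (1 + \<beta>1)\<close> and \<open>\<kappa>
  + (1 - \<beta>2)\<close>, where \<open>\<kappa>\<close> is the difference between
  \<open>slit_map s\<close> and \<open>coth (s / 2)\<close>.\<close>

lemma strip_map_minus_exp_le:
  assumes s: "norm s \<le> R" "R < P"
    and d: "d = \<rho>_bound P R + 2 * R / P + norm (1 + \<beta>1) + norm (1 - \<beta>2)" "(exp R + 1) * d \<le> 1"
  shows "norm (strip_map s - exp s) \<le> (exp R + 1) ^ 2 * d"
proof -
  define Y where "Y = exp s - 1"
  define \<kappa> where "\<kappa> = \<rho> (exp s) - 2 * s / P"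
  have R: "\<bar>Re s\<bar> \<le> R" using abs_Re_le_cmod[of s] s by simp
  have "norm \<kappa> \<le> norm (\<rho> (exp s)) + norm (2 * s / P)" unfolding \<kappa>_def by (rule norm_triangle_ineq4)
  also have "norm (\<rho> (exp s)) \<le> \<rho>_bound P R" unfolding \<rho>_bound_def by (rule norm_\<rho>_exp_le[OF R s(2)])
  also have "norm (2 * s / P) \<le> 2 * R / P" using P_gt_1 s by (simp add: norm_divide norm_mult divide_right_mono)
  finally have \<kappa>: "norm \<kappa> \<le> \<rho>_bound P R + 2 * R / P" by simp
  have y: "norm (exp s) \<le> exp R" using R by simp
  have Y: "norm Y \<le> exp R + 1" using y norm_triangle_ineq4[of "exp s" 1] unfolding Y_def norm_one by linarith
  have d1: "norm (\<kappa> - (1 + \<beta>1)) \<le> d" "norm (\<kappa> + (1 - \<beta>2)) \<le> d"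
    using \<kappa> norm_triangle_ineq4[of \<kappa> "1 + \<beta>1"] norm_triangle_ineq[of \<kappa> "1 - \<beta>2"]
      norm_ge_zero[of "1 + \<beta>1"] norm_ge_zero[of "1 - \<beta>2"] unfolding d(1) by linarith+
  have d0: "d \<ge> 0" using d1(1) norm_ge_zero order_trans by blast
  define A where "A = slit_num s - \<beta>1 * Y"
  define D where "D = slit_num s - \<beta>2 * Y"
  have "A - 2 * exp s = Y * (\<kappa> - (1 + \<beta>1))" "D - 2 = Y * (\<kappa> + (1 - \<beta>2))"
    unfolding A_def D_def slit_num_def \<kappa>_def Y_def by (simp_all add: algebra_simps)
  then have AD: "norm (A - 2 * exp s) \<le> (exp R + 1) * d" "norm (D - 2) \<le> (exp R + 1) * d"
    using Y d1 d0 by (auto simp: norm_mult intro!: mult_mono)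
  have D1: "1 \<le> norm D" using AD(2) d(2) norm_triangle_ineq2[of 2 "2 - D"] by (simp add: norm_minus_commute)
  then have "D \<noteq> 0" by auto
  then have "strip_map s - exp s = ((A - 2 * exp s) - exp s * (D - 2)) / D"
    unfolding strip_map_def A_def[unfolded Y_def, symmetric] D_def[unfolded Y_def, symmetric]
    by (simp add: field_simps)
  then have "norm (strip_map s - exp s) = norm ((A - 2 * exp s) - exp s * (D - 2)) / norm D" by (simp add: norm_divide)
  also have "\<dots> \<le> norm ((A - 2 * exp s) - exp s * (D - 2)) / 1"
    using D1 by (intro divide_left_mono) auto
  also have "\<dots> \<le> norm (A - 2 * exp s) + norm (exp s) * norm (D - 2)"
    using norm_triangle_ineq4[of "A - 2 * exp s" "exp s * (D - 2)"] by (simp add: norm_mult)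
  also have "\<dots> \<le> (exp R + 1) * d + exp R * ((exp R + 1) * d)"
    using AD y by (intro add_mono mult_mono) auto
  also have "\<dots> = (exp R + 1) ^ 2 * d" by (simp add: power2_eq_square algebra_simps)
  finally show ?thesis .
qed

lemma inj_on_strip_map_ball:
  assumes "\<beta>1 \<noteq> \<beta>2" "ball c r \<subseteq> strip" "r \<le> 1 / 2"
  shows "inj_on strip_map (ball c r)"
proof (rule inj_onI)
  fix a b assume ab: "a \<in> ball c r" "b \<in> ball c r" "strip_map a = strip_map b"
  then have "a - b \<in> {0, of_real P, - of_real P}" using assms by (intro strip_map_inj) auto
  moreover have "norm (a - b) < 1"
    using ab assms(3) dist_triangle_less_add[of a c r b r] by (simp add: dist_norm norm_minus_commute)
  ultimately show "a = b" using P_gt_1 by (auto simp: norm_minus_cancel)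
qed

end

text \<open>That is, \<open>\<beta>1 \<longrightarrow> -1\<close> and \<open>\<beta>2 \<longrightarrow>
  1\<close>: the first slit tends to \<open>[-1, 1]\<close>.\<close>

lemma edge_limits:
  "((\<lambda>P. norm (1 + periodic_slit_map.\<beta>1 P) + norm (1 - periodic_slit_map.\<beta>2 P)) \<longlongrightarrow> 0) at_top"
proof (rule Lim_null_comparison)
  define g :: "real \<Rightarrow> real" where
    "g P = 2 * (\<rho>_bound P (sqrt P) + 2 * (sqrt P + pi) / P) + \<bar>1 + (exp (- sqrt P) - 1) / (exp (- sqrt P) + 1)\<bar>
       + \<bar>1 - (exp (sqrt P) - 1) / (exp (sqrt P) + 1)\<bar>" for P
  show "\<forall>\<^sub>F P in at_top. norm (norm (1 + periodic_slit_map.\<beta>1 P) + norm (1 - periodic_slit_map.\<beta>2 P)) \<le> g P"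
  proof (rule eventually_mono[OF eventually_gt_at_top[of 1]])
    fix P :: real assume "1 < P"
    then interpret periodic_slit_map P by unfold_locales
    define u where "u = (\<lambda>x::real. (exp x - 1) / (exp x + 1))"
    have 1: "norm (1 + \<beta>1) \<le> norm (complex_of_real (1 + u (- sqrt P))) + norm (\<beta>1 - of_real (u (- sqrt P)))"
      using norm_triangle_ineq[of "complex_of_real (1 + u (- sqrt P))" "\<beta>1 - of_real (u (- sqrt P))"]
      by (simp add: algebra_simps)
    have 2: "norm (1 - \<beta>2) \<le> norm (complex_of_real (1 - u (sqrt P))) + norm (\<beta>2 - of_real (u (sqrt P)))"
      using norm_triangle_ineq4[of "complex_of_real (1 - u (sqrt P))" "\<beta>2 - of_real (u (sqrt P))"]
      by (simp add: algebra_simps)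
    define B where "B = \<rho>_bound P (sqrt P) + 2 * (sqrt P + pi) / P"
    have 3: "norm (\<beta>1 - of_real (u (- sqrt P))) \<le> B" "norm (\<beta>2 - of_real (u (sqrt P))) \<le> B"
      unfolding \<beta>1_def \<beta>2_def u_def B_def using \<open>1 < P\<close> by (rule_tac edge_val_eq; simp)+
    have "g P = 2 * B + \<bar>1 + u (- sqrt P)\<bar> + \<bar>1 - u (sqrt P)\<bar>" by (simp add: g_def u_def B_def)
    then show "norm (norm (1 + \<beta>1) + norm (1 - \<beta>2)) \<le> g P"
      using 1 2 3
      unfolding norm_of_real real_norm_def abs_of_nonneg[OF add_nonneg_nonneg[OF norm_ge_zero norm_ge_zero]]
      by linarith
  qed
  show "(g \<longlongrightarrow> 0) at_top" unfolding g_def \<rho>_bound_def by real_asymp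
qed

lemma strip_map_tendsto_exp:
  assumes "R > 0" "\<epsilon> > 0"
  shows "\<forall>\<^sub>F P in at_top. \<forall>s. norm s \<le> R \<longrightarrow> norm (periodic_slit_map.strip_map P s - exp s) < \<epsilon>"
proof -
  define d where "d P = \<rho>_bound P R + 2 * R / P + norm (1 + periodic_slit_map.\<beta>1 P) + norm (1 - periodic_slit_map.\<beta>2 P)" for P
  have "((\<lambda>P. \<rho>_bound P R + 2 * R / P) \<longlongrightarrow> 0) at_top" unfolding \<rho>_bound_def by real_asymp
  from tendsto_add[OF this edge_limits] have d: "(d \<longlongrightarrow> 0) at_top" unfolding d_def by (simp add: add.assoc)
  define c where "c = min (1 / (exp R + 1)) (\<epsilon> / (exp R + 1) ^ 2)"
  have "exp R + 1 > 0" by (simp add: add_pos_pos)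
  then have c: "c > 0" unfolding c_def using assms(2) by (simp only: min_less_iff_conj) (intro conjI divide_pos_pos zero_less_power; simp)
  have "\<forall>\<^sub>F P in at_top. 1 < P \<and> R < P \<and> d P < c"
    using eventually_gt_at_top[of 1] eventually_gt_at_top[of R] order_tendstoD(2)[OF d c] by eventually_elim auto
  then show ?thesis
  proof (rule eventually_mono, intro allI impI)
    fix P :: real and s :: complex
    assume P: "1 < P \<and> R < P \<and> d P < c" and s: "norm s \<le> R"
    interpret periodic_slit_map P using P by unfold_locales auto
    have e: "exp R + 1 > 0" by (simp add: add_pos_pos)
    have "d P < 1 / (exp R + 1)" "d P < \<epsilon> / (exp R + 1) ^ 2" using P unfolding c_def by auto
    then have dd: "(exp R + 1) * d P \<le> 1" "(exp R + 1) ^ 2 * d P < \<epsilon>"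
      using e by (simp_all add: field_simps)
    show "norm (strip_map s - exp s) < \<epsilon>"
      using strip_map_minus_exp_le[OF s _ d_def dd(1)] dd(2) P by linarith
  qed
qed

lemma eventually_\<beta>_ne: "\<forall>\<^sub>F P in at_top. periodic_slit_map.\<beta>1 P \<noteq> periodic_slit_map.\<beta>2 P"
proof (rule eventually_mono[OF order_tendstoD(2)[OF edge_limits, of 1]])
  fix P assume *: "norm (1 + periodic_slit_map.\<beta>1 P) + norm (1 - periodic_slit_map.\<beta>2 P) < 1"
  show "periodic_slit_map.\<beta>1 P \<noteq> periodic_slit_map.\<beta>2 P"
  proof
    assume "periodic_slit_map.\<beta>1 P = periodic_slit_map.\<beta>2 P"
    then have "norm (2::complex) \<le> norm (1 + periodic_slit_map.\<beta>1 P) + norm (1 - periodic_slit_map.\<beta>2 P)"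
      using norm_triangle_ineq[of "1 + periodic_slit_map.\<beta>1 P" "1 - periodic_slit_map.\<beta>2 P"] by simp
    then show False using * by simp
  qed
qed simp

text \<open>A quantitative form of Hurwitz' theorem. On a small circle around \<open>s0 = Ln w\<close> the
  function \<open>exp\<close> keeps a distance \<open>\<mu>\<close> from \<open>w\<close> that
  does not depend on \<open>w\<close>; as soon as \<open>strip_map\<close> is closer than
  \<open>\<mu> / 4\<close> to \<open>exp\<close>, it takes the value \<open>w\<close> inside the
  circle.\<close>

lemma strip_map_covers_compact:
  assumes K: "compact K" "K \<subseteq> - \<real>\<^sub>\<le>\<^sub>0" and "\<eta> > 0"
  shows "\<exists>\<delta>>0. \<delta> < pi \<and> (\<forall>\<^sub>F P in at_top. \<forall>w\<in>K. \<exists>s. norm (s - Ln w) < \<eta> \<and> \<bar>Re s\<bar> < P \<and> \<bar>Im s\<bar> < pi - \<delta> \<and>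
           periodic_slit_map.strip_map P s = w)"
proof -
  have cont: "continuous_on K Ln" using K(2) by (intro continuous_on_Ln) auto
  define L where "L = insert 0 (Ln ` K)"
  have L: "compact L" "L \<noteq> {}" using compact_continuous_image[OF cont K(1)] by (simp_all add: L_def)
  obtain R where R: "\<And>s. s \<in> L \<Longrightarrow> norm s \<le> R"
    using compact_imp_bounded[OF L(1)] unfolding bounded_iff by blast
  have R0: "R \<ge> 0" using R[of 0] by (simp add: L_def)
  have "continuous_on L (\<lambda>s. \<bar>Im s\<bar>)" by (intro continuous_intros)
  from continuous_attains_sup[OF L this]
  obtain s1 where s1: "s1 \<in> L" "\<And>s. s \<in> L \<Longrightarrow> \<bar>Im s\<bar> \<le> \<bar>Im s1\<bar>" by blast
  define m where "m = \<bar>Im s1\<bar>"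
  have ImLn: "\<bar>Im (Ln w)\<bar> < pi" if "w \<in> K" for w
    using abs_Im_Ln_less[of w] that K(2) by blast
  have m_pi: "0 \<le> m" "m < pi" using s1(1) ImLn by (auto simp: m_def L_def)
  define \<delta> where "\<delta> = (pi - m) / 2"
  have "2 * \<delta> = pi - m" by (simp add: \<delta>_def)
  then have \<delta>: "\<delta> > 0" "m + \<delta> = pi - \<delta>" "\<delta> < pi" using m_pi pi_gt_zero by linarith+
  define r where "r = min (1 / 2) (min (\<eta> / 2) (\<delta> / 2))"
  have "r \<le> 1 / 2" "r \<le> \<eta> / 2" "r \<le> \<delta> / 2" by (simp_all add: r_def min_le_iff_disj)
  moreover have "r > 0" using \<open>\<eta> > 0\<close> \<delta>(1) by (simp add: r_def)
  ultimately have r: "r > 0" "r \<le> 1 / 2" "r < \<eta>" "r < \<delta>" by linarith+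
  have "sphere (0::complex) r \<noteq> {}" using r by simp
  moreover have "continuous_on (sphere (0::complex) r) (\<lambda>u. norm (exp u - 1))"
    by (intro continuous_intros)
  ultimately have "\<exists>u0\<in>sphere (0::complex) r. \<forall>u\<in>sphere (0::complex) r. norm (exp u0 - 1) \<le> norm (exp u - 1)"
    by (rule continuous_attains_inf[OF compact_sphere])
  then obtain u0 where u0: "u0 \<in> sphere (0::complex) r"
      "\<forall>u\<in>sphere (0::complex) r. norm (exp u0 - 1) \<le> norm (exp u - 1)" ..
  have "norm u0 = r" using u0(1) by simp
  then have "u0 \<noteq> 0" using r(1) by auto
  have "\<bar>Im u0\<bar> < 2 * pi" using \<open>norm u0 = r\<close> abs_Im_le_cmod[of u0] r(2) pi_gt3 by linarith
  have "exp u0 \<noteq> 1" using exp_eq_1_box[OF \<open>\<bar>Im u0\<bar> < 2 * pi\<close>] \<open>u0 \<noteq> 0\<close> by simp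
  define \<mu> where "\<mu> = exp (- R) * norm (exp u0 - 1)"
  have \<mu>: "\<mu> > 0" using \<open>exp u0 \<noteq> 1\<close> by (simp add: \<mu>_def)
  \<comment> \<open>\<open>|exp s - exp s0|\<close> factors as \<open>exp (Re s0)\<close> times a function of \<open>s - s0\<close>, hence the uniform bound.\<close>
  have far: "\<mu> \<le> norm (exp s - exp s0)" if "norm s0 \<le> R" "norm (s - s0) = r" for s s0 :: complex
  proof -
    have "exp s - exp s0 = exp s0 * (exp (s - s0) - 1)" by (simp add: exp_diff right_diff_distrib)
    then have "norm (exp s - exp s0) = exp (Re s0) * norm (exp (s - s0) - 1)" by (simp add: norm_mult)
    moreover have "exp (- R) \<le> exp (Re s0)" using that(1) abs_Re_le_cmod[of s0] by simp
    moreover have "norm (exp u0 - 1) \<le> norm (exp (s - s0) - 1)" using that(2) by (intro bspec[OF u0(2)]) (simp add: dist_norm norm_minus_commute)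
    ultimately show ?thesis unfolding \<mu>_def by (simp add: mult_mono)
  qed
  have ev: "\<forall>\<^sub>F P in at_top. R + 1 < P \<and> periodic_slit_map.\<beta>1 P \<noteq> periodic_slit_map.\<beta>2 P \<and>
      (\<forall>s. norm s \<le> R + 1 \<longrightarrow> norm (periodic_slit_map.strip_map P s - exp s) < \<mu> / 4)"
    using eventually_gt_at_top[of "R + 1"] eventually_\<beta>_ne strip_map_tendsto_exp[of "R + 1" "\<mu> / 4"] R0 \<mu>
    by (auto intro: eventually_conj)
  show ?thesis
  proof (intro exI[of _ \<delta>] conjI \<delta> eventually_mono[OF ev] ballI)
    fix P w assume P: "R + 1 < P \<and> periodic_slit_map.\<beta>1 P \<noteq> periodic_slit_map.\<beta>2 P \<and>
      (\<forall>s. norm s \<le> R + 1 \<longrightarrow> norm (periodic_slit_map.strip_map P s - exp s) < \<mu> / 4)" and w: "w \<in> K"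
    interpret periodic_slit_map P using P R0 by unfold_locales auto
    define s0 where "s0 = Ln w"
    have "s0 \<in> L" "w \<noteq> 0" using w K(2) by (auto simp: s0_def L_def)
    then have s0: "norm s0 \<le> R" "exp s0 = w" "\<bar>Im s0\<bar> \<le> m"
      using R s1(2) by (auto simp: m_def s0_def)
    have near: "\<bar>Re s\<bar> < P \<and> \<bar>Im s\<bar> < pi - \<delta> \<and> norm s \<le> R + 1" if "norm (s - s0) \<le> r" for s
    proof -
      have "norm s \<le> R + 1 / 2" using norm_triangle_ineq[of s0 "s - s0"] that s0 r by simp
      moreover have "\<bar>Im s\<bar> \<le> m + r" using abs_Im_le_cmod[of "s - s0"] that s0(3) by simp
      ultimately show ?thesis using abs_Re_le_cmod[of s] P r \<delta> by auto
    qed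
    have sub: "cball s0 r \<subseteq> strip"
      using near \<delta> by (auto simp: strip_def dist_norm norm_minus_commute) fastforce
    then have subb: "ball s0 r \<subseteq> strip" using ball_subset_cball by blast
    have "ball (strip_map s0) (\<mu> / 2) \<subseteq> strip_map ` ball s0 r"
    proof (rule ball_subset_open_map_image)
      show "continuous_on (closure (ball s0 r)) strip_map"
        using r sub by (simp add: holomorphic_on_imp_continuous_on[OF holomorphic_on_subset[OF holomorphic_strip_map]])
      have "open (strip_map ` ball s0 r)"
        using subb P r by (intro open_mapping_thm3 holomorphic_on_subset[OF holomorphic_strip_map] inj_on_strip_map_ball) auto
      then show "open (strip_map ` interior (ball s0 r))" by (simp add: interior_open)
      fix z assume "z \<in> frontier (ball s0 r)"
      then have z: "norm (z - s0) = r" using r by (simp add: frontier_ball dist_norm norm_minus_commute)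
      have 1: "norm (strip_map z - exp z) < \<mu> / 4" "norm (strip_map s0 - exp s0) < \<mu> / 4"
        using P near[of z] near[of s0] z r by auto
      have "exp z - exp s0 = (strip_map z - strip_map s0) - (strip_map z - exp z) + (strip_map s0 - exp s0)" by simp
      then have "norm (exp z - exp s0) \<le> norm (strip_map z - strip_map s0) + norm (strip_map z - exp z) + norm (strip_map s0 - exp s0)"
        by (metis norm_triangle_le norm_triangle_ineq4 add_right_mono)
      then show "\<mu> / 2 \<le> norm (strip_map z - strip_map s0)" using far[OF s0(1) z] 1 by linarith
    qed (use r \<mu> in auto)
    moreover have "w \<in> ball (strip_map s0) (\<mu> / 2)"
    proof -
      have "norm (strip_map s0 - exp s0) < \<mu> / 4" using P near[of s0] r by auto
      then show ?thesis using \<mu> s0(2) by (simp add: dist_norm)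
    qed
    ultimately obtain s where s: "s \<in> ball s0 r" "strip_map s = w" by blast
    then have "norm (s - s0) < r" by (simp add: dist_norm norm_minus_commute)
    then show "\<exists>s. norm (s - Ln w) < \<eta> \<and> \<bar>Re s\<bar> < P \<and> \<bar>Im s\<bar> < pi - \<delta> \<and> strip_map s = w"
      using near[of s] r s(2) unfolding s0_def by (intro exI[of _ s]) auto
  qed
qed

section \<open>Ring domains and round annuli\<close>

context periodic_slit_map
begin

text \<open>The quotient map of the strip by its period, normalized to have derivative 1 at 0.\<close>

definition wrap :: "complex \<Rightarrow> complex" where
  "wrap s = P / (2 * pi * \<i>) * (exp (2 * pi * \<i> * s / P) - 1)"

definition substrip :: "real \<Rightarrow> complex set" where
  "substrip \<delta> = {s. \<bar>Re s\<bar> < P \<and> \<bar>Im s\<bar> < pi - \<delta>}"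

text \<open>The inverse of \<open>strip_map\<close> followed by \<open>wrap\<close>. The choice of the
  preimage is immaterial, as preimages differ by periods.\<close>

definition annulus_map :: "complex \<Rightarrow> complex" where
  "annulus_map w = wrap (SOME s. s \<in> strip \<and> strip_map s = w)"

lemma wrap_periodic: "wrap (s + of_real P) = wrap s"
proof -
  have "2 * pi * \<i> * (s + of_real P) / P = 2 * pi * \<i> * s / P + 2 * pi * \<i>"
    using P_gt_1 by (simp add: field_simps)
  then show ?thesis by (simp add: wrap_def exp_add)
qed

lemma wrap_cong: "a - b \<in> {0, of_real P, - of_real P} \<Longrightarrow> wrap a = wrap b"
  using wrap_periodic[of a] wrap_periodic[of b] by (auto simp: diff_eq_eq algebra_simps)

lemma wrap_inj:
  assumes a: "a \<in> strip" and b: "b \<in> strip" and eq: "wrap a = wrap b"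
  shows "a - b \<in> {0, of_real P, - of_real P}"
proof -
  have P0: "complex_of_real P \<noteq> 0" using P_gt_1 by simp
  have "exp (2 * pi * \<i> * a / P) = exp (2 * pi * \<i> * b / P)" using eq P0 unfolding wrap_def by simp
  then obtain n :: int where "2 * pi * \<i> * a / P = 2 * pi * \<i> * b / P + of_int (2 * n) * of_real pi * \<i>"
    unfolding exp_eq by auto
  then have "2 * pi * \<i> * (a - b) = 2 * pi * \<i> * (of_int n * P)" using P0 by (simp add: field_simps)
  then have ab: "a - b = of_real (of_int n * P)" by simp
  have "\<bar>Re (a - b)\<bar> < 2 * P" using a b by (auto simp: strip_def)
  then have "\<bar>of_int n * P\<bar> < 2 * P" unfolding ab by simp
  then have "\<bar>of_int n\<bar> < (2 :: real)" using P_gt_1 by (simp add: abs_mult)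
  then have "n = 0 \<or> n = 1 \<or> n = -1" by linarith
  then show ?thesis unfolding ab by auto
qed

lemma strip_map_cong:
  assumes "a \<in> strip" "b \<in> strip" "a - b \<in> {0, of_real P, - of_real P}" shows "strip_map a = strip_map b"
proof -
  have "a = b \<or> a = b + P \<or> b = a + P" using assms(3) by (auto simp: diff_eq_eq algebra_simps)
  moreover have "Re b < 0" if "a = b + P" using that assms(1) by (auto simp: strip_def)
  moreover have "Re a < 0" if "b = a + P" using that assms(2) by (auto simp: strip_def)
  ultimately show ?thesis using strip_map_periodic[of a] strip_map_periodic[of b] assms by metis
qed

text \<open>Values are already attained on a closed period cell, which is compact after narrowing the strip.\<close>

lemma strip_map_fundamental_cell:
  assumes "s \<in> strip"
  shows "\<exists>t\<in>strip. \<bar>Re t\<bar> \<le> P / 2 \<and> Im t = Im s \<and> strip_map t = strip_map s"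
proof -
  have s: "\<bar>Re s\<bar> < P" "\<bar>Im s\<bar> < pi" using assms by (auto simp: strip_def)
  consider "\<bar>Re s\<bar> \<le> P / 2" | "Re s < - P / 2" | "Re s > P / 2" by linarith
  then show ?thesis
  proof cases
    case 1 then show ?thesis using assms by blast
  next
    case 2
    have t: "s + P \<in> strip" using 2 s P_gt_1 by (auto simp: strip_def)
    have "strip_map (s + P) = strip_map s" by (rule strip_map_cong[OF t assms]) simp
    then show ?thesis using t 2 s P_gt_1 by (intro bexI[of _ "s + P"]) auto
  next
    case 3
    have t: "s - P \<in> strip" using 3 s P_gt_1 by (auto simp: strip_def)
    have "strip_map (s - P) = strip_map s" by (rule strip_map_cong[OF t assms]) simp
    then show ?thesis using t 3 s P_gt_1 by (intro bexI[of _ "s - P"]) auto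
  qed
qed

text \<open>\<open>|exp (2 \<pi> \<i> s / P)|\<close> depends only on \<open>Im s\<close>, and every nonzero
  number is of the form \<open>exp (2 \<pi> \<i> s / P)\<close> with \<open>|Re s| \<le> P /
  2\<close>.\<close>

lemma wrap_substrip_eq_annulus:
  "wrap ` substrip \<delta> = {z. P / (2 * pi) * exp (- 2 * pi * (pi - \<delta>) / P) < norm (z - \<i> * P / (2 * pi)) \<and>
     norm (z - \<i> * P / (2 * pi)) < P / (2 * pi) * exp (2 * pi * (pi - \<delta>) / P)}"
    (is "_ = ?A")
proof -
  have P0: "P > 0" using P_gt_1 by simp
  have c: "wrap s - \<i> * P / (2 * pi) = P / (2 * pi * \<i>) * exp (2 * pi * \<i> * s / P)" for s
    unfolding wrap_def by (simp add: right_diff_distrib field_simps)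
  have n: "norm (wrap s - \<i> * P / (2 * pi)) = P / (2 * pi) * exp (- 2 * pi * Im s / P)" for s
    unfolding c using P0 by (simp add: norm_mult norm_divide)
  have iff: "wrap s \<in> ?A \<longleftrightarrow> \<bar>Im s\<bar> < pi - \<delta>" for s
  proof -
    have K: "P / (2 * pi) * exp x < P / (2 * pi) * exp y \<longleftrightarrow> x < y" for x y
      using P0 by (subst mult_less_cancel_left_pos) auto
    have E: "a / P < b / P \<longleftrightarrow> a < b" for a b :: real
      using P0 by (simp add: divide_less_cancel)
    have F: "- 2 * pi * a < - 2 * pi * b \<longleftrightarrow> b < a" "- 2 * pi * a < 2 * pi * b \<longleftrightarrow> - a < b" for a b :: real
      using mult_less_cancel_left_pos[of "2 * pi" b a] mult_less_cancel_left_pos[of "2 * pi" "- a" b] by simp_all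
    show ?thesis unfolding mem_Collect_eq n K E F by linarith
  qed
  show ?thesis
  proof (intro equalityI subsetI)
    fix z assume "z \<in> wrap ` substrip \<delta>" then show "z \<in> ?A" using iff by (auto simp: substrip_def)
  next
    fix z assume z: "z \<in> ?A"
    define X where "X = 1 + 2 * pi * \<i> * z / P"
    have "0 < P / (2 * pi) * exp (- 2 * pi * (pi - \<delta>) / P)" using P0 by simp
    then have "norm (z - \<i> * P / (2 * pi)) > 0" using z unfolding mem_Collect_eq by linarith
    then have "z - \<i> * P / (2 * pi) \<noteq> 0" by auto
    moreover have "X = 2 * pi * \<i> / P * (z - \<i> * P / (2 * pi))" using P0 by (simp add: X_def field_simps)
    ultimately have X: "X \<noteq> 0" using P0 by simp
    define s where "s = P * Ln X / (2 * pi * \<i>)"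
    have "2 * pi * \<i> * s / P = Ln X" using P0 by (simp add: s_def)
    then have Zs: "wrap s = z" unfolding wrap_def using X P0 by (simp add: X_def)
    have "Re s = P * Im (Ln X) / (2 * pi)"
      unfolding s_def by (simp add: Re_divide Im_divide power2_eq_square field_simps)
    moreover have "\<bar>Im (Ln X)\<bar> \<le> pi" using mpi_less_Im_Ln[OF X] Im_Ln_le_pi[OF X] by linarith
    moreover have "\<bar>P * Im (Ln X) / (2 * pi)\<bar> = P * \<bar>Im (Ln X)\<bar> / (2 * pi)"
      using P0 by (simp add: abs_mult)
    ultimately have "\<bar>Re s\<bar> \<le> P * pi / (2 * pi)"
      using P0 by (simp add: divide_le_eq)
    then have "\<bar>Re s\<bar> \<le> P / 2" by simp
    then have "s \<in> substrip \<delta>" using iff[of s] z P0 unfolding Zs substrip_def by auto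
    then show "z \<in> wrap ` substrip \<delta>" using Zs by blast
  qed
qed

context
  assumes ne: "\<beta>1 \<noteq> \<beta>2"
begin

lemma annulus_map_strip_map: "s \<in> strip \<Longrightarrow> annulus_map (strip_map s) = wrap s"
proof -
  assume s: "s \<in> strip"
  define t where "t = (SOME t. t \<in> strip \<and> strip_map t = strip_map s)"
  have t: "t \<in> strip \<and> strip_map t = strip_map s" unfolding t_def by (rule someI[of _ s]) (simp add: s)
  have "wrap t = wrap s" by (rule wrap_cong, rule strip_map_inj[OF ne]) (use t s in auto)
  then show ?thesis by (simp add: annulus_map_def t_def)
qed

text \<open>\<open>strip_map\<close> is locally injective, hence open.\<close>

lemma open_strip_map_image:
  assumes U: "open U" "U \<subseteq> strip" shows "open (strip_map ` U)"
proof (subst open_subopen, intro ballI)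
  fix w assume "w \<in> strip_map ` U"
  then obtain s where s: "s \<in> U" "w = strip_map s" by blast
  then obtain r where r: "r > 0" "ball s r \<subseteq> U" using U(1) open_contains_ball by blast
  have b: "ball s (min r (1 / 2)) \<subseteq> U" using r(2) by auto
  have "open (strip_map ` ball s (min r (1 / 2)))"
  proof (rule open_mapping_thm3)
    show "strip_map holomorphic_on ball s (min r (1 / 2))"
      using holomorphic_on_subset[OF holomorphic_strip_map] b U by blast
    show "inj_on strip_map (ball s (min r (1 / 2)))" by (rule inj_on_strip_map_ball[OF ne]) (use b U in auto)
  qed simp
  moreover have "w \<in> strip_map ` ball s (min r (1 / 2))" using s r by simp
  ultimately show "\<exists>T. open T \<and> w \<in> T \<and> T \<subseteq> strip_map ` U" using b by blast
qed

lemma holomorphic_annulus_map: "annulus_map holomorphic_on strip_map ` strip"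
proof (rule holomorphic_on_subset)
  show "strip_map ` strip \<subseteq> strip_map ` strip" ..
  have "\<exists>T. open T \<and> w \<in> T \<and> annulus_map holomorphic_on T" if w: "w \<in> strip_map ` strip" for w
  proof -
    obtain s where s: "s \<in> strip" "w = strip_map s" using w by blast
    then obtain r0 where r0: "r0 > 0" "ball s r0 \<subseteq> strip" using open_strip open_contains_ball by blast
    define r where "r = min r0 (1 / 2)"
    have r: "r > 0" "ball s r \<subseteq> strip" "r \<le> 1 / 2" using r0 by (auto simp: r_def)
    have hol: "strip_map holomorphic_on ball s r" by (rule holomorphic_on_subset[OF holomorphic_strip_map r(2)])
    have inj: "inj_on strip_map (ball s r)" by (rule inj_on_strip_map_ball[OF ne r(2,3)])
    obtain k where k: "k holomorphic_on (strip_map ` ball s r)" "\<And>z. z \<in> ball s r \<Longrightarrow> k (strip_map z) = z"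
      using holomorphic_has_inverse[OF hol open_ball inj] by metis
    have "(\<lambda>w. wrap (k w)) holomorphic_on (strip_map ` ball s r)"
      unfolding wrap_def using P_gt_1 by (intro holomorphic_intros k) auto
    then have "annulus_map holomorphic_on (strip_map ` ball s r)"
      by (rule holomorphic_transform) (use k(2) annulus_map_strip_map r(2) in auto)
    moreover have "open (strip_map ` ball s r)" using r by (intro open_strip_map_image) auto
    moreover have "w \<in> strip_map ` ball s r" using s r by simp
    ultimately show ?thesis by blast
  qed
  then show "annulus_map holomorphic_on strip_map ` strip"
    unfolding holomorphic_on_def[of annulus_map "strip_map ` strip"]
    using holomorphic_on_imp_differentiable_at field_differentiable_at_within by fast
qed

lemma inj_on_annulus_map: "inj_on annulus_map (strip_map ` strip)"
proof (rule inj_onI)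
  fix x y assume "x \<in> strip_map ` strip" "y \<in> strip_map ` strip" "annulus_map x = annulus_map y"
  then obtain a b where ab: "a \<in> strip" "b \<in> strip" "x = strip_map a" "y = strip_map b" by blast
  then have "wrap a = wrap b" using \<open>annulus_map x = annulus_map y\<close> annulus_map_strip_map by simp
  then show "x = y" using strip_map_cong[OF ab(1,2) wrap_inj[OF ab(1,2)]] ab(3,4) by simp
qed

context
  fixes \<delta> :: real
  assumes \<delta>: "0 < \<delta>" "\<delta> < pi"
begin

lemma substrip_strip: "substrip \<delta> \<subseteq> strip"
  using \<delta> by (auto simp: substrip_def strip_def)

lemma substrip_box: "substrip \<delta> = box (Complex (- P) (- (pi - \<delta>))) (Complex P (pi - \<delta>))"
  by (auto simp: substrip_def in_box_complex_iff)

lemma open_ring: "open (strip_map ` substrip \<delta>)"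
  by (rule open_strip_map_image[OF _ substrip_strip]) (unfold substrip_box, rule open_box)

lemma connected_substrip: "connected (substrip \<delta>)"
  unfolding substrip_box by (intro convex_connected convex_box)

lemma connected_ring: "connected (strip_map ` substrip \<delta>)"
  by (intro connected_continuous_image connected_substrip holomorphic_on_imp_continuous_on
      holomorphic_on_subset[OF holomorphic_strip_map substrip_strip])

lemma zero_in_substrip: "0 \<in> substrip \<delta>"
  using \<delta> P_gt_1 by (simp add: substrip_def)

definition cell :: "complex set" where
  "cell = cbox (Complex (- P / 2) (- (pi - \<delta>))) (Complex (P / 2) (pi - \<delta>))"

lemma in_cell: "s \<in> cell \<longleftrightarrow> \<bar>Re s\<bar> \<le> P / 2 \<and> \<bar>Im s\<bar> \<le> pi - \<delta>"
  by (auto simp: cell_def in_cbox_complex_iff)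

lemma cell_strip: "cell \<subseteq> strip"
  using \<delta> P_gt_1 by (auto simp: in_cell strip_def)

lemma continuous_on_strip_map_cell: "continuous_on cell strip_map"
  by (intro holomorphic_on_imp_continuous_on holomorphic_on_subset[OF holomorphic_strip_map cell_strip])

lemma strip_map_substrip_eq_cell: "strip_map ` substrip \<delta> = strip_map ` {s \<in> cell. \<bar>Im s\<bar> < pi - \<delta>}"
proof (intro equalityI subsetI)
  fix w assume "w \<in> strip_map ` substrip \<delta>"
  then obtain s where s: "s \<in> substrip \<delta>" "w = strip_map s" by blast
  then obtain t where "t \<in> strip" "\<bar>Re t\<bar> \<le> P / 2" "Im t = Im s" "strip_map t = strip_map s"
    using strip_map_fundamental_cell substrip_strip by blast
  then show "w \<in> strip_map ` {s \<in> cell. \<bar>Im s\<bar> < pi - \<delta>}" using s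
    by (intro image_eqI[of _ _ t]) (auto simp: in_cell substrip_def)
next
  fix w assume "w \<in> strip_map ` {s \<in> cell. \<bar>Im s\<bar> < pi - \<delta>}"
  then show "w \<in> strip_map ` substrip \<delta>" using P_gt_1 by (auto simp: in_cell substrip_def)
qed

text \<open>Preimages differ by real periods, so the imaginary part of a preimage is determined by the
  value.\<close>

lemma edge_not_in_ring:
  assumes "s \<in> cell" "\<bar>Im s\<bar> = pi - \<delta>" shows "strip_map s \<notin> strip_map ` substrip \<delta>"
proof
  assume "strip_map s \<in> strip_map ` substrip \<delta>"
  then obtain t where t: "t \<in> substrip \<delta>" "strip_map s = strip_map t" by blast
  then have "s - t \<in> {0, of_real P, - of_real P}"
    using assms(1) cell_strip substrip_strip by (intro strip_map_inj[OF ne]) auto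
  then have "Im s = Im t" by (auto simp: diff_eq_eq)
  then show False using t(1) assms(2) by (simp add: substrip_def)
qed

text \<open>The image of the upper (\<open>\<sigma> = 1\<close>) or lower (\<open>\<sigma> = -1\<close>)
  side of the cell, closed up by periodicity.\<close>

definition edge_path :: "real \<Rightarrow> real \<Rightarrow> complex" where
  "edge_path \<sigma> t = strip_map (Complex (P * t - P / 2) (\<sigma> * (pi - \<delta>)))"

lemma edge_point_cell:
  assumes t: "t \<in> {0..1}" and \<sigma>: "\<bar>\<sigma>\<bar> = 1"
  shows "Complex (P * t - P / 2) (\<sigma> * (pi - \<delta>)) \<in> cell"
proof -
  have "0 \<le> P * t" "P * t \<le> P * 1" using t P_gt_1 by (auto intro: mult_left_mono)
  then have "\<bar>P * t - P / 2\<bar> \<le> P / 2" by (intro abs_leI; linarith)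
  moreover have "\<bar>\<sigma> * (pi - \<delta>)\<bar> = pi - \<delta>" unfolding abs_mult \<sigma> using \<delta> by simp
  ultimately show ?thesis by (simp add: in_cell)
qed

lemma simple_path_edge:
  assumes "\<bar>\<sigma>\<bar> = 1" shows "simple_path (edge_path \<sigma>)" "pathfinish (edge_path \<sigma>) = pathstart (edge_path \<sigma>)"
proof -
  have "continuous_on {0..1} (\<lambda>t. Complex (P * t - P / 2) (\<sigma> * (pi - \<delta>)))"
    unfolding Complex_eq by (intro continuous_intros)
  then have "path (edge_path \<sigma>)"
    unfolding path_def edge_path_def
    by (rule continuous_on_compose2[OF continuous_on_strip_map_cell]) (use edge_point_cell[OF _ assms] in auto)
  moreover have "loop_free (edge_path \<sigma>)"
    unfolding loop_free_def
  proof (intro ballI impI)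
    fix x y :: real assume xy: "x \<in> {0..1}" "y \<in> {0..1}" "edge_path \<sigma> x = edge_path \<sigma> y"
    have "Complex (P * x - P / 2) (\<sigma> * (pi - \<delta>)) - Complex (P * y - P / 2) (\<sigma> * (pi - \<delta>)) \<in> {0, of_real P, - of_real P}"
      using xy(3) edge_point_cell[OF xy(1) assms] edge_point_cell[OF xy(2) assms] cell_strip
      unfolding edge_path_def by (intro strip_map_inj[OF ne]) auto
    then have "P * (x - y) = 0 \<or> P * (x - y) = P * 1 \<or> P * (x - y) = P * (- 1)"
      by (auto simp: complex_eq_iff right_diff_distrib)
    then have "x - y = 0 \<or> x - y = 1 \<or> x - y = - 1"
      using P_gt_1 unfolding mult_cancel_left by auto
    then show "x = y \<or> x = 0 \<and> y = 1 \<or> x = 1 \<and> y = 0" using xy(1,2) by auto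
  qed
  ultimately show "simple_path (edge_path \<sigma>)" by (simp add: simple_path_def)
  have c0: "Complex (P * 0 - P / 2) (\<sigma> * (pi - \<delta>)) \<in> strip" and c1: "Complex (P * 1 - P / 2) (\<sigma> * (pi - \<delta>)) \<in> strip"
    by (rule subsetD[OF cell_strip edge_point_cell[OF _ assms]]; simp)+
  show "pathfinish (edge_path \<sigma>) = pathstart (edge_path \<sigma>)"
    unfolding pathfinish_def pathstart_def edge_path_def
    by (rule strip_map_cong[OF c1 c0]) (simp add: complex_eq_iff)
qed

lemma path_image_edge:
  assumes "\<bar>\<sigma>\<bar> = 1" shows "path_image (edge_path \<sigma>) = strip_map ` {s \<in> cell. Im s = \<sigma> * (pi - \<delta>)}"
proof (intro equalityI subsetI)
  fix w assume "w \<in> path_image (edge_path \<sigma>)"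
  then show "w \<in> strip_map ` {s \<in> cell. Im s = \<sigma> * (pi - \<delta>)}"
    using edge_point_cell[OF _ assms] by (auto simp: path_image_def edge_path_def)
next
  fix w assume "w \<in> strip_map ` {s \<in> cell. Im s = \<sigma> * (pi - \<delta>)}"
  then obtain s where s: "s \<in> cell" "Im s = \<sigma> * (pi - \<delta>)" "w = strip_map s" by blast
  define t where "t = (Re s + P / 2) / P"
  have "P * t - P / 2 = Re s" using P_gt_1 by (simp add: t_def)
  moreover have "t \<in> {0..1}" using s(1) P_gt_1 by (auto simp: t_def in_cell field_simps)
  moreover from this s have "s = Complex (P * t - P / 2) (\<sigma> * (pi - \<delta>))"
    by (simp add: complex_eq_iff \<open>P * t - P / 2 = Re s\<close>)
  ultimately show "w \<in> path_image (edge_path \<sigma>)"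
    unfolding path_image_def edge_path_def using s(3) by (intro image_eqI[of _ _ t]) simp_all
qed

lemma disjoint_edges: "path_image (edge_path 1) \<inter> path_image (edge_path (- 1)) = {}"
proof -
  have False if st: "s \<in> cell" "t \<in> cell" "Im s = pi - \<delta>" "Im t = - (pi - \<delta>)" "strip_map s = strip_map t" for s t
  proof -
    have "s - t \<in> {0, of_real P, - of_real P}" using st cell_strip by (intro strip_map_inj[OF ne]) auto
    then have "Im s = Im t" by (auto simp: diff_eq_eq)
    then show False using st \<delta> by simp
  qed
  then show ?thesis by (auto simp: path_image_edge)
qed

end
end
end

context periodic_slit_map
begin

text \<open>The closure is the image of the compact cell, and of the cell only the two horizontal sides are
  mapped outside the ring.\<close>

lemma frontier_ring:
  assumes ne: "\<beta>1 \<noteq> \<beta>2" and \<delta>: "0 < \<delta>" "\<delta> < pi"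
  shows "frontier (Fin ` strip_map ` substrip \<delta>) = Fin ` path_image (edge_path \<delta> 1) \<union> Fin ` path_image (edge_path \<delta> (- 1))"
proof -
  have abs_m1: "\<bar>- 1 :: real\<bar> = 1" by simp
  let ?C = "cell \<delta>" and ?F = "Fin ` strip_map ` substrip \<delta>"
  have contF: "continuous_on ?C (\<lambda>s. Fin (strip_map s))"
    by (rule continuous_on_compose2[OF continuous_on_Fin[of UNIV] continuous_on_strip_map_cell[OF ne \<delta>]]) simp
  have cpt: "compact ((\<lambda>s. Fin (strip_map s)) ` ?C)"
    by (rule compact_continuous_image[OF contF]) (simp add: cell_def[OF ne \<delta>])
  have sub: "?F \<subseteq> (\<lambda>s. Fin (strip_map s)) ` ?C"
    unfolding strip_map_substrip_eq_cell[OF ne \<delta>] by blast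
  \<comment> \<open>The open cell: its image lies in the ring, and its closure is the cell.\<close>
  define B where "B = box (Complex (- P / 2) (- (pi - \<delta>))) (Complex (P / 2) (pi - \<delta>))"
  have "0 \<in> B" using P_gt_1 \<delta> by (simp add: B_def in_box_complex_iff)
  then have clB: "closure B = ?C" unfolding B_def cell_def[OF ne \<delta>] by (intro closure_box) blast
  have "B \<subseteq> substrip \<delta>" using P_gt_1 by (auto simp: B_def in_box_complex_iff substrip_def)
  then have "(\<lambda>s. Fin (strip_map s)) ` B \<subseteq> closure ?F"
    using closure_subset[of ?F] by blast
  then have "(\<lambda>s. Fin (strip_map s)) ` ?C \<subseteq> closure ?F"
    using image_closure_subset[of B "\<lambda>s. Fin (strip_map s)" "closure ?F"] contF unfolding clB by simp
  moreover have "closure ?F \<subseteq> (\<lambda>s. Fin (strip_map s)) ` ?C"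
    by (rule closure_minimal[OF sub compact_imp_closed[OF cpt]])
  ultimately have cl: "closure ?F = Fin ` strip_map ` ?C" by (auto simp: image_image)
  have "open ?F" by (intro open_Fin_image open_ring ne \<delta>)
  then have "frontier ?F = Fin ` strip_map ` ?C - ?F" unfolding frontier_def cl by (simp add: interior_open)
  also have "\<dots> = Fin ` (strip_map ` ?C - strip_map ` substrip \<delta>)" by (rule inj_on_image_set_diff[symmetric, OF inj_Fin[of UNIV]]) auto
  also have "strip_map ` ?C - strip_map ` substrip \<delta> = strip_map ` {s \<in> ?C. Im s = 1 * (pi - \<delta>)} \<union> strip_map ` {s \<in> ?C. Im s = - 1 * (pi - \<delta>)}"
  proof (intro equalityI subsetI)
    fix w assume w: "w \<in> strip_map ` ?C - strip_map ` substrip \<delta>"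
    then obtain s where s: "s \<in> ?C" "w = strip_map s" by blast
    have "\<not> \<bar>Im s\<bar> < pi - \<delta>"
    proof
      assume "\<bar>Im s\<bar> < pi - \<delta>"
      then have "strip_map s \<in> strip_map ` substrip \<delta>"
        unfolding strip_map_substrip_eq_cell[OF ne \<delta>] using s(1) by (intro imageI) simp
      then show False using w s(2) by simp
    qed
    then have "Im s = pi - \<delta> \<or> Im s = - (pi - \<delta>)" using s(1) unfolding in_cell[OF ne \<delta>] by linarith
    then show "w \<in> strip_map ` {s \<in> ?C. Im s = 1 * (pi - \<delta>)} \<union> strip_map ` {s \<in> ?C. Im s = - 1 * (pi - \<delta>)}"
      unfolding s(2) using s(1) by (elim disjE) (rule UnI1, rule imageI, simp, rule UnI2, rule imageI, simp)
  next
    fix w assume "w \<in> strip_map ` {s \<in> ?C. Im s = 1 * (pi - \<delta>)} \<union> strip_map ` {s \<in> ?C. Im s = - 1 * (pi - \<delta>)}"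
    then obtain s where s: "s \<in> ?C" "w = strip_map s" "Im s = 1 * (pi - \<delta>) \<or> Im s = - 1 * (pi - \<delta>)" by blast
    then have "\<bar>Im s\<bar> = pi - \<delta>" using \<delta> by auto
    from edge_not_in_ring[OF ne \<delta> s(1) this] show "w \<in> strip_map ` ?C - strip_map ` substrip \<delta>"
      unfolding s(2) using s(1) by (intro DiffI imageI)
  qed
  also have "Fin ` \<dots> = Fin ` path_image (edge_path \<delta> 1) \<union> Fin ` path_image (edge_path \<delta> (- 1))"
    unfolding path_image_edge[OF ne \<delta> abs_one] path_image_edge[OF ne \<delta> abs_m1] image_Un ..
  finally show ?thesis .
qed

lemma ring_bounded_by_Jordan_curves:
  assumes ne: "\<beta>1 \<noteq> \<beta>2" and \<delta>: "0 < \<delta>" "\<delta> < pi"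
  shows "\<exists>\<J>. finite \<J> \<and> pairwise disjnt \<J> \<and> (\<forall>J\<in>\<J>. jordan_curve J \<and> J \<subseteq> Fin ` (- \<real>\<^sub>\<le>\<^sub>0)) \<and>
             frontier (Fin ` strip_map ` substrip \<delta>) = \<Union>\<J>"
proof (intro exI conjI)
  let ?J = "\<lambda>\<sigma>. Fin ` path_image (edge_path \<delta> \<sigma>)"
  show "finite {?J 1, ?J (- 1)}" by simp
  show "pairwise disjnt {?J 1, ?J (- 1)}"
    using disjoint_edges[OF ne \<delta>] by (auto simp: pairwise_def disjnt_def)
  show "\<forall>J\<in>{?J 1, ?J (- 1)}. jordan_curve J \<and> J \<subseteq> Fin ` (- \<real>\<^sub>\<le>\<^sub>0)"
  proof -
    have "jordan_curve (?J \<sigma>) \<and> ?J \<sigma> \<subseteq> Fin ` (- \<real>\<^sub>\<le>\<^sub>0)" if \<sigma>: "\<bar>\<sigma>\<bar> = 1" for \<sigma>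
    proof
      have "simple_path (Fin \<circ> edge_path \<delta> \<sigma>)"
        by (intro simple_path_continuous_image simple_path_edge[OF ne \<delta> \<sigma>] continuous_on_Fin inj_Fin)
      moreover have "pathfinish (Fin \<circ> edge_path \<delta> \<sigma>) = pathstart (Fin \<circ> edge_path \<delta> \<sigma>)"
        using simple_path_edge(2)[OF ne \<delta> \<sigma>] by (simp add: pathfinish_compose pathstart_compose)
      ultimately show "jordan_curve (?J \<sigma>)"
        unfolding jordan_curve_def by (metis path_image_compose)
      have "path_image (edge_path \<delta> \<sigma>) \<subseteq> strip_map ` strip"
        unfolding path_image_edge[OF ne \<delta> \<sigma>] using cell_strip[OF ne \<delta>] by blast
      then show "?J \<sigma> \<subseteq> Fin ` (- \<real>\<^sub>\<le>\<^sub>0)" using strip_map_avoids_nonpos_Reals by blast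
    qed
    then show ?thesis by simp
  qed
  show "frontier (Fin ` strip_map ` substrip \<delta>) = \<Union>{?J 1, ?J (- 1)}"
    unfolding frontier_ring[OF assms] by simp
qed

lemma annulus_map_ring:
  assumes ne: "\<beta>1 \<noteq> \<beta>2" and \<delta>: "0 < \<delta>" "\<delta> < pi"
  shows "annulus_map ` strip_map ` substrip \<delta> = wrap ` substrip \<delta>"
  using annulus_map_strip_map[OF ne] substrip_strip[OF ne \<delta>] by (auto simp: image_image subset_iff intro!: image_cong)

lemma circle_domain_moebius_ring:
  assumes ne: "\<beta>1 \<noteq> \<beta>2" and \<delta>: "0 < \<delta>" "\<delta> < pi" and D: "a * d - b * c \<noteq> 0"
  shows "circle_domain (moebius a b c d ` Fin ` annulus_map ` strip_map ` substrip \<delta>)"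
  unfolding annulus_map_ring[OF ne \<delta>]
proof (rule circle_domain_moebius_annulus[OF D _ _ _ _ wrap_substrip_eq_annulus])
  have P0: "P > 0" using P_gt_1 by simp
  show "0 < P / (2 * pi) * exp (- 2 * pi * (pi - \<delta>) / P)" using P0 by simp
  have "- 2 * pi * (pi - \<delta>) / P < 2 * pi * (pi - \<delta>) / P" using P0 \<delta> by (intro divide_strict_right_mono) auto
  then show "P / (2 * pi) * exp (- 2 * pi * (pi - \<delta>) / P) < P / (2 * pi) * exp (2 * pi * (pi - \<delta>) / P)"
    using P0 by (intro mult_strict_left_mono) auto
  have "wrap holomorphic_on substrip \<delta>" unfolding wrap_def using P0 by (intro holomorphic_intros) auto
  then show "connected (wrap ` substrip \<delta>)"
    by (intro connected_continuous_image connected_substrip[OF ne \<delta>] holomorphic_on_imp_continuous_on)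
  show "wrap ` substrip \<delta> \<noteq> {}" using zero_in_substrip[OF ne \<delta>] by blast
qed

text \<open>\<open>wrap s - s = P / (2 \<pi> \<i>) (exp u - 1 - u)\<close> with \<open>u = 2 \<pi> \<i> s /
  P\<close>, so \<open>wrap\<close> tends to the identity as \<open>P\<close> grows.\<close>

lemma wrap_near:
  assumes d: "\<And>u::complex. norm u < d \<Longrightarrow> norm (exp u - 1 - u) \<le> \<epsilon> * norm u" and s: "2 * pi * norm s < d * P"
  shows "norm (wrap s - s) \<le> \<epsilon> * norm s"
proof -
  have P0: "P > 0" using P_gt_1 by simp
  define u where "u = 2 * pi * \<i> * s / P"
  have nu: "norm u = 2 * pi * norm s / P" using P0 by (simp add: u_def norm_mult norm_divide)
  have "wrap s - s = P / (2 * pi * \<i>) * (exp u - 1 - u)"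
    unfolding wrap_def u_def using P0 by (simp add: right_diff_distrib)
  then have "norm (wrap s - s) = P / (2 * pi) * norm (exp u - 1 - u)"
    using P0 by (simp add: norm_mult norm_divide)
  also have "\<dots> \<le> P / (2 * pi) * (\<epsilon> * norm u)"
  proof (rule mult_left_mono)
    have "norm u < d" unfolding nu using P0 s by (simp add: divide_less_eq)
    then show "norm (exp u - 1 - u) \<le> \<epsilon> * norm u" by (rule d)
  qed (use P0 in simp)
  also have "\<dots> = \<epsilon> * norm s" unfolding nu using P0 by (simp add: field_simps)
  finally show ?thesis .
qed

end

section \<open>An exhaustion of the slit plane\<close>

abbreviation "strip_map_of \<equiv> periodic_slit_map.strip_map"
abbreviation "annulus_map_of \<equiv> periodic_slit_map.annulus_map"
abbreviation "ring_dom P \<delta> \<equiv> strip_map_of P ` periodic_slit_map.substrip P \<delta>"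

text \<open>The conditions under which \<open>ring_dom P \<delta>\<close> is a ring domain; they hold for
  every \<open>\<delta>\<close> in \<open>(0, \<pi>)\<close> once \<open>P\<close> is large.\<close>

definition admissible :: "real \<Rightarrow> real \<Rightarrow> bool" where
  "admissible P \<delta> \<longleftrightarrow> 1 < P \<and> periodic_slit_map.\<beta>1 P \<noteq> periodic_slit_map.\<beta>2 P \<and> 0 < \<delta> \<and> \<delta> < pi"

lemma ring_in_compact:
  assumes "admissible P \<delta>" shows "\<exists>C. compact C \<and> ring_dom P \<delta> \<subseteq> C \<and> C \<subseteq> - \<real>\<^sub>\<le>\<^sub>0"
proof -
  interpret periodic_slit_map P using assms by unfold_locales (simp add: admissible_def)
  have ne: "\<beta>1 \<noteq> \<beta>2" and \<delta>: "0 < \<delta>" "\<delta> < pi" using assms by (simp_all add: admissible_def)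
  have "compact (strip_map ` cell \<delta>)"
    by (intro compact_continuous_image continuous_on_strip_map_cell[OF ne \<delta>]) (simp add: cell_def[OF ne \<delta>])
  moreover have "ring_dom P \<delta> \<subseteq> strip_map ` cell \<delta>" unfolding strip_map_substrip_eq_cell[OF ne \<delta>] by blast
  moreover have "strip_map ` cell \<delta> \<subseteq> - \<real>\<^sub>\<le>\<^sub>0" using strip_map_avoids_nonpos_Reals cell_strip[OF ne \<delta>] by blast
  ultimately show ?thesis by blast
qed

lemma ring_covers_compact:
  assumes K: "compact K" "K \<subseteq> - \<real>\<^sub>\<le>\<^sub>0"
  shows "\<exists>P \<delta>. N < P \<and> admissible P \<delta> \<and> K \<subseteq> ring_dom P \<delta>"
proof -
  obtain \<delta> where \<delta>: "0 < \<delta>" "\<delta> < pi" and ev: "\<forall>\<^sub>F P in at_top. \<forall>w\<in>K. \<exists>s. norm (s - Ln w) < 1 \<and> \<bar>Re s\<bar> < P \<and> \<bar>Im s\<bar> < pi - \<delta> \<and>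
           periodic_slit_map.strip_map P s = w" using strip_map_covers_compact[OF K, of 1] by auto
  have "\<forall>\<^sub>F P in at_top. N < P \<and> admissible P \<delta> \<and> K \<subseteq> ring_dom P \<delta>"
    using eventually_gt_at_top[of 1] eventually_gt_at_top[of N] eventually_\<beta>_ne ev
  proof eventually_elim
    case (elim P)
    interpret periodic_slit_map P using elim(1) by unfold_locales
    have "K \<subseteq> ring_dom P \<delta>"
    proof
      fix w assume "w \<in> K"
      then obtain s where "\<bar>Re s\<bar> < P" "\<bar>Im s\<bar> < pi - \<delta>" "strip_map s = w" using elim(4) by blast
      then show "w \<in> ring_dom P \<delta>" by (intro image_eqI[of _ _ s]) (auto simp: substrip_def)
    qed
    then show ?case using elim \<delta> by (simp add: admissible_def)
  qed
  from eventually_happens'[OF trivial_limit_at_top_linorder this] show ?thesis by blast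
qed

text \<open>A compact exhaustion of the slit plane: the images under \<open>exp\<close> of rectangles that
  exhaust the strip.\<close>

definition exhaust_compact :: "nat \<Rightarrow> complex set" where
  "exhaust_compact n = exp ` cbox (Complex (- real n) (- (pi - 1 / (real n + 1)))) (Complex (real n) (pi - 1 / (real n + 1)))"

lemma exhaust_compact: "compact (exhaust_compact n)" "exhaust_compact n \<subseteq> - \<real>\<^sub>\<le>\<^sub>0"
proof -
  show "compact (exhaust_compact n)" unfolding exhaust_compact_def
    by (intro compact_continuous_image continuous_intros) simp
  show "exhaust_compact n \<subseteq> - \<real>\<^sub>\<le>\<^sub>0"
  proof
    fix w assume "w \<in> exhaust_compact n"
    then obtain s where s: "w = exp s" "- (pi - 1 / (real n + 1)) \<le> Im s" "Im s \<le> pi - 1 / (real n + 1)"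
      by (auto simp: exhaust_compact_def in_cbox_complex_iff)
    have "0 < 1 / (real n + 1)" by simp
    then have I: "- pi < Im s" "Im s < pi" using s by linarith+
    show "w \<in> - \<real>\<^sub>\<le>\<^sub>0" using exp_notin_nonpos_Reals[OF I] s(1) by simp
  qed
qed

lemma exhaust_compact_UN:
  assumes "w \<notin> \<real>\<^sub>\<le>\<^sub>0" shows "\<exists>n. w \<in> exhaust_compact n"
proof -
  have w0: "w \<noteq> 0" using assms by auto
  define \<eta> where "\<eta> = pi - \<bar>Im (Ln w)\<bar>"
  have "\<eta> > 0" using abs_Im_Ln_less[OF assms] by (simp add: \<eta>_def)
  obtain n :: nat where n: "max \<bar>Re (Ln w)\<bar> (1 / \<eta>) < n" using reals_Archimedean2 by blast
  have "1 / \<eta> < real n + 1" using n by linarith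
  then have "1 / (real n + 1) < \<eta>" using \<open>\<eta> > 0\<close> by (simp add: field_simps)
  then have "\<bar>Im (Ln w)\<bar> \<le> pi - 1 / (real n + 1)" "\<bar>Re (Ln w)\<bar> \<le> n" using n by (auto simp: \<eta>_def)
  then have "Ln w \<in> cbox (Complex (- real n) (- (pi - 1 / (real n + 1)))) (Complex (real n) (pi - 1 / (real n + 1)))"
    unfolding in_cbox_complex_iff complex.sel atLeastAtMost_iff by (intro conjI; linarith)
  then show ?thesis using w0 unfolding exhaust_compact_def by (metis exp_Ln image_eqI)
qed

text \<open>Choose the rings recursively. The closure of a ring is a compact subset of the slit plane, so a
  ring with a sufficiently large period contains it, together with the next compact set.\<close>

lemma ring_sequence:
  "\<exists>P \<delta> :: nat \<Rightarrow> real. \<forall>j. admissible (P j) (\<delta> j) \<and> real j < P j \<and> exhaust_compact j \<subseteq> ring_dom (P j) (\<delta> j) \<and>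
      ring_dom (P j) (\<delta> j) \<subseteq> ring_dom (P (Suc j)) (\<delta> (Suc j))"
proof -
  have "\<exists>f. \<forall>n. (admissible (fst (f n)) (snd (f n)) \<and> real n < fst (f n) \<and> exhaust_compact n \<subseteq> ring_dom (fst (f n)) (snd (f n))) \<and>
      ring_dom (fst (f n)) (snd (f n)) \<subseteq> ring_dom (fst (f (Suc n))) (snd (f (Suc n)))"
  proof (rule dependent_nat_choice)
    show "\<exists>x. admissible (fst x) (snd x) \<and> real 0 < fst x \<and> exhaust_compact 0 \<subseteq> ring_dom (fst x) (snd x)"
    proof -
      obtain P \<delta> where "real 0 < P" "admissible P \<delta>" "exhaust_compact 0 \<subseteq> ring_dom P \<delta>"
        using ring_covers_compact[OF exhaust_compact, of "real 0" 0] by (elim exE conjE)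
      then show ?thesis by (intro exI[of _ "(P, \<delta>)"]) (simp only: fst_conv snd_conv)
    qed
  next
    fix x :: "real \<times> real" and n
    assume "admissible (fst x) (snd x) \<and> real n < fst x \<and> exhaust_compact n \<subseteq> ring_dom (fst x) (snd x)"
    then have "admissible (fst x) (snd x)" ..
    from ring_in_compact[OF this]
    obtain C where C: "compact C" "ring_dom (fst x) (snd x) \<subseteq> C" "C \<subseteq> - \<real>\<^sub>\<le>\<^sub>0" by (elim exE conjE)
    have "compact (C \<union> exhaust_compact (Suc n))" "C \<union> exhaust_compact (Suc n) \<subseteq> - \<real>\<^sub>\<le>\<^sub>0"
      using C exhaust_compact by (simp_all add: compact_Un)
    from ring_covers_compact[OF this, of "real (Suc n)"]
    obtain P \<delta> where P: "real (Suc n) < P" "admissible P \<delta>" "C \<union> exhaust_compact (Suc n) \<subseteq> ring_dom P \<delta>"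
      by (elim exE conjE)
    have CP: "C \<subseteq> ring_dom P \<delta>" "exhaust_compact (Suc n) \<subseteq> ring_dom P \<delta>" using P(3) by (simp_all only: Un_subset_iff)
    show "\<exists>y. (admissible (fst y) (snd y) \<and> real (Suc n) < fst y \<and> exhaust_compact (Suc n) \<subseteq> ring_dom (fst y) (snd y)) \<and>
        ring_dom (fst x) (snd x) \<subseteq> ring_dom (fst y) (snd y)"
      by (rule exI[of _ "(P, \<delta>)"], unfold fst_conv snd_conv, intro conjI P CP subset_trans[OF C(2) CP(1)])
  qed
  then obtain f where f: "\<forall>n. (admissible (fst (f n)) (snd (f n)) \<and> real n < fst (f n) \<and> exhaust_compact n \<subseteq> ring_dom (fst (f n)) (snd (f n))) \<and>
      ring_dom (fst (f n)) (snd (f n)) \<subseteq> ring_dom (fst (f (Suc n))) (snd (f (Suc n)))" ..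
  then have "\<forall>j. admissible (fst (f j)) (snd (f j)) \<and> real j < fst (f j) \<and> exhaust_compact j \<subseteq> ring_dom (fst (f j)) (snd (f j)) \<and>
      ring_dom (fst (f j)) (snd (f j)) \<subseteq> ring_dom (fst (f (Suc j))) (snd (f (Suc j)))" unfolding conj_assoc .
  then show ?thesis by (rule_tac exI[of _ "\<lambda>j. fst (f j)"], rule_tac exI[of _ "\<lambda>j. snd (f j)"])
qed

text \<open>By \<open>strip_map_covers_compact\<close> the point \<open>w\<close> has a preimage close to
  \<open>Ln w\<close>, and \<open>wrap\<close> moves it only slightly.\<close>

lemma annulus_map_tendsto_Ln:
  assumes K: "compact K" "K \<subseteq> - \<real>\<^sub>\<le>\<^sub>0" and "\<epsilon> > 0"
  shows "\<forall>\<^sub>F P in at_top. \<forall>w\<in>K. norm (annulus_map_of P w - Ln w) < \<epsilon>"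
proof -
  have "compact (Ln ` K)" by (rule compact_continuous_image[OF _ K(1)]) (use K(2) in \<open>auto intro!: continuous_on_Ln\<close>)
  from compact_imp_bounded[OF this, unfolded bounded_pos]
  obtain R where R0: "R > 0" "\<forall>x\<in>Ln ` K. norm x \<le> R" by (elim exE conjE)
  have R: "R > 0" "norm (Ln w) \<le> R" if "w \<in> K" for w using R0 that by simp_all
  define \<eta> where "\<eta> = min 1 (\<epsilon> / 2)"
  have \<eta>: "\<eta> > 0" "\<eta> \<le> 1" "\<eta> \<le> \<epsilon> / 2" using \<open>\<epsilon> > 0\<close> by (auto simp: \<eta>_def)
  define \<epsilon>' where "\<epsilon>' = \<epsilon> / (2 * (R + 1))"
  have \<epsilon>': "\<epsilon>' > 0" using \<open>\<epsilon> > 0\<close> R0(1) by (simp add: \<epsilon>'_def)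
  have "(exp has_derivative (*) 1) (at (0::complex))"
    using DERIV_exp[of "0::complex"] by (simp add: has_field_derivative_def)
  from conjunct2[OF this[unfolded has_derivative_at_alt], rule_format, OF \<epsilon>']
  obtain d where d: "d > 0"
      "\<forall>u::complex. norm (u - 0) < d \<longrightarrow> norm (exp u - exp 0 - 1 * (u - 0)) \<le> \<epsilon>' * norm (u - 0)"
    by (elim exE conjE)
  obtain \<delta> where \<delta>: "0 < \<delta>" and ev: "\<forall>\<^sub>F P in at_top. \<forall>w\<in>K. \<exists>s. norm (s - Ln w) < \<eta> \<and> \<bar>Re s\<bar> < P \<and> \<bar>Im s\<bar> < pi - \<delta> \<and>
           periodic_slit_map.strip_map P s = w" using strip_map_covers_compact[OF K \<eta>(1)] by blast
  show ?thesis
    using ev eventually_gt_at_top[of 1] eventually_gt_at_top[of "2 * pi * (R + 1) / d"] eventually_\<beta>_ne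
  proof eventually_elim
    case (elim P)
    interpret periodic_slit_map P using elim by unfold_locales
    show ?case
    proof
      fix w assume w: "w \<in> K"
      then obtain s where s: "norm (s - Ln w) < \<eta>" "\<bar>Re s\<bar> < P" "\<bar>Im s\<bar> < pi - \<delta>" "strip_map s = w" using elim(1) by blast
      have ns: "norm s \<le> R + 1" using norm_triangle_ineq[of "Ln w" "s - Ln w"] s(1) R(2)[OF w] \<eta>(2) by simp
      have "s \<in> strip" using s(2,3) \<delta> by (auto simp: strip_def)
      then have gw: "annulus_map w = wrap s" using annulus_map_strip_map[OF elim(4)] s(4) by blast
      have "2 * pi * (R + 1) < d * P" using elim(3) d(1) by (simp add: divide_less_eq mult.commute)
      moreover have "2 * pi * norm s \<le> 2 * pi * (R + 1)" using ns by (intro mult_left_mono) simp_all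
      ultimately have "2 * pi * norm s < d * P" by linarith
      then have "norm (wrap s - s) \<le> \<epsilon>' * norm s" using d(2) by (intro wrap_near[of d]) simp_all
      also have "\<dots> \<le> \<epsilon>' * (R + 1)" using ns \<epsilon>' by simp
      also have "\<dots> = \<epsilon> / 2" using R0(1) by (simp add: \<epsilon>'_def field_simps)
      finally have "norm (wrap s - s) \<le> \<epsilon> / 2" .
      then show "norm (annulus_map w - Ln w) < \<epsilon>" unfolding gw
        using norm_triangle_ineq[of "wrap s - s" "s - Ln w"] s(1) \<eta>(3) by simp
    qed
  qed
qed

section \<open>Convergence of the normalized maps\<close>

lemma interp_det_nonzero:
  assumes "z0 \<noteq> z1" "z0 \<noteq> z2" "z1 \<noteq> z2" "w0 \<noteq> w1" "w0 \<noteq> w2" "w1 \<noteq> w2"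
  shows "interp_a z0 z1 z2 w0 w1 w2 * interp_d z0 z1 z2 w0 w1 w2 - interp_b z0 z1 z2 w0 w1 w2 * interp_c z0 z1 z2 w0 w1 w2 \<noteq> 0"
  unfolding interp_det using assms by simp

lemma tendsto_interp:
  assumes "(Z0 \<longlongrightarrow> z0) F" "(Z1 \<longlongrightarrow> z1) F" "(Z2 \<longlongrightarrow> z2) F"
  shows "((\<lambda>j. interp_a (Z0 j) (Z1 j) (Z2 j) w0 w1 w2) \<longlongrightarrow> interp_a z0 z1 z2 w0 w1 w2) F"
    "((\<lambda>j. interp_b (Z0 j) (Z1 j) (Z2 j) w0 w1 w2) \<longlongrightarrow> interp_b z0 z1 z2 w0 w1 w2) F"
    "((\<lambda>j. interp_c (Z0 j) (Z1 j) (Z2 j) w0 w1 w2) \<longlongrightarrow> interp_c z0 z1 z2 w0 w1 w2) F"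
    "((\<lambda>j. interp_d (Z0 j) (Z1 j) (Z2 j) w0 w1 w2) \<longlongrightarrow> interp_d z0 z1 z2 w0 w1 w2) F"
  unfolding interp_defs using assms by (auto intro!: tendsto_intros)

lemma tendsto_moebius_bound:
  assumes "(A \<longlongrightarrow> a) F" "(B \<longlongrightarrow> b) F" "(C \<longlongrightarrow> c) F" "(D \<longlongrightarrow> d) F" and nz: "a * d - b * c \<noteq> 0"
  shows "((\<lambda>j. 4 * frob_sq (A j - a) (B j - b) (C j - c) (D j - d) * frob_sq (A j) (B j) (C j) (D j) /
            (norm (A j * D j - B j * C j))\<^sup>2) \<longlongrightarrow> 0) F"
proof -
  have "((\<lambda>j. 4 * frob_sq (A j - a) (B j - b) (C j - c) (D j - d) * frob_sq (A j) (B j) (C j) (D j) /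
            (norm (A j * D j - B j * C j))\<^sup>2) \<longlongrightarrow>
        4 * frob_sq (a - a) (b - b) (c - c) (d - d) * frob_sq a b c d / (norm (a * d - b * c))\<^sup>2) F"
    unfolding frob_sq_def norm_sq_def using nz by (intro tendsto_intros assms) auto
  then show ?thesis by (simp add: frob_sq_def norm_sq_def)
qed

text \<open>Split the distance at the value of the limit transformation at the approximating point; the
  first part is small uniformly on the sphere, the second one by the Lipschitz bound.\<close>

lemma uniform_limit_moebius:
  assumes g: "uniform_limit U G \<gamma> sequentially"
    and lim: "A \<longlonglongrightarrow> a" "B \<longlonglongrightarrow> b" "C \<longlonglongrightarrow> c" "D \<longlonglongrightarrow> d"
    and nz: "a * d - b * c \<noteq> 0" "\<And>j. A j * D j - B j * C j \<noteq> 0"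
  shows "uniform_limit (Fin ` U) (\<lambda>j p. moebius (A j) (B j) (C j) (D j) (Fin (G j (fin_part p))))
           (\<lambda>p. moebius a b c d (Fin (\<gamma> (fin_part p)))) sequentially"
  unfolding uniform_limit_iff
proof (intro allI impI)
  fix \<epsilon> :: real assume "\<epsilon> > 0"
  define L where "L = frob_sq a b c d / norm (a * d - b * c)"
  have L: "L \<ge> 0" by (simp add: L_def frob_sq_def norm_sq_def)
  define \<eta> where "\<eta> = \<epsilon> / (4 * (L + 1))"
  have \<eta>: "\<eta> > 0" using \<open>\<epsilon> > 0\<close> L by (simp add: \<eta>_def)
  have "L * (2 * \<eta>) \<le> (L + 1) * (2 * \<eta>)" using \<eta> by simp
  also have "\<dots> = \<epsilon> / 2" using L by (simp add: \<eta>_def field_simps)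
  finally have L\<eta>: "L * (2 * \<eta>) \<le> \<epsilon> / 2" .
  have "(\<epsilon> / 2)\<^sup>2 > 0" using \<open>\<epsilon> > 0\<close> by simp
  from order_tendstoD(2)[OF tendsto_moebius_bound[OF lim nz(1)] this]
  have "\<forall>\<^sub>F j in sequentially. 4 * frob_sq (A j - a) (B j - b) (C j - c) (D j - d) * frob_sq (A j) (B j) (C j) (D j) /
            (norm (A j * D j - B j * C j))\<^sup>2 < (\<epsilon> / 2)\<^sup>2" .
  moreover have "\<forall>\<^sub>F j in sequentially. \<forall>w\<in>U. dist (G j w) (\<gamma> w) < \<eta>"
    using g \<eta> unfolding uniform_limit_iff by blast
  ultimately show "\<forall>\<^sub>F j in sequentially. \<forall>p\<in>Fin ` U. dist (moebius (A j) (B j) (C j) (D j) (Fin (G j (fin_part p))))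
      (moebius a b c d (Fin (\<gamma> (fin_part p)))) < \<epsilon>"
  proof eventually_elim
    case (elim j)
    show ?case
    proof
      fix p assume "p \<in> Fin ` U"
      then obtain w where w: "w \<in> U" "p = Fin w" by blast
      let ?M = "moebius a b c d" and ?q = "Fin (G j w)"
      have "(dist (moebius (A j) (B j) (C j) (D j) ?q) (?M ?q))\<^sup>2 < (\<epsilon> / 2)\<^sup>2"
        using dist_moebius_moebius_le[OF nz(1) nz(2)[of j], of ?q] elim(1) by linarith
      then have 1: "dist (moebius (A j) (B j) (C j) (D j) ?q) (?M ?q) < \<epsilon> / 2"
        using \<open>\<epsilon> > 0\<close> by (intro power2_less_imp_less[of _ "\<epsilon> / 2"]) auto
      have "dist (?M ?q) (?M (Fin (\<gamma> w))) \<le> L * dist ?q (Fin (\<gamma> w))"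
        unfolding L_def by (rule moebius_lipschitz[OF nz(1)])
      also have "\<dots> \<le> L * (2 * \<eta>)"
      proof (rule mult_left_mono[OF _ L])
        have "norm (G j w - \<gamma> w) < \<eta>" using elim(2) w(1) by (simp add: dist_norm)
        then show "dist ?q (Fin (\<gamma> w)) \<le> 2 * \<eta>" using dist_Fin_le[of "G j w" "\<gamma> w"] by linarith
      qed
      finally have 2: "dist (?M ?q) (?M (Fin (\<gamma> w))) \<le> \<epsilon> / 2" using L\<eta> by linarith
      show "dist (moebius (A j) (B j) (C j) (D j) (Fin (G j (fin_part p)))) (?M (Fin (\<gamma> (fin_part p)))) < \<epsilon>"
        using dist_triangle[of "moebius (A j) (B j) (C j) (D j) ?q" "?M (Fin (\<gamma> w))" "?M ?q"] 1 2 unfolding w(2) fin_part.simps by linarith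
    qed
  qed
qed

lemma sphere_domain_Fin: "open A \<Longrightarrow> connected A \<Longrightarrow> A \<noteq> {} \<Longrightarrow> sphere_domain (Fin ` A)"
  by (auto simp: sphere_domain_def open_Fin_image intro: connected_continuous_image continuous_on_Fin)

lemma open_slit_plane: "open (- \<real>\<^sub>\<le>\<^sub>0 :: complex set)"
  by (simp add: open_Compl closed_nonpos_Reals_complex)

lemma connected_slit_plane: "connected (- \<real>\<^sub>\<le>\<^sub>0 :: complex set)"
proof -
  have el: "exp (Ln w) = w" if "w \<in> - \<real>\<^sub>\<le>\<^sub>0" for w :: complex
  proof -
    have "w \<noteq> 0" using that by auto
    then show ?thesis by (rule exp_Ln)
  qed
  have "exp ` {z. \<bar>Im z\<bar> < pi} = (\<lambda>w. exp (Ln w)) ` (- \<real>\<^sub>\<le>\<^sub>0)"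
    unfolding Ln_image_slit_plane[symmetric] image_image ..
  also have "\<dots> = (\<lambda>w. w) ` (- \<real>\<^sub>\<le>\<^sub>0)" by (rule image_cong[OF refl el])
  also have "\<dots> = - \<real>\<^sub>\<le>\<^sub>0" by simp
  finally have "exp ` {z. \<bar>Im z\<bar> < pi} = - \<real>\<^sub>\<le>\<^sub>0" .
  moreover have "connected {z. \<bar>Im z\<bar> < pi}"
  proof -
    have eq: "{z. \<bar>Im z\<bar> < pi} = {z. Im z < pi} \<inter> {z. Im z > - pi}" by auto
    show ?thesis unfolding eq
      by (intro convex_connected convex_Int convex_halfspace_Im_lt convex_halfspace_Im_gt)
  qed
  then have "connected (exp ` {z. \<bar>Im z\<bar> < pi})"
    by (rule connected_continuous_image[rotated]) (intro continuous_intros)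
  ultimately show ?thesis by (simp only:)
qed

lemma countably_connected_slit_plane: "countably_connected (Fin ` (- \<real>\<^sub>\<le>\<^sub>0))"
proof -
  have "connected (\<real>\<^sub>\<le>\<^sub>0 :: complex set)"
  proof -
    have eq: "(\<real>\<^sub>\<le>\<^sub>0 :: complex set) = {z. Re z \<le> 0} \<inter> {z. Im z \<le> 0} \<inter> {z. Im z \<ge> 0}"
      by (auto simp: complex_nonpos_Reals_iff)
    show ?thesis
      unfolding eq by (intro convex_connected convex_Int convex_halfspace_Re_le convex_halfspace_Im_le convex_halfspace_Im_ge)
  qed
  moreover have "\<not> bounded (\<real>\<^sub>\<le>\<^sub>0 :: complex set)"
  proof
    assume "bounded (\<real>\<^sub>\<le>\<^sub>0 :: complex set)"
    then obtain B where B: "\<And>z::complex. z \<in> \<real>\<^sub>\<le>\<^sub>0 \<Longrightarrow> norm z \<le> B" unfolding bounded_iff by blast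
    have "complex_of_real (- \<bar>B\<bar> - 1) \<in> \<real>\<^sub>\<le>\<^sub>0" by (simp only: nonpos_Reals_of_real_iff)
    from B[OF this] show False unfolding norm_of_real by simp
  qed
  ultimately have "connected (- (Fin ` (- \<real>\<^sub>\<le>\<^sub>0)))"
    unfolding Compl_Fin_image double_complement by (rule connected_insert_Infty)
  then have "components (- (Fin ` (- \<real>\<^sub>\<le>\<^sub>0))) \<subseteq> {- (Fin ` (- \<real>\<^sub>\<le>\<^sub>0))}"
    by (rule iffD1[OF connected_eq_components_subset_sing])
  then show ?thesis unfolding countably_connected_def by (rule countable_subset) simp
qed

lemma uniform_limit_annulus_map:
  assumes K: "compact K" "K \<subseteq> - \<real>\<^sub>\<le>\<^sub>0" and P: "filterlim P at_top sequentially"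
  shows "uniform_limit K (\<lambda>j. annulus_map_of (P j)) Ln sequentially"
  unfolding uniform_limit_iff dist_norm
  using filterlim_iff[THEN iffD1, OF P, rule_format, OF annulus_map_tendsto_Ln[OF K]] by blast

theorem theorem1p1:
  shows "\<exists>(D :: riemann_sphere set) (\<Phi> :: nat \<Rightarrow> riemann_sphere set).
    sphere_domain D \<and> countably_connected D \<and> exhaustion D \<Phi> \<and>
    (\<forall>a0 a1 a2. {a0, a1, a2} \<subseteq> \<Phi> 0 \<and> a0 \<noteq> a1 \<and> a0 \<noteq> a2 \<and> a1 \<noteq> a2 \<longrightarrow>
      (\<exists>(f :: nat \<Rightarrow> riemann_sphere \<Rightarrow> riemann_sphere) (f_\<Phi> :: riemann_sphere \<Rightarrow> riemann_sphere).
         (\<forall>j. normalized_koebe_map a0 a1 a2 (\<Phi> j) (f j)) \<and>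
         locally_uniform_limit D f f_\<Phi> \<and>
         conformal_on f_\<Phi> D \<and>
         \<not> circle_domain (f_\<Phi> ` D)))"
proof -
  define S :: "complex set" where "S = - \<real>\<^sub>\<le>\<^sub>0"
  obtain P \<delta> :: "nat \<Rightarrow> real" where seq: "\<And>j. admissible (P j) (\<delta> j)" "\<And>j. real j < P j"
     "\<And>j. exhaust_compact j \<subseteq> ring_dom (P j) (\<delta> j)" "\<And>j. ring_dom (P j) (\<delta> j) \<subseteq> ring_dom (P (Suc j)) (\<delta> (Suc j))"
    using ring_sequence by blast
  have P_lim: "filterlim P at_top sequentially"
    by (rule filterlim_at_top_mono[OF filterlim_real_sequentially]) (intro always_eventually allI less_imp_le seq(2))
  define R where "R j = ring_dom (P j) (\<delta> j)" for j
  have loc: "periodic_slit_map (P j)" and ne: "periodic_slit_map.\<beta>1 (P j) \<noteq> periodic_slit_map.\<beta>2 (P j)"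
    and \<delta>: "0 < \<delta> j" "\<delta> j < pi" for j
    using seq(1)[of j] by (auto simp: admissible_def periodic_slit_map_def)
  note substrip_strip = periodic_slit_map.substrip_strip[OF loc ne \<delta>]
  have R_S: "R j \<subseteq> S" for j
    using periodic_slit_map.strip_map_avoids_nonpos_Reals[OF loc] substrip_strip unfolding R_def S_def by blast
  have R_open: "open (R j)" for j unfolding R_def by (rule periodic_slit_map.open_ring[OF loc ne \<delta>])
  have R_conn: "connected (R j)" for j unfolding R_def by (rule periodic_slit_map.connected_ring[OF loc ne \<delta>])
  have R_ne: "R j \<noteq> {}" for j using periodic_slit_map.zero_in_substrip[OF loc ne \<delta>] unfolding R_def by blast
  have R_hol: "annulus_map_of (P j) holomorphic_on R j" for j
    unfolding R_def by (rule holomorphic_on_subset[OF periodic_slit_map.holomorphic_annulus_map[OF loc ne]]) (use substrip_strip in blast)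
  have R_inj: "inj_on (annulus_map_of (P j)) (R j)" for j
    unfolding R_def by (rule inj_on_subset[OF periodic_slit_map.inj_on_annulus_map[OF loc ne]]) (use substrip_strip in blast)
  have R_UN: "(\<Union>j. R j) = S"
  proof (intro equalityI subsetI)
    fix w assume "w \<in> S"
    then obtain n where "w \<in> exhaust_compact n" using exhaust_compact_UN[of w] by (auto simp: S_def)
    then show "w \<in> (\<Union>j. R j)" using seq(3)[of n] unfolding R_def by blast
  qed (use R_S in blast)
  have R_mono: "R 0 \<subseteq> R j" for j
  proof (induction j)
    case (Suc j)
    have "R j \<subseteq> R (Suc j)" unfolding R_def by (rule seq(4))
    with Suc show ?case by (rule subset_trans)
  qed (rule subset_refl)
  have exh: "exhaustion (Fin ` S) (\<lambda>j. Fin ` R j)"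
    unfolding exhaustion_def
  proof (intro conjI allI)
    fix j
    show "sphere_domain (Fin ` R j)" by (intro sphere_domain_Fin R_open R_conn R_ne)
    show "Fin ` R j \<subseteq> Fin ` S" using R_S by blast
    show "\<exists>\<J>. finite \<J> \<and> pairwise disjnt \<J> \<and> (\<forall>J\<in>\<J>. jordan_curve J \<and> J \<subseteq> Fin ` S) \<and> frontier (Fin ` R j) = \<Union>\<J>"
      unfolding R_def S_def by (rule periodic_slit_map.ring_bounded_by_Jordan_curves[OF loc ne \<delta>])
    show "Fin ` R j \<subseteq> Fin ` R (Suc j)" using seq(4) unfolding R_def by blast
    show "Fin ` S = (\<Union>j. Fin ` R j)" unfolding R_UN[symmetric] by blast
  qed
  have "\<exists>f f_\<Phi>. (\<forall>j. normalized_koebe_map a0 a1 a2 (Fin ` R j) (f j)) \<and> locally_uniform_limit (Fin ` S) f f_\<Phi> \<and>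
         conformal_on f_\<Phi> (Fin ` S) \<and> \<not> circle_domain (f_\<Phi> ` Fin ` S)"
    if a: "{a0, a1, a2} \<subseteq> Fin ` R 0" "a0 \<noteq> a1" "a0 \<noteq> a2" "a1 \<noteq> a2" for a0 a1 a2
  proof -
    obtain w0 w1 w2 where w: "a0 = Fin w0" "a1 = Fin w1" "a2 = Fin w2" and wR0: "w0 \<in> R 0" "w1 \<in> R 0" "w2 \<in> R 0"
      using a(1) by auto
    have wne: "w0 \<noteq> w1" "w0 \<noteq> w2" "w1 \<noteq> w2" using a w by auto
    have wR: "w0 \<in> R j" "w1 \<in> R j" "w2 \<in> R j" for j using wR0 R_mono by auto
    define A where "A j = interp_a (annulus_map_of (P j) w0) (annulus_map_of (P j) w1) (annulus_map_of (P j) w2) w0 w1 w2" for j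
    define B where "B j = interp_b (annulus_map_of (P j) w0) (annulus_map_of (P j) w1) (annulus_map_of (P j) w2) w0 w1 w2" for j
    define C where "C j = interp_c (annulus_map_of (P j) w0) (annulus_map_of (P j) w1) (annulus_map_of (P j) w2) w0 w1 w2" for j
    define D where "D j = interp_d (annulus_map_of (P j) w0) (annulus_map_of (P j) w1) (annulus_map_of (P j) w2) w0 w1 w2" for j
    define a b c d where "a = interp_a (Ln w0) (Ln w1) (Ln w2) w0 w1 w2" and "b = interp_b (Ln w0) (Ln w1) (Ln w2) w0 w1 w2"
      and "c = interp_c (Ln w0) (Ln w1) (Ln w2) w0 w1 w2" and "d = interp_d (Ln w0) (Ln w1) (Ln w2) w0 w1 w2"
    define f where "f j p = moebius (A j) (B j) (C j) (D j) (Fin (annulus_map_of (P j) (fin_part p)))" for j p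
    define flim where "flim p = moebius a b c d (Fin (Ln (fin_part p)))" for p
    have gne: "annulus_map_of (P j) w0 \<noteq> annulus_map_of (P j) w1" "annulus_map_of (P j) w0 \<noteq> annulus_map_of (P j) w2" "annulus_map_of (P j) w1 \<noteq> annulus_map_of (P j) w2" for j
      using wR[of j] wne inj_onD[OF R_inj[of j]] by blast+
    have Dj: "A j * D j - B j * C j \<noteq> 0" for j
      unfolding A_def B_def C_def D_def by (rule interp_det_nonzero[OF gne wne])
    have wS: "w0 \<in> S" "w1 \<in> S" "w2 \<in> S" using wR0 R_S by auto
    have Ln_inj: "inj_on Ln S" by (rule inj_onI) (metis ComplD S_def exp_Ln nonpos_Reals_zero_I)
    have Lne: "Ln w0 \<noteq> Ln w1" "Ln w0 \<noteq> Ln w2" "Ln w1 \<noteq> Ln w2"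
      using wS wne inj_onD[OF Ln_inj] by blast+
    have Dn: "a * d - b * c \<noteq> 0" unfolding a_def b_def c_def d_def by (rule interp_det_nonzero[OF Lne wne])
    have koebe: "normalized_koebe_map a0 a1 a2 (Fin ` R j) (f j)" for j
      unfolding normalized_koebe_map_def
    proof (intro conjI)
      show "conformal_on (f j) (Fin ` R j)"
        unfolding f_def[abs_def] by (rule conformal_on_moebius_Fin[OF Dj R_open R_hol R_inj])
      have "f j ` Fin ` R j = moebius (A j) (B j) (C j) (D j) ` Fin ` annulus_map_of (P j) ` R j"
        by (simp add: f_def image_image)
      then show "circle_domain (f j ` Fin ` R j)"
        using periodic_slit_map.circle_domain_moebius_ring[OF loc ne \<delta> Dj] by (simp add: R_def)
      show "f j a0 = a0" "f j a1 = a1" "f j a2 = a2"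
        unfolding f_def w fin_part.simps A_def B_def C_def D_def by (rule moebius_interp[OF gne wne])+
    qed
    have lim: "(\<lambda>j. annulus_map_of (P j) w) \<longlonglongrightarrow> Ln w" if "w \<in> S" for w
    proof -
      have u: "uniform_limit {w} (\<lambda>j. annulus_map_of (P j)) Ln sequentially"
        by (rule uniform_limit_annulus_map[OF _ _ P_lim]) (use that in \<open>simp_all add: S_def\<close>)
      show ?thesis by (rule tendsto_uniform_limitI[OF u]) simp
    qed
    have coeff: "A \<longlonglongrightarrow> a" "B \<longlonglongrightarrow> b" "C \<longlonglongrightarrow> c" "D \<longlonglongrightarrow> d"
      unfolding A_def[abs_def] B_def[abs_def] C_def[abs_def] D_def[abs_def] a_def b_def c_def d_def
      by (intro tendsto_interp lim wS)+
    have "locally_uniform_limit (Fin ` S) f flim"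
      unfolding locally_uniform_limit_def
    proof
      fix p assume "p \<in> Fin ` S"
      then obtain w where w: "w \<in> S" "p = Fin w" by blast
      then obtain r where r: "r > 0" "cball w r \<subseteq> S"
        using open_slit_plane open_contains_cball unfolding S_def by blast
      have "uniform_limit (cball w r) (\<lambda>j. annulus_map_of (P j)) Ln sequentially"
        by (rule uniform_limit_annulus_map[OF compact_cball _ P_lim]) (use r S_def in blast)
      then have u: "uniform_limit (ball w r) (\<lambda>j. annulus_map_of (P j)) Ln sequentially"
        by (rule uniform_limit_on_subset) (rule ball_subset_cball)
      show "\<exists>U. open U \<and> p \<in> U \<and> U \<subseteq> Fin ` S \<and> uniform_limit U f flim sequentially"
      proof (intro exI conjI)
        show "open (Fin ` ball w r)" by (intro open_Fin_image open_ball)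
        show "p \<in> Fin ` ball w r" using w r by simp
        show "Fin ` ball w r \<subseteq> Fin ` S" using r(2) ball_subset_cball by blast
        show "uniform_limit (Fin ` ball w r) f flim sequentially"
          unfolding f_def[abs_def] flim_def[abs_def] by (rule uniform_limit_moebius[OF u coeff Dn Dj])
      qed
    qed
    moreover have "conformal_on flim (Fin ` S)"
      unfolding flim_def[abs_def]
    proof (rule conformal_on_moebius_Fin[OF Dn _ _ Ln_inj])
      show "open S" unfolding S_def by (rule open_slit_plane)
      show "Ln holomorphic_on S" by (intro holomorphic_on_Ln) (auto simp: S_def)
    qed
    moreover have "flim ` Fin ` S = moebius a b c d ` Fin ` {z. \<bar>Im z\<bar> < pi}"
      unfolding Ln_image_slit_plane[symmetric] S_def by (simp add: flim_def image_image)
    then have "\<not> circle_domain (flim ` Fin ` S)" using moebius_strip_not_circle_domain[OF Dn] by simp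
    ultimately show ?thesis using koebe by blast
  qed
  moreover have "sphere_domain (Fin ` S)"
    unfolding S_def by (intro sphere_domain_Fin open_slit_plane connected_slit_plane) (use exhaust_compact_UN in \<open>auto intro!: exI[of _ 1]\<close>)
  moreover have "countably_connected (Fin ` S)" unfolding S_def by (rule countably_connected_slit_plane)
  ultimately show ?thesis using exh by (intro exI[of _ "Fin ` S"] exI[of _ "\<lambda>j. Fin ` R j"]) blast
qed

end
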